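(* Let $n\ge2$, let $G\subsetneq\mathbb{R}^n$ be a proper subdomain, and let $h:G\to h(G)\subset\mathbb{R}^n$ be harmonic and $K$-quasiconformal for some $K\ge1$. Then $h:(G,k_G)\to(h(G),k_{h(G)})$ is a pseudo-isometry.
   Context: A mapping is harmonic if each of its components is a harmonic function. The quasihyperbolic metric of a proper subdomain $D\subsetneq\mathbb{R}^n$ is $k_D(x,y)=\inf_\gamma\int_\gamma \frac{ds}{d(z,\partial D)}$ (infimum over rectifiable curves in $D$ joining $x$ to $y$), $d(z,\partial D)$ being Euclidean distance to the boundary. A map $f:(M,d_M)\to(N,d_N)$ between metric spaces is a pseudo-isometry if there are positive constants $a,b$ with $a^{-1}d_M(x,y)-b\le d_N(f(x),f(y))\le a\,d_M(x,y)$ for all $x,y\in M$. A homeomorphism $h$ between domains of $\mathbb{R}^n$ is $K$-quasiconformal if it is ACL$^n$ (absolutely continuous on almost all lines parallel to the axes, with partial derivatives locally in $L^n$) and a.e. satisfies $|h'(x)|^n\le KJ_h(x)$ and $J_h(x)\le K\,l(h'(x))^n$, where $|h'(x)|=\max_{|v|=1}|h'(x)v|$, $l(h'(x))=\min_{|v|=1}|h'(x)v|$ and $J_h$ is the Jacobian determinant. *)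

theory Defs
  imports "HOL-Analysis.Analysis"
begin

section \<open>Domains, partial derivatives, harmonic mappings\<close>

definition domain_set :: "'a::topological_space set \<Rightarrow> bool"
  where "domain_set D \<longleftrightarrow> open D \<and> connected D \<and> D \<noteq> {}"

text \<open>Where the partial derivative does not exist, the value is arbitrary.\<close>

definition partial_deriv ::
    "'n \<Rightarrow> (real^'n \<Rightarrow> 'b::real_normed_vector) \<Rightarrow> real^'n \<Rightarrow> 'b"
  where "partial_deriv i f x = vector_derivative (\<lambda>t. f (x + t *\<^sub>R axis i 1)) (at 0)"

text \<open>The first three conjuncts say that \<open>u\<close> is twice continuously differentiable
  on the open set \<open>D\<close>.\<close>

definition harmonic_on :: "(real^'n) set \<Rightarrow> (real^'n \<Rightarrow> real) \<Rightarrow> bool"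
  where "harmonic_on D u \<longleftrightarrow>
    (\<forall>x\<in>D. u differentiable (at x)) \<and>
    (\<forall>i. \<forall>x\<in>D. partial_deriv i u differentiable (at x)) \<and>
    (\<forall>i j. continuous_on D (partial_deriv j (partial_deriv i u))) \<and>
    (\<forall>x\<in>D. (\<Sum>i\<in>UNIV. partial_deriv i (partial_deriv i u) x) = 0)"

definition harmonic_map_on :: "(real^'n) set \<Rightarrow> (real^'n \<Rightarrow> real^'m) \<Rightarrow> bool"
  where "harmonic_map_on D h \<longleftrightarrow> (\<forall>i. harmonic_on D (\<lambda>x. h x $ i))"

section \<open>Rectifiable curves and the quasihyperbolic metric\<close>

definition polygon_length :: "(real \<Rightarrow> 'a::metric_space) \<Rightarrow> real list \<Rightarrow> real"
  where "polygon_length \<gamma> ts = (\<Sum>i<length ts - 1. dist (\<gamma> (ts ! i)) (\<gamma> (ts ! Suc i)))"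

definition rectifiable_path :: "(real \<Rightarrow> 'a::metric_space) \<Rightarrow> bool"
  where "rectifiable_path \<gamma> \<longleftrightarrow>
    path \<gamma> \<and> bdd_above (polygon_length \<gamma> ` {ts. sorted ts \<and> set ts \<subseteq> {0..1}})"

text \<open>Length of the restriction of \<open>\<gamma>\<close> to \<open>[0,t]\<close>; meaningful for rectifiable \<open>\<gamma>\<close>.\<close>

definition length_upto :: "(real \<Rightarrow> 'a::metric_space) \<Rightarrow> real \<Rightarrow> real"
  where "length_upto \<gamma> t = (SUP ts\<in>{ts. sorted ts \<and> set ts \<subseteq> {0..t}}. polygon_length \<gamma> ts)"

text \<open>The choice of the parameter \<open>t\<close> is immaterial, since a rectifiable \<open>\<gamma>\<close> is constant on every
  parameter interval on which \<open>length_upto \<gamma>\<close> is constant.\<close>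

definition arclength_param :: "(real \<Rightarrow> 'a::metric_space) \<Rightarrow> real \<Rightarrow> 'a"
  where "arclength_param \<gamma> s = \<gamma> (SOME t. t \<in> {0..1} \<and> length_upto \<gamma> t = s)"

definition line_integral :: "(real \<Rightarrow> 'a::metric_space) \<Rightarrow> ('a \<Rightarrow> real) \<Rightarrow> real"
  where "line_integral \<gamma> \<rho> =
    integral {0..length_upto \<gamma> 1} (\<lambda>s. \<rho> (arclength_param \<gamma> s))"

definition quasihyperbolic :: "'a::metric_space set \<Rightarrow> 'a \<Rightarrow> 'a \<Rightarrow> real"
  where "quasihyperbolic D x y =
    Inf {line_integral \<gamma> (\<lambda>z. 1 / infdist z (frontier D)) |\<gamma>.
      rectifiable_path \<gamma> \<and> path_image \<gamma> \<subseteq> D \<and> pathstart \<gamma> = x \<and> pathfinish \<gamma> = y}"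

definition pseudo_isometry ::
    "'a set \<Rightarrow> ('a \<Rightarrow> 'a \<Rightarrow> real) \<Rightarrow> 'b set \<Rightarrow> ('b \<Rightarrow> 'b \<Rightarrow> real) \<Rightarrow> ('a \<Rightarrow> 'b) \<Rightarrow> bool"
  where "pseudo_isometry M dM N dN f \<longleftrightarrow> f \<in> M \<rightarrow> N \<and>
    (\<exists>a>0. \<exists>b>0. \<forall>x\<in>M. \<forall>y\<in>M.
      inverse a * dM x y - b \<le> dN (f x) (f y) \<and> dN (f x) (f y) \<le> a * dM x y)"

section \<open>Quasiconformal mappings\<close>

definition abs_continuous_on_interval ::
    "real \<Rightarrow> real \<Rightarrow> (real \<Rightarrow> 'a::real_normed_vector) \<Rightarrow> bool"
  where "abs_continuous_on_interval a b f \<longleftrightarrow>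
    (\<forall>\<epsilon>>0. \<exists>\<delta>>0. \<forall>\<D>. \<D> division_of \<Union>\<D> \<longrightarrow> \<Union>\<D> \<subseteq> {a..b} \<longrightarrow>
      (\<Sum>I\<in>\<D>. Sup I - Inf I) < \<delta> \<longrightarrow> (\<Sum>I\<in>\<D>. norm (f (Sup I) - f (Inf I))) < \<epsilon>)"

text \<open>Lines parallel to the \<open>i\<close>-th axis are indexed by their remaining coordinates
  \<open>y\<close>, and ``almost every line'' refers to \<open>(n-1)\<close>-dimensional Lebesgue measure,
  here the product measure over the index set \<open>UNIV - {i}\<close>.\<close>

definition ACL_on :: "(real^'n) set \<Rightarrow> (real^'n \<Rightarrow> real^'m) \<Rightarrow> bool"
  where "ACL_on D f \<longleftrightarrow> continuous_on D f \<and>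
    (\<forall>a b i. cbox a b \<subseteq> D \<longrightarrow>
      (AE y in Pi\<^sub>M (UNIV - {i}) (\<lambda>_. lborel :: real measure).
        (\<forall>j. j \<noteq> i \<longrightarrow> y j \<in> {a $ j..b $ j}) \<longrightarrow>
        abs_continuous_on_interval (a $ i) (b $ i) (\<lambda>t. f (\<chi> j. if j = i then t else y j))))"

definition ACLp_on :: "nat \<Rightarrow> (real^'n) set \<Rightarrow> (real^'n \<Rightarrow> real^'m) \<Rightarrow> bool"
  where "ACLp_on p D f \<longleftrightarrow> ACL_on D f \<and>
    (\<forall>i F. compact F \<and> F \<subseteq> D \<longrightarrow>
      set_borel_measurable lebesgue F (partial_deriv i f) \<and>
      set_integrable lebesgue F (\<lambda>x. norm (partial_deriv i f x) ^ p))"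

text \<open>The formal derivative: an ACL map has partial derivatives almost everywhere.\<close>

definition deriv_matrix :: "(real^'n \<Rightarrow> real^'m) \<Rightarrow> real^'n \<Rightarrow> real^'n^'m"
  where "deriv_matrix f x = (\<chi> i j. partial_deriv j f x $ i)"

definition min_stretch :: "real^'n^'m \<Rightarrow> real"
  where "min_stretch A = (INF v\<in>sphere 0 1. norm (A *v v))"

text \<open>The operator norm below is \<open>max {norm (A *v v) | norm v = 1}\<close>.\<close>

definition quasiconformal ::
    "real \<Rightarrow> (real^'n) set \<Rightarrow> (real^'n) set \<Rightarrow> (real^'n \<Rightarrow> real^'n) \<Rightarrow> bool"
  where "quasiconformal K D D' h \<longleftrightarrow>
    domain_set D \<and> domain_set D' \<and> (\<exists>g. homeomorphism D D' h g) \<and>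
    ACLp_on CARD('n) D h \<and>
    (AE x in lebesgue. x \<in> D \<longrightarrow>
      onorm ((*v) (deriv_matrix h x)) ^ CARD('n) \<le> K * det (deriv_matrix h x) \<and>
      det (deriv_matrix h x) \<le> K * min_stretch (deriv_matrix h x) ^ CARD('n))"

end

theory Submission
  imports Defs
begin

text \<open>The map \<open>h\<close> is \<open>C\<^sup>1\<close>, so quasiconformality gives \<open>|h'|\<^sup>n \<le> K J\<close> everywhere, and a logarithmic
  cut-off of \<open>|h - u|\<close> across the ring \<open>s < |h - u| < 2\<^sup>N s\<close> has \<open>n\<close>-energy at most \<open>C N\<^sup>1\<^sup>-\<^sup>n\<close>. Loewner's
  estimate, a lower bound for the \<open>n\<close>-energy of a function with values \<open>0\<close> and \<open>1\<close> on two continua of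
  comparable size and distance, follows from a Poincare inequality by telescoping means over shrinking balls.
  Together they give two distortion estimates. First, \<open>|h y - h x| \<le> C d(h x, \<partial>h(G))\<close> for
  \<open>|y - x| \<le> d(x, \<partial>G) / 4\<close>; the gradient estimate for harmonic functions turns this into
  \<open>|h' x| d(x, \<partial>G) \<le> C d(h x, \<partial>h(G))\<close>, whence the upper bound. Second, \<open>h\<^sup>-\<^sup>1\<close> maps balls of radius
  \<open>c d(u, \<partial>h(G))\<close> into balls of bounded quasihyperbolic radius; chaining them gives the lower bound.\<close>

section \<open>Arc length and line integrals\<close>

text \<open>The inverse of a harmonic map is in general not harmonic, so the two directions are
  treated differently. The gradient estimate makes the upper bound infinitesimal, hence free of an
  additive term; for the inverse only whole balls are controlled, and counting the balls of a chain
  costs the additive constant. Both distortion estimates are proved by contradiction from the same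
  two energy bounds. The exponent of the energy equals the dimension, so that |h'|^n can be
  exchanged for the Jacobian and every dyadic layer of the ring, whatever its radius, contributes
  the same amount C / N^n. The total falls below the Loewner constant for large N because n >= 2,
  and 2^N becomes the distortion factor. That h(G) is not the whole space is not assumed; it comes
  out of the second distortion estimate.\<close>

abbreviation "len \<equiv> length_upto"
abbreviation "plen \<equiv> polygon_length"

lemma polygon_length_simps [simp]:
  "plen g [] = 0"
  "plen g [x] = 0"
  "plen g (x # y # r) = dist (g x) (g y) + plen g (y # r)"
  by (simp_all add: polygon_length_def sum.lessThan_Suc_shift del: sum.lessThan_Suc)

lemma polygon_length_append_le:
  "plen g xs + plen g ys \<le> plen g (xs @ ys)"
proof (induction xs rule: induct_list012)
  case (2 x)
  show ?case by (cases ys) auto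
qed auto

lemma polygon_length_insert:
  "plen g (xs @ ys) \<le> plen g (xs @ [a]) + plen g (a # ys)"
proof (induction xs rule: induct_list012)
  case 1
  show ?case by (cases ys) auto
next
  case (2 x)
  show ?case
    by (cases ys) (auto simp: dist_triangle add.assoc[symmetric] intro: add_right_mono)
qed auto

lemma polygon_length_bound:
  assumes "\<And>s t. s \<in> set ts \<Longrightarrow> t \<in> set ts \<Longrightarrow> dist (g s) (g t) \<le> k"
  shows "plen g ts \<le> real (length ts - 1) * k"
proof -
  have "plen g ts \<le> (\<Sum>i<length ts - 1. (k::real))"
    unfolding polygon_length_def by (intro sum_mono assms nth_mem) auto
  then show ?thesis by simp
qed

lemma polygon_length_telescope:
  assumes "\<And>s t. s \<in> set ts \<Longrightarrow> t \<in> set ts \<Longrightarrow> s \<le> t \<Longrightarrow> dist (g s) (g t) \<le> F t - F s"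
    and "sorted ts" and "ts \<noteq> []"
  shows "plen g ts \<le> F (last ts) - F (hd ts)"
  using assms
proof (induction ts rule: induct_list012)
  case (3 x y zs)
  have "plen g (y # zs) \<le> F (last (y # zs)) - F (hd (y # zs))"
    using 3 by (intro "3.IH") auto
  moreover have "dist (g x) (g y) \<le> F y - F x" using 3 by auto
  ultimately show ?case by simp
qed auto

lemma rectifiable_pathD:
  assumes "rectifiable_path g"
  shows "continuous_on {0..1} g"
  using assms by (simp add: rectifiable_path_def path_def)

lemma polygon_length_le_length_upto:
  assumes "rectifiable_path g" "t \<le> 1" "sorted ts" "set ts \<subseteq> {0..t}"
  shows "plen g ts \<le> len g t"
  unfolding length_upto_def
proof (rule cSUP_upper)
  have "bdd_above (plen g ` {ts. sorted ts \<and> set ts \<subseteq> {0..1}})"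
    using assms(1) by (simp add: rectifiable_path_def)
  then show "bdd_above (plen g ` {ts. sorted ts \<and> set ts \<subseteq> {0..t}})"
    by (rule bdd_above_mono) (intro image_mono, use assms(2) in auto)
qed (use assms in auto)

lemma length_upto_least:
  assumes "\<And>ts. sorted ts \<Longrightarrow> set ts \<subseteq> {0..t} \<Longrightarrow> plen g ts \<le> B"
  shows "len g t \<le> B"
  unfolding length_upto_def
proof (rule cSUP_least)
  have "[] \<in> {ts. sorted ts \<and> set ts \<subseteq> {0..t}}" by simp
  then show "{ts. sorted ts \<and> set ts \<subseteq> {0..t}} \<noteq> {}" by blast
qed (use assms in auto)

lemma length_upto_add_le:
  assumes "rectifiable_path g" "0 \<le> a" "a \<le> b" "b \<le> 1" "sorted ts" "set ts \<subseteq> {a..b}"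
  shows "len g a + plen g ts \<le> len g b"
proof -
  have "len g a \<le> len g b - plen g ts"
  proof (rule length_upto_least)
    fix us assume us: "sorted us" "set us \<subseteq> {0..a}"
    have "plen g us + plen g ts \<le> plen g (us @ ts)"
      by (rule polygon_length_append_le)
    also have "\<dots> \<le> len g b"
      using us assms by (intro polygon_length_le_length_upto) (fastforce simp: sorted_append)+
    finally show "plen g us \<le> len g b - plen g ts" by simp
  qed
  then show ?thesis by simp
qed

lemma dist_le_length_upto:
  assumes "rectifiable_path g" "0 \<le> a" "a \<le> b" "b \<le> 1"
  shows "dist (g a) (g b) \<le> len g b - len g a"
  using length_upto_add_le[OF assms, of "[a,b]"] assms by simp

lemma length_upto_mono:
  assumes "rectifiable_path g" "0 \<le> a" "a \<le> b" "b \<le> 1"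
  shows "len g a \<le> len g b"
  using length_upto_add_le[OF assms, of "[]"] by simp

lemma sorted_split:
  fixes ts :: "real list"
  assumes "sorted ts"
  obtains us vs where "ts = us @ vs" "sorted us" "sorted vs"
    "\<And>t. t \<in> set us \<Longrightarrow> t \<le> a" "\<And>t. t \<in> set vs \<Longrightarrow> a \<le> t"
proof -
  have "\<exists>us vs. ts = us @ vs \<and> (\<forall>t\<in>set us. t \<le> a) \<and> (\<forall>t\<in>set vs. a \<le> t)"
    using assms
  proof (induction ts)
    case (Cons t ts)
    show ?case
    proof (cases "t \<le> a")
      case True
      from Cons obtain us vs where "ts = us @ vs" "\<forall>t\<in>set us. t \<le> a" "\<forall>t\<in>set vs. a \<le> t" by auto
      with True show ?thesis by (intro exI[of _ "t # us"] exI[of _ vs]) auto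
    next
      case False
      with Cons.prems show ?thesis by (intro exI[of _ "[]"] exI[of _ "t # ts"]) auto
    qed
  qed simp
  then show thesis using that assms by (auto simp: sorted_append)
qed

text \<open>A polygon does not get shorter when \<open>a\<close> is inserted as a vertex, and then
  it splits there. The bound \<open>B\<close> is left abstract, so that a piece of a curve can be
  measured by any estimate for its polygons.\<close>

lemma length_upto_le_add:
  assumes "rectifiable_path g" "0 \<le> a" "a \<le> b" "b \<le> 1"
    and B: "\<And>ts. sorted ts \<Longrightarrow> set ts \<subseteq> {a..b} \<Longrightarrow> plen g ts \<le> B"
  shows "len g b \<le> len g a + B"
proof (rule length_upto_least)
  fix ts assume ts: "sorted ts" "set ts \<subseteq> {0..b}"
  obtain us vs where uv: "ts = us @ vs" "sorted us" "sorted vs"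
    "\<And>t. t \<in> set us \<Longrightarrow> t \<le> a" "\<And>t. t \<in> set vs \<Longrightarrow> a \<le> t"
    by (rule sorted_split[OF ts(1), of a]) blast
  have "plen g ts \<le> plen g (us @ [a]) + plen g (a # vs)"
    unfolding uv(1) by (rule polygon_length_insert)
  also have "plen g (us @ [a]) \<le> len g a"
    using uv assms ts by (intro polygon_length_le_length_upto) (auto simp: sorted_append)
  also have "plen g (a # vs) \<le> B"
    using uv assms ts by (intro B) auto
  finally show "plen g ts \<le> len g a + B" by simp
qed

text \<open>A polygon whose length is within \<open>e/2\<close> of the total leaves little for a
  short interval \<open>{a..b}\<close>: its part outside is at most the length of the curve outside,
  and its few edges inside are short by uniform continuity of \<open>g\<close>.\<close>

lemma length_upto_continuous:
  assumes r: "rectifiable_path g"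
  shows "continuous_on {0..1} (len g)"
proof -
  have main: "\<exists>d>0. \<forall>a b. 0 \<le> a \<and> a \<le> b \<and> b \<le> 1 \<and> b - a < d \<longrightarrow>
      len g b - len g a < e" if e: "e > 0" for e
  proof -
    have "\<exists>ts\<in>{ts. sorted ts \<and> set ts \<subseteq> {0..1}}. len g 1 - e/2 < plen g ts"
    proof (rule ccontr)
      assume "\<not> ?thesis"
      then have "len g 1 \<le> len g 1 - e/2"
        by (intro length_upto_least) (auto simp: not_less)
      with e show False by simp
    qed
    then obtain ts where ts: "sorted ts" "set ts \<subseteq> {0..1}"
      "len g 1 - e/2 < plen g ts" by auto
    \<comment> \<open>Between the inserted vertices \<open>a\<close> and \<open>b\<close> there are
      at most \<open>length ts + 1\<close> edges, each of length at most \<open>k\<close>, hence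
      \<open>e/2\<close> in all.\<close>
    define k where "k = e / (2 * (real (length ts) + 1))"
    have k: "k > 0" using e by (simp add: k_def)
    have "uniformly_continuous_on {0..1} g"
      using rectifiable_pathD[OF r] compact_uniformly_continuous by blast
    then obtain d where d: "d > 0"
      "\<And>s t. s \<in> {0..1} \<Longrightarrow> t \<in> {0..1} \<Longrightarrow> dist s t < d \<Longrightarrow> dist (g s) (g t) < k"
      using k unfolding uniformly_continuous_on_def by metis
    have "len g b - len g a < e"
      if ab: "0 \<le> a" "a \<le> b" "b \<le> 1" "b - a < d" for a b
    proof -
      obtain us vs where uv: "ts = us @ vs" "sorted us" "sorted vs"
        "\<And>t. t \<in> set us \<Longrightarrow> t \<le> a" "\<And>t. t \<in> set vs \<Longrightarrow> a \<le> t"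
        by (rule sorted_split[OF ts(1), of a]) blast
      obtain ms ws where mw: "vs = ms @ ws" "sorted ms" "sorted ws"
        "\<And>t. t \<in> set ms \<Longrightarrow> t \<le> b" "\<And>t. t \<in> set ws \<Longrightarrow> b \<le> t"
        by (rule sorted_split[OF uv(3), of b]) blast
      have "plen g ts \<le> plen g (us @ [a]) + plen g ((a # ms) @ ws)"
        unfolding uv(1) mw(1) using polygon_length_insert[of g us "ms @ ws" a] by simp
      also have "\<dots> \<le> plen g (us @ [a]) +
          (plen g ((a # ms) @ [b]) + plen g (b # ws))"
        by (intro add_left_mono polygon_length_insert)
      also have "plen g (us @ [a]) \<le> len g a"
        using uv r ts ab by (intro polygon_length_le_length_upto) (auto simp: sorted_append)
      also have "plen g (b # ws) \<le> len g 1 - len g b"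
      proof -
        have "set (b # ws) \<subseteq> {b..1}" using mw uv ts ab by auto
        then show ?thesis
          using length_upto_add_le[OF r, of b 1 "b # ws"] mw ab by auto
      qed
      also have "plen g ((a # ms) @ [b]) \<le> real (length ((a # ms) @ [b]) - 1) * k"
      proof (rule polygon_length_bound)
        fix s t assume "s \<in> set ((a # ms) @ [b])" "t \<in> set ((a # ms) @ [b])"
        then have "s \<in> {a..b}" "t \<in> {a..b}" using mw uv ab by auto
        then show "dist (g s) (g t) \<le> k"
          using ab by (intro less_imp_le d(2)) (auto simp: dist_real_def)
      qed
      also have "\<dots> \<le> (real (length ts) + 1) * k"
        using k by (intro mult_right_mono) (auto simp: uv mw)
      also have "\<dots> = e / 2"
      proof -
        have "k * (e / (2 * k)) = e / 2" if "k > 0" for k :: real using that by simp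
        from this[of "real (length ts) + 1"] show ?thesis by (simp add: k_def)
      qed
      finally show ?thesis using ts(3) by simp
    qed
    with d(1) show ?thesis by blast
  qed
  show ?thesis
    unfolding continuous_on_iff
  proof (intro ballI allI impI)
    fix t e :: real assume t: "t \<in> {0..1}" and e: "0 < e"
    from main[OF e] obtain d where d: "d>0" "\<And>a b. 0 \<le> a \<Longrightarrow> a \<le> b \<Longrightarrow> b \<le> 1 \<Longrightarrow> b - a < d \<Longrightarrow>
      len g b - len g a < e" by blast
    have "dist (len g s) (len g t) < e" if s: "s \<in> {0..1}" "dist s t < d" for s
    proof (cases "s \<le> t")
      case True
      then show ?thesis using d(2)[of s t] length_upto_mono[OF r, of s t] s t
        by (auto simp: dist_real_def)
    next
      case False
      then show ?thesis using d(2)[of t s] length_upto_mono[OF r, of t s] s t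
        by (auto simp: dist_real_def)
    qed
    with d(1) show "\<exists>d>0. \<forall>x'\<in>{0..1}. dist x' t < d \<longrightarrow> dist (len g x') (len g t) < e"
      by blast
  qed
qed

lemma length_upto_0 [simp]: "len g 0 = 0"
proof -
  have z: "plen g ts = 0" if "set ts \<subseteq> {0..0}" for ts
  proof -
    have "ts ! i = 0" if "i < length ts" for i
      using that \<open>set ts \<subseteq> {0..0}\<close> nth_mem by fastforce
    then show ?thesis unfolding polygon_length_def by (intro sum.neutral) auto
  qed
  have "plen g ` {ts. sorted ts \<and> set ts \<subseteq> {0..0}} = {0}"
    using z by (auto simp: image_iff intro!: exI[of _ "[]"])
  then show ?thesis unfolding length_upto_def by simp
qed

section \<open>Arc length parametrization and partial line integrals\<close>

lemma arclength_param_length_upto: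
  assumes r: "rectifiable_path g" and t: "t \<in> {0..1}"
  shows "arclength_param g (len g t) = g t"
proof -
  define u where "u = (SOME u. u \<in> {0..1} \<and> len g u = len g t)"
  have u: "u \<in> {0..1}" "len g u = len g t"
    using someI[of "\<lambda>u. u \<in> {0..1} \<and> len g u = len g t" t] t
    unfolding u_def by auto
  have "dist (g u) (g t) \<le> 0"
  proof (cases "u \<le> t")
    case True
    then show ?thesis using dist_le_length_upto[OF r, of u t] u t by auto
  next
    case False
    then show ?thesis using dist_le_length_upto[OF r, of t u] u t by (auto simp: dist_commute)
  qed
  then show ?thesis by (simp add: arclength_param_def u_def)
qed

lemma length_upto_IVT:
  assumes r: "rectifiable_path g" and "0 \<le> a" "a \<le> b" "b \<le> 1"
    and "s \<in> {len g a..len g b}"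
  obtains t where "t \<in> {a..b}" "len g t = s"
proof -
  have "continuous_on {a..b} (len g)"
    using length_upto_continuous[OF r] by (rule continuous_on_subset) (use assms in auto)
  then show thesis
    using IVT'[of "len g" a s b] assms that by auto
qed

lemma arclength_param_continuous:
  assumes r: "rectifiable_path g"
  shows "continuous_on {0..len g 1} (arclength_param g)"
    and "arclength_param g ` {0..len g 1} \<subseteq> path_image g"
proof -
  let ?\<sigma> = "arclength_param g"
  have ex: "\<exists>t\<in>{0..1}. len g t = s" if "s \<in> {0..len g 1}" for s
    using length_upto_IVT[OF r, of 0 1 s] that by (metis length_upto_0 order_refl zero_le_one)
  have lip: "dist (?\<sigma> s) (?\<sigma> s') \<le> s' - s"
    if ss: "s \<in> {0..len g 1}" "s' \<in> {0..len g 1}" "s \<le> s'" for s s'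
  proof -
    obtain t where t: "t \<in> {0..1}" "len g t = s" using ex[OF ss(1)] by blast
    obtain t' where t': "t' \<in> {0..1}" "len g t' = s'" using ex[OF ss(2)] by blast
    show ?thesis
    proof (cases "t \<le> t'")
      case True
      then show ?thesis
        using dist_le_length_upto[OF r, of t t'] t t' arclength_param_length_upto[OF r] by auto
    next
      case False
      then have "s' \<le> s" using length_upto_mono[OF r, of t' t] t t' by auto
      with ss(3) have "s' = s" by simp
      then show ?thesis by simp
    qed
  qed
  show "continuous_on {0..len g 1} ?\<sigma>"
    unfolding continuous_on_iff
  proof (intro ballI allI impI)
    fix s e :: real assume s: "s \<in> {0..len g 1}" "0 < e"
    have "dist (?\<sigma> s') (?\<sigma> s) < e" if "s' \<in> {0..len g 1}" "dist s' s < e" for s'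
      using lip[of s s'] lip[of s' s] s that
      by (cases "s \<le> s'") (auto simp: dist_real_def dist_commute)
    with s show "\<exists>d>0. \<forall>x'\<in>{0..len g 1}. dist x' s < d \<longrightarrow> dist (?\<sigma> x') (?\<sigma> s) < e"
      by blast
  qed
  show "?\<sigma> ` {0..len g 1} \<subseteq> path_image g"
  proof clarify
    fix s assume "s \<in> {0..len g 1}"
    then obtain t where t: "t \<in> {0..1}" "len g t = s" using ex by blast
    then show "?\<sigma> s \<in> path_image g"
      using arclength_param_length_upto[OF r t(1)] by (auto simp: path_image_def)
  qed
qed

definition line_integral_upto :: "(real \<Rightarrow> 'a::metric_space) \<Rightarrow> ('a \<Rightarrow> real) \<Rightarrow> real \<Rightarrow> real"
  where "line_integral_upto g w t =
    integral {0..len g t} (\<lambda>s. w (arclength_param g s))"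

lemma line_integral_upto_simps [simp]:
  "line_integral_upto g w 0 = 0" "line_integral_upto g w 1 = line_integral g w"
  by (simp_all add: line_integral_upto_def line_integral_def)

context
  fixes g :: "real \<Rightarrow> 'a::metric_space" and w :: "'a \<Rightarrow> real"
  assumes r: "rectifiable_path g" and w: "continuous_on (path_image g) w"
begin

lemma density_arclength_continuous:
  "continuous_on {0..len g 1} (\<lambda>s. w (arclength_param g s))"
  using continuous_on_compose2[OF w arclength_param_continuous(1)[OF r]
      arclength_param_continuous(2)[OF r]] .

lemma line_integral_upto_diff:
  assumes "0 \<le> a" "a \<le> b" "b \<le> 1"
  shows "line_integral_upto g w b - line_integral_upto g w a =
      integral {len g a..len g b} (\<lambda>s. w (arclength_param g s))"
proof -
  have m: "0 \<le> len g a" "len g a \<le> len g b"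
     "len g b \<le> len g 1"
    using length_upto_mono[OF r, of 0 a] length_upto_mono[OF r, of a b]
      length_upto_mono[OF r, of b 1] assms by auto
  have "(\<lambda>s. w (arclength_param g s)) integrable_on {0..len g b}"
    by (intro integrable_continuous_real continuous_on_subset[OF density_arclength_continuous])
      (use m in auto)
  from Henstock_Kurzweil_Integration.integral_combine[OF m(1,2) this]
  show ?thesis by (simp add: line_integral_upto_def)
qed

lemma line_integral_upto_continuous: "continuous_on {0..1} (line_integral_upto g w)"
proof -
  have "continuous_on {0..len g 1} (\<lambda>x. integral {0..x} (\<lambda>s. w (arclength_param g s)))"
    by (intro indefinite_integral_continuous_1 integrable_continuous_real
        density_arclength_continuous)
  then show ?thesis
    unfolding line_integral_upto_def
    using length_upto_mono[OF r, of 0] length_upto_mono[OF r, of _ 1]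
    by (intro continuous_on_compose2[OF _ length_upto_continuous[OF r]]) auto
qed

lemma line_integral_upto_ge:
  assumes ab: "0 \<le> a" "a \<le> b" "b \<le> 1" and B: "\<And>t. t \<in> {a..b} \<Longrightarrow> B \<le> w (g t)"
  shows "B * (len g b - len g a) \<le>
      line_integral_upto g w b - line_integral_upto g w a"
proof -
  have m: "0 \<le> len g a" "len g a \<le> len g b"
     "len g b \<le> len g 1"
    using length_upto_mono[OF r, of 0 a] length_upto_mono[OF r, of a b]
      length_upto_mono[OF r, of b 1] ab by auto
  have "integral {len g a..len g b} (\<lambda>s. B) \<le>
     integral {len g a..len g b} (\<lambda>s. w (arclength_param g s))"
  proof (rule integral_le)
    show "(\<lambda>s. w (arclength_param g s)) integrable_on {len g a..len g b}"
      by (intro integrable_continuous_real continuous_on_subset[OF density_arclength_continuous])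
        (use m in auto)
    fix s assume "s \<in> {len g a..len g b}"
    then obtain t where t: "t \<in> {a..b}" "len g t = s"
      using length_upto_IVT[OF r ab] by blast
    then show "B \<le> w (arclength_param g s)"
      using arclength_param_length_upto[OF r, of t] B[of t] ab by auto
  qed auto
  then show ?thesis using line_integral_upto_diff[OF ab] m by (simp add: mult.commute)
qed

end

lemma line_integral_upto_le:
  assumes r: "rectifiable_path g" and w: "continuous_on (path_image g) w"
    and ab: "0 \<le> a" "a \<le> b" "b \<le> 1" and B: "\<And>t. t \<in> {a..b} \<Longrightarrow> w (g t) \<le> B"
  shows "line_integral_upto g w b - line_integral_upto g w a \<le>
      B * (len g b - len g a)"
  using line_integral_upto_ge[OF r continuous_on_minus[OF w] ab, of "- B"] B
  by (simp add: line_integral_upto_def)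

section \<open>Parametrizations controlled by the quasihyperbolic metric\<close>

abbreviation bdist :: "'a::euclidean_space set \<Rightarrow> 'a \<Rightarrow> real"
  where "bdist D z \<equiv> infdist z (frontier D)"

text \<open>The second component of a pair \<open>qh_param D g A\<close> is an upper bound for the quasihyperbolic length of
  \<open>g\<close>. Unlike arc length integrals, such pairs can be mapped and concatenated directly, and
  they describe the quasihyperbolic metric up to a constant factor.\<close>

abbreviation straddles :: "real \<Rightarrow> real \<Rightarrow> real \<Rightarrow> real \<Rightarrow> real \<Rightarrow> real \<Rightarrow> bool"
  where "straddles a b t e u v \<equiv> a \<le> u \<and> u \<le> t \<and> t \<le> v \<and> v \<le> b \<and> v - u < e"

definition qh_param ::
    "'a::euclidean_space set \<Rightarrow> (real \<Rightarrow> 'a) \<Rightarrow> (real \<Rightarrow> real) \<Rightarrow> bool"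
  where "qh_param D g A \<longleftrightarrow> path g \<and> path_image g \<subseteq> D \<and> continuous_on {0..1} A \<and>
    (\<forall>t\<in>{0..1}. \<exists>e>0. \<forall>u v. straddles 0 1 t e u v \<longrightarrow>
      dist (g u) (g v) \<le> bdist D (g t) * (A v - A u))"

definition qh_join :: "'a::euclidean_space set \<Rightarrow> 'a \<Rightarrow> 'a \<Rightarrow> real \<Rightarrow> bool"
  where "qh_join D x y c \<longleftrightarrow> (\<exists>g A. qh_param D g A \<and>
    pathstart g = x \<and> pathfinish g = y \<and> A 1 - A 0 \<le> c)"

text \<open>This bisection principle integrates the pointwise condition in \<open>qh_param\<close>:
  what is additive over adjacent intervals and holds on short intervals straddling each point holds
  on \<open>{a..b}\<close>. The bounds are built in because the curves are only controlled on
  \<open>{0..1}\<close>.\<close>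

lemma Bolzano_within [consumes 1, case_names trans local]:
  fixes P :: "real \<Rightarrow> real \<Rightarrow> bool"
  assumes "a \<le> b"
    and trans: "\<And>u v w. P u v \<Longrightarrow> P v w \<Longrightarrow> a \<le> u \<Longrightarrow> u \<le> v \<Longrightarrow> v \<le> w \<Longrightarrow> w \<le> b \<Longrightarrow> P u w"
    and local: "\<And>t. a \<le> t \<Longrightarrow> t \<le> b \<Longrightarrow>
      \<exists>e>0. \<forall>u v. straddles a b t e u v \<longrightarrow> P u v"
  shows "P a b"
proof -
  define Q where "Q u v \<longleftrightarrow> (a \<le> u \<longrightarrow> v \<le> b \<longrightarrow> P u v)" for u v
  have "Q a b"
    using assms(1)
  proof (induction rule: Bolzano)
    case (trans u v w)
    then show ?case using assms(2)[of u v w] unfolding Q_def by auto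
  next
    case (local t)
    from assms(3)[OF this] show ?case unfolding Q_def by meson
  qed
  then show ?thesis by (simp add: Q_def)
qed

lemma infdist_frontier_pos:
  assumes "open D" "D \<noteq> UNIV" "p \<in> D"
  shows "bdist D p > 0"
proof -
  have ne: "frontier D \<noteq> {}" using assms frontier_eq_empty by auto
  have "p \<notin> frontier D" using assms by (simp add: frontier_def interior_open)
  then have "bdist D p \<noteq> 0"
    using in_closed_iff_infdist_zero[OF frontier_closed ne] by auto
  then show ?thesis using infdist_nonneg[of p "frontier D"] by simp
qed

lemma ball_infdist_frontier:
  assumes "p \<in> D"
  shows "ball p (bdist D p) \<subseteq> D"
proof (rule ccontr)
  assume "\<not> ?thesis"
  then obtain q where q: "q \<in> ball p (bdist D p)" "q \<notin> D" by blast
  have "connected (closed_segment p q)" by simp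
  then have "closed_segment p q \<inter> frontier D \<noteq> {}"
    using assms q by (intro connected_Int_frontier) auto
  then obtain z where z: "z \<in> closed_segment p q" "z \<in> frontier D" by blast
  then have "dist p z \<le> dist p q"
    by (metis dist_commute dist_in_closed_segment(1))
  moreover have "bdist D p \<le> dist p z" using z by (simp add: infdist_le)
  ultimately show False using q by simp
qed

lemma infdist_continuous_nbhd:
  assumes "path g" "path_image g \<subseteq> D" "open D" "D \<noteq> UNIV" "t \<in> {0..1}"
  obtains e where "e > 0" "\<And>s. s \<in> {0..1} \<Longrightarrow> \<bar>s - t\<bar> < e \<Longrightarrow>
      bdist D (g s) \<le> 2 * bdist D (g t) \<and>
      bdist D (g t) \<le> 2 * bdist D (g s)"
proof -
  let ?d = "\<lambda>s. bdist D (g s)"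
  have pos: "?d t > 0"
    using assms by (intro infdist_frontier_pos) (auto simp: path_image_def subset_iff)
  have "continuous_on {0..1} ?d"
    using assms(1) unfolding path_def by (intro continuous_on_infdist)
  then obtain e where e: "e > 0" "\<And>s. s \<in> {0..1} \<Longrightarrow> dist s t < e \<Longrightarrow> dist (?d s) (?d t) < ?d t / 2"
    using assms(5) pos unfolding continuous_on_iff by (meson half_gt_zero)
  show thesis
  proof (rule that[OF e(1)])
    fix s assume "s \<in> {0..1}" "\<bar>s - t\<bar> < e"
    then have "\<bar>?d s - ?d t\<bar> < ?d t / 2" using e(2)[of s] by (simp add: dist_real_def)
    then show "?d s \<le> 2 * ?d t \<and> ?d t \<le> 2 * ?d s" using pos by linarith
  qed
qed

lemma qh_paramD:
  assumes "qh_param D g A" "t \<in> {0..1}"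
  obtains e where "e > 0" "\<And>u v. 0 \<le> u \<Longrightarrow> u \<le> t \<Longrightarrow> t \<le> v \<Longrightarrow> v \<le> 1 \<Longrightarrow> v - u < e \<Longrightarrow>
      dist (g u) (g v) \<le> bdist D (g t) * (A v - A u)"
proof -
  from assms have "\<exists>e>0. \<forall>u v. straddles 0 1 t e u v \<longrightarrow>
      dist (g u) (g v) \<le> bdist D (g t) * (A v - A u)"
    unfolding qh_param_def by (elim conjE) (erule bspec)
  then show thesis using that by blast
qed

text \<open>Distances are nonnegative and the boundary distance is positive, so the local inequality
  forces \<open>A v - A u\<close> to be nonnegative.\<close>

lemma qh_param_mono:
  assumes q: "qh_param D g A" and D: "open D" "D \<noteq> UNIV"
    and ab: "0 \<le> a" "a \<le> b" "b \<le> 1"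
  shows "A a \<le> A b"
  using ab(2)
proof (induction rule: Bolzano_within)
  case (local t)
  then have t: "t \<in> {0..1}" using ab by auto
  then have "bdist D (g t) > 0"
    using q D by (intro infdist_frontier_pos) (auto simp: path_image_def qh_param_def subset_iff)
  moreover obtain e where e: "e > 0" "\<And>u v. 0 \<le> u \<Longrightarrow> u \<le> t \<Longrightarrow> t \<le> v \<Longrightarrow> v \<le> 1 \<Longrightarrow> v - u < e \<Longrightarrow>
      dist (g u) (g v) \<le> bdist D (g t) * (A v - A u)"
    using qh_paramD[OF q t] by blast
  ultimately have "A u \<le> A v" if "0 \<le> u" "u \<le> t" "t \<le> v" "v \<le> 1" "v - u < e" for u v
  proof -
    have "0 \<le> bdist D (g t) * (A v - A u)"
      using e(2)[OF that] zero_le_dist[of "g u" "g v"] by linarith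
    then show ?thesis using \<open>bdist D (g t) > 0\<close> by (simp add: zero_le_mult_iff)
  qed
  then show ?case using e(1) ab by (intro exI[of _ e]) auto
qed auto

lemma qh_param_dist_le:
  assumes q: "qh_param D g A" and D: "open D" "D \<noteq> UNIV"
    and ab: "0 \<le> a" "a \<le> b" "b \<le> 1"
    and M: "\<And>t. t \<in> {a..b} \<Longrightarrow> bdist D (g t) \<le> M"
  shows "dist (g a) (g b) \<le> M * (A b - A a)"
  using ab(2)
proof (induction rule: Bolzano_within)
  case (trans u v w)
  then show ?case using dist_triangle[of "g u" "g w" "g v"] by (simp add: algebra_simps)
next
  case (local t)
  then have t: "t \<in> {0..1}" using ab by auto
  obtain e where e: "e > 0" "\<And>u v. 0 \<le> u \<Longrightarrow> u \<le> t \<Longrightarrow> t \<le> v \<Longrightarrow> v \<le> 1 \<Longrightarrow> v - u < e \<Longrightarrow>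
      dist (g u) (g v) \<le> bdist D (g t) * (A v - A u)"
    using qh_paramD[OF q t] by blast
  have "dist (g u) (g v) \<le> M * (A v - A u)"
    if uv: "a \<le> u" "u \<le> t" "t \<le> v" "v \<le> b" "v - u < e" for u v
  proof -
    have "dist (g u) (g v) \<le> bdist D (g t) * (A v - A u)"
      using uv ab by (intro e(2)) auto
    also have "\<dots> \<le> M * (A v - A u)"
      using qh_param_mono[OF q D, of u v] uv ab M[of t] by (intro mult_right_mono) auto
    finally show ?thesis .
  qed
  then show ?case using e(1) by (intro exI[of _ e]) auto
qed

lemma qh_param_polygon_le:
  assumes q: "qh_param D g A" and D: "open D" "D \<noteq> UNIV"
    and ab: "0 \<le> a" "a \<le> b" "b \<le> 1" and ts: "sorted ts" "set ts \<subseteq> {a..b}"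
    and M: "\<And>t. t \<in> {a..b} \<Longrightarrow> bdist D (g t) \<le> M"
  shows "plen g ts \<le> M * (A b - A a)"
proof -
  have M0: "0 \<le> M" using M[of a] infdist_nonneg[of "g a" "frontier D"] ab by auto
  show ?thesis
  proof (cases "ts = []")
    case True
    then show ?thesis using qh_param_mono[OF q D ab] M0 by auto
  next
    case False
    have "plen g ts \<le> M * A (last ts) - M * A (hd ts)"
    proof (rule polygon_length_telescope[where F = "\<lambda>t. M * A t"])
      fix u v assume uv: "u \<in> set ts" "v \<in> set ts" "u \<le> v"
      then have uv': "a \<le> u" "v \<le> b" using ts by auto
      have "dist (g u) (g v) \<le> M * (A v - A u)"
        using uv uv' ab M by (intro qh_param_dist_le[OF q D]) auto
      then show "dist (g u) (g v) \<le> M * A v - M * A u" by (simp add: right_diff_distrib)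
    qed (use ts False in auto)
    also have "\<dots> \<le> M * (A b - A a)"
    proof -
      have "last ts \<in> {a..b}" "hd ts \<in> {a..b}"
        using last_in_set[OF False] hd_in_set[OF False] ts by blast+
      then have "A (last ts) \<le> A b" "A a \<le> A (hd ts)"
        using qh_param_mono[OF q D] ab by auto
      then have "M * (A (last ts) - A (hd ts)) \<le> M * (A b - A a)"
        using M0 by (intro mult_left_mono) auto
      then show ?thesis by (simp add: right_diff_distrib)
    qed
    finally show ?thesis .
  qed
qed

lemma qh_param_rectifiable:
  assumes q: "qh_param D g A" and D: "open D" "D \<noteq> UNIV"
  shows "rectifiable_path g"
proof -
  have p: "path g" using q by (simp add: qh_param_def)
  have "continuous_on {0..1} (\<lambda>t. bdist D (g t))"
    using p unfolding path_def by (intro continuous_on_infdist)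
  from compact_imp_bounded[OF compact_continuous_image[OF this]]
  obtain M where M: "\<And>t. t \<in> {0..1} \<Longrightarrow> norm (bdist D (g t)) \<le> M"
    unfolding bounded_iff by blast
  have M: "bdist D (g t) \<le> M" if "t \<in> {0..1}" for t
    using M[OF that] by simp
  have "plen g ts \<le> M * (A 1 - A 0)" if "sorted ts" "set ts \<subseteq> {0..1}" for ts
    using that M by (intro qh_param_polygon_le[OF q D]) auto
  then show ?thesis
    unfolding rectifiable_path_def using p by (auto intro!: bdd_aboveI[where M = "M * (A 1 - A 0)"])
qed

section \<open>Comparison of these parametrizations with the quasihyperbolic metric\<close>

lemma qh_density_continuous:
  assumes "S \<subseteq> D" "open D" "D \<noteq> UNIV"
  shows "continuous_on S (\<lambda>z. 1 / bdist D z)"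
proof (intro continuous_intros ballI)
  fix z assume "z \<in> S"
  then show "bdist D z \<noteq> 0" using assms infdist_frontier_pos[OF assms(2,3), of z] by auto
qed

lemma line_integral_nonneg:
  assumes "rectifiable_path g" "path_image g \<subseteq> D" "open D" "D \<noteq> UNIV"
  shows "0 \<le> line_integral g (\<lambda>z. 1 / bdist D z)"
  using line_integral_upto_ge[OF assms(1) qh_density_continuous[OF assms(2-4)], of 0 1 0]
  by (simp add: infdist_nonneg)

text \<open>Near \<open>t\<close> the boundary distance is frozen at its value at \<open>t\<close>,
  up to a factor 2. This is done twice, in the density and in the bound for arc length, whence the
  factor 4.\<close>

lemma line_integral_qh_param_le:
  assumes q: "qh_param D g A" and D: "open D" "D \<noteq> UNIV"
  shows "line_integral g (\<lambda>z. 1 / bdist D z) \<le> 4 * (A 1 - A 0)"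
proof -
  let ?\<rho> = "\<lambda>z. 1 / bdist D z"
  let ?I = "line_integral_upto g ?\<rho>"
  have p: "path g" "path_image g \<subseteq> D" using q by (auto simp: qh_param_def)
  note r = qh_param_rectifiable[OF q D]
  note c = qh_density_continuous[OF p(2) D]
  have "?I 1 - ?I 0 \<le> 4 * (A 1 - A 0)"
    using zero_le_one[where 'a=real]
  proof (induction rule: Bolzano_within[where P = "\<lambda>u v. ?I v - ?I u \<le> 4 * (A v - A u)"])
    case (local t)
    then have t: "t \<in> {0..1}" by auto
    let ?d = "\<lambda>s. bdist D (g s)"
    have pos: "?d s > 0" if "s \<in> {0..1}" for s
      using that p D by (intro infdist_frontier_pos) (auto simp: path_image_def subset_iff)
    obtain e where e: "e > 0" "\<And>s. s \<in> {0..1} \<Longrightarrow> \<bar>s - t\<bar> < e \<Longrightarrow> ?d s \<le> 2 * ?d t \<and> ?d t \<le> 2 * ?d s"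
      using infdist_continuous_nbhd[OF p D t] by blast
    have "?I v - ?I u \<le> 4 * (A v - A u)"
      if uv: "0 \<le> u" "u \<le> t" "t \<le> v" "v \<le> 1" "v - u < e" for u v
    proof -
      have uv': "0 \<le> u" "u \<le> v" "v \<le> 1" using uv by auto
      have "?I v - ?I u \<le> (2 / ?d t) * (len g v - len g u)"
      proof (rule line_integral_upto_le[OF r c uv'])
        fix s assume "s \<in> {u..v}"
        then have "?d t \<le> 2 * ?d s" "s \<in> {0..1}" using e(2)[of s] uv by auto
        then show "1 / ?d s \<le> 2 / ?d t"
          using pos[of s] pos[OF t] by (simp add: field_simps)
      qed
      also have "\<dots> \<le> (2 / ?d t) * (2 * ?d t * (A v - A u))"
      proof (intro mult_left_mono)
        have "len g v \<le> len g u + 2 * ?d t * (A v - A u)"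
        proof (rule length_upto_le_add[OF r uv'])
          fix ts assume "sorted ts" "set ts \<subseteq> {u..v}"
          then show "plen g ts \<le> 2 * ?d t * (A v - A u)"
            using uv e(2) by (intro qh_param_polygon_le[OF q D uv']) auto
        qed
        then show "len g v - len g u \<le> 2 * ?d t * (A v - A u)" by simp
      qed (use pos[OF t] in auto)
      also have "\<dots> = 4 * (A v - A u)" using pos[OF t] by simp
      finally show ?thesis .
    qed
    then show ?case using e(1) by (intro exI[of _ e]) simp
  qed auto
  then show ?thesis by simp
qed

text \<open>The factor 2 pays for replacing the density along a short piece of the curve by its
  value at \<open>t\<close>.\<close>

lemma qh_param_of_rectifiable:
  assumes r: "rectifiable_path g" and im: "path_image g \<subseteq> D" and D: "open D" "D \<noteq> UNIV"
  shows "qh_param D g (\<lambda>t. 2 * line_integral_upto g (\<lambda>z. 1 / bdist D z) t)"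
proof -
  let ?\<rho> = "\<lambda>z. 1 / bdist D z"
  let ?I = "line_integral_upto g ?\<rho>"
  let ?d = "\<lambda>s. bdist D (g s)"
  have p: "path g" using r by (simp add: rectifiable_path_def)
  note c = qh_density_continuous[OF im D]
  have pos: "?d s > 0" if "s \<in> {0..1}" for s
    using that im D by (intro infdist_frontier_pos) (auto simp: path_image_def subset_iff)
  have "\<exists>e>0. \<forall>u v. straddles 0 1 t e u v \<longrightarrow>
      dist (g u) (g v) \<le> ?d t * (2 * ?I v - 2 * ?I u)" if t: "t \<in> {0..1}" for t
  proof -
    obtain e where e: "e > 0" "\<And>s. s \<in> {0..1} \<Longrightarrow> \<bar>s - t\<bar> < e \<Longrightarrow> ?d s \<le> 2 * ?d t \<and> ?d t \<le> 2 * ?d s"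
      using infdist_continuous_nbhd[OF p im D t] by blast
    have "dist (g u) (g v) \<le> ?d t * (2 * ?I v - 2 * ?I u)"
      if uv: "0 \<le> u" "u \<le> t" "t \<le> v" "v \<le> 1" "v - u < e" for u v
    proof -
      have uv': "0 \<le> u" "u \<le> v" "v \<le> 1" using uv by auto
      have "1 / (2 * ?d t) * (len g v - len g u) \<le> ?I v - ?I u"
      proof (rule line_integral_upto_ge[OF r c uv'])
        fix s assume "s \<in> {u..v}"
        then have "?d s \<le> 2 * ?d t" "s \<in> {0..1}" using e(2)[of s] uv by auto
        then show "1 / (2 * ?d t) \<le> 1 / ?d s"
          using pos[of s] pos[OF t] by (intro divide_left_mono) auto
      qed
      then have "len g v - len g u \<le> ?d t * (2 * ?I v - 2 * ?I u)"
        using pos[OF t] by (simp add: field_simps)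
      with dist_le_length_upto[OF r uv'] show ?thesis by linarith
    qed
    then show ?thesis using e(1) by blast
  qed
  then show ?thesis
    unfolding qh_param_def using p im line_integral_upto_continuous[OF r c]
    by (auto intro!: continuous_intros)
qed

lemma quasihyperbolic_le:
  assumes "qh_join D x y c" and D: "open D" "D \<noteq> UNIV"
  shows "quasihyperbolic D x y \<le> 4 * c"
proof -
  obtain g A where q: "qh_param D g A" "pathstart g = x" "pathfinish g = y" "A 1 - A 0 \<le> c"
    using assms(1) unfolding qh_join_def by blast
  have "quasihyperbolic D x y \<le> line_integral g (\<lambda>z. 1 / bdist D z)"
    unfolding quasihyperbolic_def
  proof (rule cInf_lower)
    show "bdd_below {line_integral g (\<lambda>z. 1 / bdist D z) |g.
      rectifiable_path g \<and> path_image g \<subseteq> D \<and> pathstart g = x \<and> pathfinish g = y}"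
      using line_integral_nonneg[OF _ _ D] by (intro bdd_belowI[where m = 0]) auto
  qed (use q qh_param_rectifiable[OF q(1) D] in \<open>auto simp: qh_param_def\<close>)
  also have "\<dots> \<le> 4 * (A 1 - A 0)" by (rule line_integral_qh_param_le[OF q(1) D])
  also have "\<dots> \<le> 4 * c" using q(4) by simp
  finally show ?thesis .
qed

text \<open>The first assumption, with an arbitrary constant \<open>c'\<close>, makes the set of
  competing curves nonempty; the \<open>Inf\<close> of the empty set would say nothing. The factor 2
  is that of \<open>qh_param_of_rectifiable\<close>.\<close>

lemma qh_join_of_quasihyperbolic:
  assumes ex: "qh_join D x y c'" and D: "open D" "D \<noteq> UNIV" and "quasihyperbolic D x y < c"
  shows "qh_join D x y (2 * c)"
proof -
  let ?\<rho> = "\<lambda>z. 1 / bdist D z"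
  let ?S = "{line_integral g ?\<rho> |g.
      rectifiable_path g \<and> path_image g \<subseteq> D \<and> pathstart g = x \<and> pathfinish g = y}"
  have "?S \<noteq> {}"
    using ex qh_param_rectifiable[OF _ D]
    unfolding qh_join_def qh_param_def by blast
  with assms(4) obtain g where g: "rectifiable_path g" "path_image g \<subseteq> D" "pathstart g = x"
    "pathfinish g = y" "line_integral g ?\<rho> < c"
    unfolding quasihyperbolic_def using cInf_lessD[of ?S c] by blast
  show ?thesis
    unfolding qh_join_def
    using qh_param_of_rectifiable[OF g(1,2) D] g(3-5)
    by (intro exI conjI) (assumption | simp)+
qed

section \<open>Joining points by segments and concatenation\<close>

lemma qh_join_mono: "qh_join D x y c \<Longrightarrow> c \<le> c' \<Longrightarrow> qh_join D x y c'"
  unfolding qh_join_def by (elim exE conjE, intro exI conjI) (assumption | erule (1) order_trans)+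

text \<open>Along the segment the boundary distance stays at least \<open>bdist D x / 2\<close>,
  hence at least \<open>dist x y\<close>, so the identity can serve as the second component.\<close>

lemma qh_join_segment:
  assumes xy: "dist x y \<le> bdist D x / 2" and D: "open D" "D \<noteq> UNIV" "x \<in> D"
  shows "qh_join D x y 1"
proof -
  let ?d = "bdist D x"
  have pos: "?d > 0" using D by (rule infdist_frontier_pos)
  have im: "path_image (linepath x y) \<subseteq> ball x ?d"
  proof -
    have "closed_segment x y \<subseteq> cball x (?d / 2)"
      using xy pos by (intro closed_segment_subset) auto
    also have "\<dots> \<subseteq> ball x ?d" using pos by auto
    finally show ?thesis by simp
  qed
  have "dist (linepath x y u) (linepath x y v) \<le> bdist D (linepath x y t) * (v - u)"
    if t: "t \<in> {0..1}" and uv: "u \<le> v" for u v t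
  proof -
    have e: "linepath x y u - linepath x y v = (v - u) *\<^sub>R (x - y)"
      by (simp add: linepath_def algebra_simps)
    have "dist (linepath x y u) (linepath x y v) = (v - u) * dist x y"
      using uv by (simp add: dist_norm e)
    also have "dist x (linepath x y t) \<le> ?d / 2"
    proof -
      have "linepath x y t \<in> closed_segment x y" using t by (metis linepath_in_path atLeastAtMost_iff)
      then show ?thesis using xy by (metis dist_commute dist_in_closed_segment(1) order_trans)
    qed
    then have "dist x y \<le> bdist D (linepath x y t)"
      using infdist_triangle[of x "frontier D" "linepath x y t"] xy by linarith
    then have "(v - u) * dist x y \<le> (v - u) * bdist D (linepath x y t)"
      using uv by (intro mult_left_mono) auto
    finally show ?thesis by (simp add: mult.commute)
  qed
  then have "qh_param D (linepath x y) (\<lambda>t. t)"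
    unfolding qh_param_def using im ball_infdist_frontier[OF D(3)]
    by (auto intro!: continuous_intros exI[of _ "1::real"])
  then show ?thesis unfolding qh_join_def by (intro exI[of _ "linepath x y"] exI[of _ "\<lambda>t. t"]) auto
qed

lemma qh_join_trans:
  assumes "qh_join D x y c" "qh_join D y z c'"
  shows "qh_join D x z (c + c')"
proof -
  obtain g A where q: "qh_param D g A" "pathstart g = x" "pathfinish g = y" "A 1 - A 0 \<le> c"
    using assms(1) unfolding qh_join_def by blast
  obtain h B where r: "qh_param D h B" "pathstart h = y" "pathfinish h = z" "B 1 - B 0 \<le> c'"
    using assms(2) unfolding qh_join_def by blast
  have dq: "path g" "path_image g \<subseteq> D" "continuous_on {0..1} A"
    using q(1) unfolding qh_param_def by blast+
  have dr: "path h" "path_image h \<subseteq> D" "continuous_on {0..1} B"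
    using r(1) unfolding qh_param_def by blast+
  \<comment> \<open>Only increments of the second components matter, so the second one may be
    shifted to start at \<open>A 1\<close>.\<close>
  define C where "C = A +++ (\<lambda>t. B t + (A 1 - B 0))"
  have "path A" "path (\<lambda>t. B t + (A 1 - B 0))" "pathfinish A = pathstart (\<lambda>t. B t + (A 1 - B 0))"
    using dq dr by (auto simp: path_def pathstart_def pathfinish_def intro!: continuous_intros)
  then have cont: "continuous_on {0..1} C"
    unfolding C_def path_def[symmetric] by (rule path_join_imp)
  have pj: "path (g +++ h)" "path_image (g +++ h) \<subseteq> D"
    using path_image_join_subset[of g h] dq dr q(3) r(2) by auto
  have A: "C t = A (2 * t)" "(g +++ h) t = g (2 * t)" if "t \<le> 1/2" for t
    using that by (auto simp: C_def joinpaths_def)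
  have B: "C t = B (2 * t - 1) + (A 1 - B 0)" "(g +++ h) t = h (2 * t - 1)" if "t \<ge> 1/2" for t
  proof -
    have "C t = B (2 * t - 1) + (A 1 - B 0) \<and> (g +++ h) t = h (2 * t - 1)"
    proof (cases "t = 1/2")
      case True
      show ?thesis using q(3) r(2)
        unfolding True C_def joinpaths_def by (simp add: pathstart_def pathfinish_def)
    next
      case False
      then have "\<not> t \<le> 1/2" using that by linarith
      then show ?thesis unfolding C_def joinpaths_def by simp
    qed
    then show "C t = B (2 * t - 1) + (A 1 - B 0)" "(g +++ h) t = h (2 * t - 1)" by auto
  qed
  let ?P = "\<lambda>t u v. dist ((g +++ h) u) ((g +++ h) v) \<le>
      bdist D ((g +++ h) t) * (C v - C u)"
  have left: "\<exists>e>0. \<forall>u v. straddles 0 (1/2) t e u v \<longrightarrow> ?P t u v" if t: "0 \<le> t" "t \<le> 1/2" for t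
  proof -
    have "2 * t \<in> {0..1}" using t by auto
    from qh_paramD[OF q(1) this] obtain e where e: "e > 0"
      "\<And>u v. 0 \<le> u \<Longrightarrow> u \<le> 2 * t \<Longrightarrow> 2 * t \<le> v \<Longrightarrow> v \<le> 1 \<Longrightarrow> v - u < e \<Longrightarrow>
        dist (g u) (g v) \<le> bdist D (g (2 * t)) * (A v - A u)" by blast
    \<comment> \<open>The tolerance is halved because the joined path runs at double speed.\<close>
    have "?P t u v" if uv: "straddles 0 (1/2) t (e/2) u v" for u v
    proof -
      have "u \<le> 1/2" "v \<le> 1/2" using uv by linarith+
      note eqs = A[OF this(1)] A[OF this(2)] A[OF t(2)]
      show ?thesis unfolding eqs by (rule e(2)) (use uv in linarith)+
    qed
    then show ?thesis using e(1) half_gt_zero by blast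
  qed
  have right: "\<exists>e>0. \<forall>u v. straddles (1/2) 1 t e u v \<longrightarrow> ?P t u v" if t: "1/2 \<le> t" "t \<le> 1" for t
  proof -
    have "2 * t - 1 \<in> {0..1}" using t by auto
    from qh_paramD[OF r(1) this] obtain e where e: "e > 0"
      "\<And>u v. 0 \<le> u \<Longrightarrow> u \<le> 2 * t - 1 \<Longrightarrow> 2 * t - 1 \<le> v \<Longrightarrow> v \<le> 1 \<Longrightarrow> v - u < e \<Longrightarrow>
        dist (h u) (h v) \<le> bdist D (h (2 * t - 1)) * (B v - B u)" by blast
    have "?P t u v" if uv: "straddles (1/2) 1 t (e/2) u v" for u v
    proof -
      have "1/2 \<le> u" "1/2 \<le> v" using uv by linarith+
      note eqs = B[OF this(1)] B[OF this(2)] B[OF t(1)]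
      have "dist (h (2 * u - 1)) (h (2 * v - 1)) \<le> bdist D (h (2 * t - 1)) * (B (2 * v - 1) - B (2 * u - 1))"
        by (rule e(2)) (use uv in linarith)+
      then show ?thesis unfolding eqs by simp
    qed
    then show ?thesis using e(1) half_gt_zero by blast
  qed
  have "\<exists>e>0. \<forall>u v. straddles 0 1 t e u v \<longrightarrow> ?P t u v"
    if t: "t \<in> {0..1}" for t
  proof -
    consider (lt) "t < 1/2" | (gt) "t > 1/2" | (eq) "t = 1/2" by linarith
    then show ?thesis
    proof cases
      case lt
      with left[of t] t obtain e where e: "e > 0"
        "\<And>u v. straddles 0 (1/2) t e u v \<Longrightarrow> ?P t u v" by force
      show ?thesis
      proof (intro exI[of _ "min e (1/2 - t)"] conjI allI impI)
        fix u v assume "straddles 0 1 t (min e (1/2 - t)) u v"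
        then show "?P t u v" by (intro e(2)) auto
      qed (use lt e(1) in auto)
    next
      case gt
      with right[of t] t obtain e where e: "e > 0"
        "\<And>u v. straddles (1/2) 1 t e u v \<Longrightarrow> ?P t u v" by force
      show ?thesis
      proof (intro exI[of _ "min e (t - 1/2)"] conjI allI impI)
        fix u v assume "straddles 0 1 t (min e (t - 1/2)) u v"
        then show "?P t u v" by (intro e(2)) auto
      qed (use gt e(1) in auto)
    next
      \<comment> \<open>An interval around the junction is cut there, and each half belongs to one
        of the two paths.\<close>
      case eq
      with left[of t] t obtain e where e: "e > 0"
        "\<And>u v. straddles 0 (1/2) t e u v \<Longrightarrow> ?P t u v" by force
      from eq right[of t] t obtain e' where e': "e' > 0"
        "\<And>u v. straddles (1/2) 1 t e' u v \<Longrightarrow> ?P t u v" by force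
      show ?thesis
      proof (intro exI[of _ "min e e'"] conjI allI impI)
        show "0 < min e e'" using e e' by auto
        fix u v assume uv: "straddles 0 1 t (min e e') u v"
        have "?P t u t" using uv eq by (intro e(2)) auto
        moreover have "?P t t v" using uv eq by (intro e'(2)) auto
        ultimately show "?P t u v"
          using dist_triangle[of "(g +++ h) u" "(g +++ h) v" "(g +++ h) t"]
          by (simp add: algebra_simps)
      qed
    qed
  qed
  then have "qh_param D (g +++ h) C"
    unfolding qh_param_def using cont pj by blast
  moreover have "C 1 - C 0 \<le> c + c'" using q(4) r(4) A(1)[of 0] B(1)[of 1] by simp
  ultimately show ?thesis
    unfolding qh_join_def using q r by (intro exI[of _ "g +++ h"] exI[of _ C]) auto
qed

lemma qh_join_exists:
  assumes D: "open D" "D \<noteq> UNIV" "connected D" and xy: "x \<in> D" "y \<in> D"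
  obtains c where "qh_join D x y c"
proof -
  \<comment> \<open>Asking for joins in both directions makes the relation symmetric without
    reversing a parametrization.\<close>
  let ?R = "\<lambda>z w. (\<exists>c. qh_join D z w c) \<and> (\<exists>c. qh_join D w z c)"
  have "?R x y"
  proof (rule connected_equivalence_relation[OF D(3) xy])
    fix z assume z: "z \<in> D"
    \<comment> \<open>With one third, the boundary distance at \<open>w\<close> is still more than
      twice \<open>dist z w\<close>, so the segment can be used from either end.\<close>
    let ?T = "ball z (bdist D z / 3)"
    have pos: "bdist D z > 0" using D z by (intro infdist_frontier_pos)
    then have "?T \<subseteq> ball z (bdist D z)" by auto
    then have sub: "?T \<subseteq> D" using ball_infdist_frontier[OF z] by blast
    have "?R z w" if w: "w \<in> ?T" for w
    proof -
      have "dist z w < bdist D z / 3" using w by simp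
      moreover have "bdist D z \<le> bdist D w + dist z w" "0 \<le> dist z w" by (rule infdist_triangle) simp
      ultimately have d: "dist z w \<le> bdist D z / 2" "dist z w \<le> bdist D w / 2" by linarith+
      have "w \<in> D" using w sub by blast
      then show ?thesis
        using d qh_join_segment[of z w D] qh_join_segment[of w z D] D z dist_commute[of w z] by auto
    qed
    then show "\<exists>T. openin (top_of_set D) T \<and> z \<in> T \<and> (\<forall>w\<in>T. ?R z w)"
      using pos sub by (intro exI[of _ ?T]) (auto intro: open_openin_trans[OF D(1)])
  qed (use qh_join_trans in blast)+
  then show thesis using that by blast
qed

section \<open>Means over balls and the Poincare inequality\<close>

lemma nn_integral_lborel_affine:
  fixes f :: "'a::euclidean_space \<Rightarrow> ennreal"
  assumes [measurable]: "f \<in> borel_measurable borel" and c: "c \<noteq> 0"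
  shows "(\<integral>\<^sup>+x. f x \<partial>lborel) = ennreal (\<bar>c\<bar> ^ DIM('a)) * (\<integral>\<^sup>+x. f (t + c *\<^sub>R x) \<partial>lborel)"
proof -
  have "(\<integral>\<^sup>+x. f x \<partial>lborel) =
      (\<integral>\<^sup>+x. f x \<partial>density (distr lborel borel (\<lambda>x. t + c *\<^sub>R x)) (\<lambda>_. ennreal (\<bar>c\<bar> ^ DIM('a))))"
    using lborel_affine[OF c, of t] by simp
  also have "\<dots> = ennreal (\<bar>c\<bar> ^ DIM('a)) * (\<integral>\<^sup>+x. f (t + c *\<^sub>R x) \<partial>lborel)"
    by (subst nn_integral_density) (auto simp: nn_integral_distr nn_integral_cmult)
  finally show ?thesis .
qed

abbreviation energy :: "('a::euclidean_space \<Rightarrow> ennreal) \<Rightarrow> 'a set \<Rightarrow> ennreal"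
  where "energy P S \<equiv> \<integral>\<^sup>+x. P x * indicator S x \<partial>lborel"

text \<open>For fixed \<open>a\<close> the substitution x = a + s (b - a) maps \<open>S\<close> into
  itself by convexity, and its Jacobian s^n is at least 2^(-n).\<close>

lemma nn_integral_segments_half:
  fixes S :: "'a::euclidean_space set" and P :: "'a \<Rightarrow> ennreal"
  assumes [measurable]: "S \<in> sets borel" "P \<in> borel_measurable borel"
    and S: "convex S" and s: "1/2 \<le> s" "s \<le> 1"
  shows "(\<integral>\<^sup>+a. (\<integral>\<^sup>+b. indicator S a * indicator S b * P (a + s *\<^sub>R (b - a)) \<partial>lborel) \<partial>lborel)
    \<le> 2 ^ DIM('a) * emeasure lborel S * energy P S"
proof -
  let ?H = "\<lambda>a b. indicator S a * indicator S b * P (a + s *\<^sub>R (b - a))"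
  let ?I = "\<integral>\<^sup>+x. P x * indicator S x \<partial>lborel"
  have inner: "(\<integral>\<^sup>+b. ?H a b \<partial>lborel)
      \<le> indicator S a * (2 ^ DIM('a) * ?I)" for a
  proof (cases "a \<in> S")
    case True
    have "(\<integral>\<^sup>+b. ?H a b \<partial>lborel)
      \<le> (\<integral>\<^sup>+b. P ((1 - s) *\<^sub>R a + s *\<^sub>R b) * indicator S ((1 - s) *\<^sub>R a + s *\<^sub>R b) \<partial>lborel)"
    proof (rule nn_integral_mono)
      fix b
      have e: "a + s *\<^sub>R (b - a) = (1 - s) *\<^sub>R a + s *\<^sub>R b" by (simp add: algebra_simps)
      show "?H a b
        \<le> P ((1 - s) *\<^sub>R a + s *\<^sub>R b) * indicator S ((1 - s) *\<^sub>R a + s *\<^sub>R b)"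
      proof (cases "b \<in> S")
        case bS: True
        have "(1 - s) *\<^sub>R a + s *\<^sub>R b \<in> S"
          using S True bS s by (intro convexD) auto
        then show ?thesis unfolding e using True bS by simp
      qed simp
    qed
    \<comment> \<open>The factor (2 s)^n >= 1 is inserted to supply the Jacobian of the affine
      substitution.\<close>
    also have "\<dots> \<le> 2 ^ DIM('a) * ennreal (\<bar>s\<bar> ^ DIM('a)) * \<dots>"
    proof -
      have "1 \<le> (2 * s) ^ DIM('a)" using s by (intro one_le_power) auto
      then have "1 \<le> ennreal (2 ^ DIM('a) * \<bar>s\<bar> ^ DIM('a))"
        using s by (simp add: power_mult_distrib)
      also have "\<dots> = 2 ^ DIM('a) * ennreal (\<bar>s\<bar> ^ DIM('a))"
        using s by (simp add: ennreal_mult ennreal_power[symmetric])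
      finally have "1 \<le> 2 ^ DIM('a) * ennreal (\<bar>s\<bar> ^ DIM('a))" .
      from mult_right_mono[OF this] show ?thesis by simp
    qed
    also have "\<dots> = 2 ^ DIM('a) * ?I"
      using nn_integral_lborel_affine[of "\<lambda>x. P x * indicator S x" s "(1 - s) *\<^sub>R a"] s
      by (simp add: mult.assoc)
    finally show ?thesis using True by simp
  qed simp
  have "(\<integral>\<^sup>+a. (\<integral>\<^sup>+b. ?H a b \<partial>lborel) \<partial>lborel)
      \<le> (\<integral>\<^sup>+a. (2 ^ DIM('a) * ?I) * indicator S a \<partial>lborel)"
    using inner by (intro nn_integral_mono) (simp add: mult.commute)
  also have "\<dots> = 2 ^ DIM('a) * ?I * emeasure lborel S"
    by (simp add: nn_integral_cmult_indicator)
  finally show ?thesis by (simp add: mult.assoc mult.left_commute mult.commute)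
qed

text \<open>For small \<open>s\<close> the substitution in \<open>b\<close> degenerates; exchanging
  the roles of \<open>a\<close> and \<open>b\<close> turns \<open>s\<close> into
  \<open>1 - s\<close> and leads back to the case \<open>s\<close> at least 1/2.\<close>

lemma nn_integral_segments:
  fixes S :: "'a::euclidean_space set" and P :: "'a \<Rightarrow> ennreal"
  assumes [measurable]: "S \<in> sets borel" "P \<in> borel_measurable borel"
    and S: "convex S"
  shows "(\<integral>\<^sup>+a. (\<integral>\<^sup>+b. indicator S a * indicator S b *
      (\<integral>\<^sup>+s. P (a + s *\<^sub>R (b - a)) * indicator {0..1::real} s \<partial>lborel) \<partial>lborel) \<partial>lborel)
    \<le> 2 ^ DIM('a) * emeasure lborel S * energy P S"
proof -
  let ?i = "indicator {0..1::real}"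
  let ?H = "\<lambda>a b s. indicator S a * indicator S b * P (a + s *\<^sub>R (b - a))"
  let ?B = "2 ^ DIM('a) * emeasure lborel S * energy P S"
  define K where "K s = (\<integral>\<^sup>+a. (\<integral>\<^sup>+b. ?H a b s \<partial>lborel) \<partial>lborel)"
    for s
  have K: "K s \<le> ?B" if s: "s \<in> {0..1}" for s
  proof (cases "1/2 \<le> s")
    case True
    then show ?thesis unfolding K_def using s by (intro nn_integral_segments_half assms) auto
  next
    case False
    have "K s = (\<integral>\<^sup>+b. (\<integral>\<^sup>+a. ?H a b s \<partial>lborel) \<partial>lborel)"
      unfolding K_def by (rule lborel_pair.Fubini'[symmetric]) measurable
    also have "\<dots> = K (1 - s)"
      unfolding K_def by (intro nn_integral_cong) (simp add: algebra_simps mult.commute)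
    also have "\<dots> \<le> ?B"
      unfolding K_def using s False by (intro nn_integral_segments_half assms) auto
    finally show ?thesis .
  qed
  have "(\<integral>\<^sup>+a. (\<integral>\<^sup>+b. indicator S a * indicator S b *
      (\<integral>\<^sup>+s. P (a + s *\<^sub>R (b - a)) * indicator {0..1::real} s \<partial>lborel) \<partial>lborel) \<partial>lborel)
    = (\<integral>\<^sup>+a. (\<integral>\<^sup>+b. (\<integral>\<^sup>+s. ?H a b s * ?i s
         \<partial>lborel) \<partial>lborel) \<partial>lborel)"
    by (intro nn_integral_cong) (simp add: nn_integral_cmult[symmetric] mult.assoc)
  also have "\<dots> = (\<integral>\<^sup>+a. (\<integral>\<^sup>+s. (\<integral>\<^sup>+b. ?H a b s * ?i s
         \<partial>lborel) \<partial>lborel) \<partial>lborel)"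
    by (intro nn_integral_cong lborel_pair.Fubini'[symmetric]) measurable
  also have "\<dots> = (\<integral>\<^sup>+s. (\<integral>\<^sup>+a. (\<integral>\<^sup>+b. ?H a b s * ?i s
         \<partial>lborel) \<partial>lborel) \<partial>lborel)"
    by (rule lborel_pair.Fubini'[symmetric]) measurable
  also have "\<dots> = (\<integral>\<^sup>+s. K s * indicator {0..1::real} s \<partial>lborel)"
    unfolding K_def by (intro nn_integral_cong) (auto simp: indicator_def)
  also have "\<dots> \<le> (\<integral>\<^sup>+s. ?B * indicator {0..1::real} s \<partial>lborel)"
    using K by (intro nn_integral_mono) (auto simp: indicator_def)
  also have "\<dots> = ?B" by (subst nn_integral_cmult_indicator) simp_all
  finally show ?thesis .
qed

text \<open>Here \<open>P\<close> plays the role of \<open>\<rho>\<^sup>n\<close> for an upper gradient \<open>\<rho>\<close> of \<open>f\<close>. The free parameter \<open>c\<close>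
  comes from \<open>\<rho> \<le> c + \<rho>\<^sup>n / c\<^sup>n\<^sup>-\<^sup>1\<close>, which is used in place of Hoelder's inequality.\<close>

definition energy_bound :: "'a::euclidean_space set \<Rightarrow> ('a \<Rightarrow> real) \<Rightarrow> ('a \<Rightarrow> ennreal) \<Rightarrow> bool"
  where "energy_bound W f P \<longleftrightarrow> (\<forall>a\<in>W. \<forall>b\<in>W. \<forall>c>0. ennreal (f a - f b) \<le> ennreal (dist a b) *
    (ennreal c + ennreal (1 / c ^ (DIM('a) - 1)) *
      (\<integral>\<^sup>+s. P (a + s *\<^sub>R (b - a)) * indicator {0..1::real} s \<partial>lborel)))"

definition mean_on :: "('a::euclidean_space \<Rightarrow> real) \<Rightarrow> 'a set \<Rightarrow> real"
  where "mean_on f S = enn2real (\<integral>\<^sup>+x. ennreal (f x) * indicator S x \<partial>lborel) / measure lborel S"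

context
  fixes f :: "'a::euclidean_space \<Rightarrow> real"
  assumes m[measurable]: "f \<in> borel_measurable borel" and f: "\<And>x. 0 \<le> f x" "\<And>x. f x \<le> 1"
begin

lemma mean_on_ball:
  assumes r: "r > 0"
  shows "energy (\<lambda>x. ennreal (f x)) (ball q r) = ennreal (mean_on f (ball q r) * measure lborel (ball q r))"
proof -
  have pos: "0 < measure lborel (ball q r)" using content_ball_pos[OF r, of q] by simp
  have "energy (\<lambda>x. ennreal (f x)) (ball q r) \<le> energy (\<lambda>x. 1) (ball q r)"
    using f(2) by (intro nn_integral_mono mult_right_mono) (auto simp: ennreal_le_1)
  also have "\<dots> = emeasure lborel (ball q r)" by simp
  also have "\<dots> < \<infinity>" by (rule emeasure_bounded_finite) simp
  finally show ?thesis using pos by (simp add: mean_on_def)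
qed

lemma mean_on_near:
  assumes r: "r > 0" and c: "0 \<le> c" and near: "\<And>x. x \<in> ball q r \<Longrightarrow> \<bar>f x - c\<bar> \<le> e"
  shows "\<bar>mean_on f (ball q r) - c\<bar> \<le> e"
proof -
  let ?V = "measure lborel (ball q r)" and ?m = "mean_on f (ball q r)"
  have pos: "0 < ?V" using content_ball_pos[OF r, of q] by simp
  have e: "0 \<le> e" using near[of q] r by (simp add: order_trans[OF abs_ge_zero])
  have m0: "0 \<le> ?m" by (simp add: mean_on_def)
  have const: "ennreal (b * ?V) = energy (\<lambda>x. ennreal b) (ball q r)" if "0 \<le> b" for b
    using emeasure_eq_ennreal_measure[of lborel "ball q r"] emeasure_bounded_finite[of "ball q r"] that
    by (simp add: nn_integral_cmult_indicator ennreal_mult less_top)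
  have "ennreal (?m * ?V) \<le> ennreal ((c + e) * ?V)"
    unfolding mean_on_ball[OF r, symmetric] const[OF add_nonneg_nonneg[OF c e]]
  proof (intro nn_integral_mono)
    fix x show "ennreal (f x) * indicator (ball q r) x \<le> ennreal (c + e) * indicator (ball q r) x"
      using near[of x] by (auto simp: indicator_def abs_le_iff intro!: ennreal_leI)
  qed
  then have up: "?m \<le> c + e" using pos c e by (simp add: ennreal_le_iff)
  have "ennreal (max 0 (c - e) * ?V) \<le> ennreal (?m * ?V)"
    unfolding mean_on_ball[OF r, symmetric] const[OF max.cobounded1]
  proof (intro nn_integral_mono)
    fix x show "ennreal (max 0 (c - e)) * indicator (ball q r) x \<le> ennreal (f x) * indicator (ball q r) x"
      using near[of x] f(1)[of x] by (auto simp: indicator_def abs_le_iff intro!: ennreal_leI)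
  qed
  then have "max 0 (c - e) \<le> ?m" using pos m0 by (simp add: ennreal_le_iff)
  with up show ?thesis by (simp add: abs_le_iff)
qed

text \<open>Poincare inequality: the segment bound is averaged over \<open>a\<close> in the first
  small ball and \<open>b\<close> in the second. Its energy term is enlarged to all pairs from
  \<open>ball q t\<close>, where \<open>nn_integral_segments\<close> applies.\<close>

lemma mean_on_diff_le:
  assumes P[measurable]: "P \<in> borel_measurable borel"
    and e: "energy_bound W f P" and W: "ball q t \<subseteq> W" and t: "t > 0" and k: "k > 0"
    and sub: "ball q1 t1 \<subseteq> ball q t" "ball q2 t2 \<subseteq> ball q t" and t12: "t/2 \<le> t1" "t/2 \<le> t2"
    and I: "energy P (ball q t) \<le> ennreal I" "0 \<le> I"
  shows "mean_on f (ball q1 t1) - mean_on f (ball q2 t2) \<le>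
    k + 16 ^ DIM('a) / measure lborel (ball (0::'a) 1) * I / k ^ (DIM('a) - 1)"
proof -
  let ?n = "DIM('a)" and ?S = "ball q t" and ?S1 = "ball q1 t1" and ?S2 = "ball q2 t2"
  let ?m1 = "mean_on f (ball q1 t1)" and ?m2 = "mean_on f (ball q2 t2)"
  let ?\<omega> = "measure lborel (ball (0::'a) 1)"
  have tpos: "t1 > 0" "t2 > 0" using t t12 by auto
  have w: "?\<omega> > 0" using content_ball_pos[of 1 "0::'a"] by simp
  have meas: "measure lborel (ball p r) = r ^ ?n * ?\<omega>" if "r > 0" for p :: 'a and r
    using content_ball_conv_unit_ball[of r p] that by simp
  have em: "emeasure lborel (ball p r) = ennreal (measure lborel (ball p r))" for p :: 'a and r
    using emeasure_eq_ennreal_measure[of lborel "ball p r"] emeasure_bounded_finite[of "ball p r"] by (simp add: less_top)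
  have npos: "?n > 0" by simp
  have bs[simp, measurable]: "ball p r \<in> sets borel" for p :: 'a and r by simp
  define G where "G = (2 * t) ^ ?n / k ^ (?n - 1)"
  have G: "G \<ge> 0" using t k by (simp add: G_def)
  define L where "L a b = (\<integral>\<^sup>+s. P (a + s *\<^sub>R (b - a)) * indicator {0..1::real} s \<partial>lborel)" for a b
  have Lm[measurable]: "case_prod L \<in> borel_measurable (borel \<Otimes>\<^sub>M borel)"
    unfolding L_def by measurable
  \<comment> \<open>The term \<open>f b\<close> stands on the right so that both sides can be
    integrated in \<open>ennreal\<close>.\<close>
  have pt: "ennreal (f a) \<le> ennreal (f b) + ennreal k + ennreal G * L a b"
    if ab: "a \<in> ?S" "b \<in> ?S" for a b
  proof -
    \<comment> \<open>Since \<open>dist a b\<close> is at most \<open>2 * t\<close>, this choice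
      turns the constant term into \<open>k\<close>.\<close>
    define c where "c = k / (2 * t)"
    have c: "c > 0" using k t by (simp add: c_def)
    have d: "dist a b \<le> 2 * t"
      using ab dist_triangle[of a b q] by (simp add: dist_commute)
    have "ennreal (f a - f b) \<le> ennreal (dist a b) * (ennreal c + ennreal (1 / c ^ (?n - 1)) * L a b)"
      using e ab W c unfolding energy_bound_def L_def by blast
    also have "\<dots> \<le> ennreal (2 * t) * (ennreal c + ennreal (1 / c ^ (?n - 1)) * L a b)"
      using d by (intro mult_right_mono ennreal_leI) auto
    also have "\<dots> = ennreal (2 * t * c) + ennreal (2 * t * (1 / c ^ (?n - 1))) * L a b"
      using t c by (subst ennreal_mult, simp, simp, subst ennreal_mult) (simp_all add: distrib_left mult.assoc)
    also have "2 * t * c = k" using t by (simp add: c_def)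
    also have "2 * t * (1 / c ^ (?n - 1)) = G"
    proof -
      have "(2 * t) ^ ?n = 2 * t * (2 * t) ^ (?n - 1)"
        using npos by (metis power_eq_if neq0_conv)
      then show ?thesis by (simp add: c_def G_def power_divide)
    qed
    finally have *: "ennreal (f a - f b) \<le> ennreal k + ennreal G * L a b" .
    have "ennreal (f a) \<le> ennreal (f b + max 0 (f a - f b))" by (rule ennreal_leI) simp
    also have "\<dots> = ennreal (f b) + ennreal (f a - f b)"
      using f(1)[of b] by (simp add: ennreal_plus max_def ennreal_neg)
    also have "\<dots> \<le> ennreal (f b) + (ennreal k + ennreal G * L a b)"
      using * by (rule add_left_mono)
    finally show ?thesis by (simp add: add.assoc)
  qed
  let ?V = "measure lborel ?S" and ?V1 = "measure lborel ?S1" and ?V2 = "measure lborel ?S2"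
  have V: "?V = t ^ ?n * ?\<omega>" "?V1 = t1 ^ ?n * ?\<omega>" "?V2 = t2 ^ ?n * ?\<omega>"
    using meas t tpos by blast+
  have Vpos: "?V > 0" "?V1 > 0" "?V2 > 0" using w t tpos unfolding V by simp_all
  have mp: "0 \<le> ?m1" "0 \<le> ?m2" by (simp_all add: mean_on_def)
  have "ennreal (?m1 * ?V1 * ?V2) = energy (\<lambda>a. ennreal (f a)) ?S1 * emeasure lborel ?S2"
    using mp Vpos unfolding mean_on_ball[OF tpos(1)] em by (simp add: ennreal_mult)
  also have "\<dots> = (\<integral>\<^sup>+a. (\<integral>\<^sup>+b. ennreal (f a) * indicator ?S1 a * indicator ?S2 b \<partial>lborel) \<partial>lborel)"
    by (subst nn_integral_multc[symmetric], measurable) (simp add: nn_integral_cmult_indicator)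
  also have "\<dots> \<le> (\<integral>\<^sup>+a. (\<integral>\<^sup>+b. (ennreal (f b) * indicator ?S2 b) * indicator ?S1 a
      + ennreal k * indicator ?S1 a * indicator ?S2 b
      + ennreal G * (indicator ?S a * indicator ?S b * L a b) \<partial>lborel) \<partial>lborel)"
  proof (intro nn_integral_mono)
    fix a b
    show "ennreal (f a) * indicator ?S1 a * indicator ?S2 b \<le> (ennreal (f b) * indicator ?S2 b) * indicator ?S1 a
      + ennreal k * indicator ?S1 a * indicator ?S2 b + ennreal G * (indicator ?S a * indicator ?S b * L a b)"
    proof (cases "a \<in> ?S1 \<and> b \<in> ?S2")
      case True
      then have "a \<in> ?S" "b \<in> ?S" using sub by blast+
      then show ?thesis using pt[of a b] True by simp
    next
      case False
      then have "ennreal (f a) * indicator ?S1 a * indicator ?S2 b = 0" by (auto simp: indicator_def)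
      then show ?thesis by (simp only: zero_le)
    qed
  qed
  also have "\<dots> = (\<integral>\<^sup>+a. energy (\<lambda>b. ennreal (f b)) ?S2 * indicator ?S1 a
      + ennreal k * indicator ?S1 a * emeasure lborel ?S2
      + ennreal G * (\<integral>\<^sup>+b. indicator ?S a * indicator ?S b * L a b \<partial>lborel) \<partial>lborel)"
  proof (intro nn_integral_cong)
    fix a
    have [measurable]: "L a \<in> borel_measurable borel" unfolding L_def by measurable
    show "(\<integral>\<^sup>+b. (ennreal (f b) * indicator ?S2 b) * indicator ?S1 a
      + ennreal k * indicator ?S1 a * indicator ?S2 b
      + ennreal G * (indicator ?S a * indicator ?S b * L a b) \<partial>lborel) =
      energy (\<lambda>b. ennreal (f b)) ?S2 * indicator ?S1 a
      + ennreal k * indicator ?S1 a * emeasure lborel ?S2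
      + ennreal G * (\<integral>\<^sup>+b. indicator ?S a * indicator ?S b * L a b \<partial>lborel)"
      by (subst nn_integral_add, measurable, subst nn_integral_add, measurable,
          subst nn_integral_multc, measurable, subst nn_integral_cmult, measurable)
         (simp add: nn_integral_cmult_indicator)
  qed
  also have "\<dots> = energy (\<lambda>b. ennreal (f b)) ?S2 * emeasure lborel ?S1
      + ennreal k * emeasure lborel ?S1 * emeasure lborel ?S2
      + ennreal G * (\<integral>\<^sup>+a. (\<integral>\<^sup>+b. indicator ?S a * indicator ?S b * L a b \<partial>lborel) \<partial>lborel)"
  proof -
    have Hm: "(\<lambda>a. \<integral>\<^sup>+b. indicator ?S a * indicator ?S b * L a b \<partial>lborel) \<in> borel_measurable borel"
      by measurable
    have "(\<integral>\<^sup>+a. c * indicator ?S1 a + k * indicator ?S1 a * d + g * H a \<partial>lborel)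
      = c * emeasure lborel ?S1 + k * emeasure lborel ?S1 * d + g * (\<integral>\<^sup>+a. H a \<partial>lborel)"
      if [measurable]: "H \<in> borel_measurable borel" for c d k g :: ennreal and H
    proof -
      have "(\<integral>\<^sup>+a. c * indicator ?S1 a + k * d * indicator ?S1 a + g * H a \<partial>lborel)
        = c * emeasure lborel ?S1 + k * d * emeasure lborel ?S1 + g * (\<integral>\<^sup>+a. H a \<partial>lborel)"
        by (simp add: nn_integral_add nn_integral_cmult)
      then show ?thesis by (simp only: mult_ac)
    qed
    from this[OF Hm] show ?thesis .
  qed
  also have "\<dots> \<le> ennreal (?m2 * ?V2) * ennreal ?V1 + ennreal k * ennreal ?V1 * ennreal ?V2
      + ennreal G * (2 ^ ?n * ennreal ?V * ennreal I)"
  proof -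
    have "(\<integral>\<^sup>+a. (\<integral>\<^sup>+b. indicator ?S a * indicator ?S b * L a b \<partial>lborel) \<partial>lborel)
        \<le> 2 ^ ?n * emeasure lborel ?S * energy P ?S"
      unfolding L_def by (rule nn_integral_segments) auto
    also have "\<dots> \<le> 2 ^ ?n * emeasure lborel ?S * ennreal I" using I(1) by (intro mult_left_mono) auto
    finally show ?thesis
      unfolding mean_on_ball[OF tpos(2)] em by (intro add_mono mult_left_mono) auto
  qed
  also have "\<dots> = ennreal (?m2 * ?V2 * ?V1 + k * ?V1 * ?V2 + G * (2 ^ ?n * ?V * I))"
    using mp Vpos k G I(2)
    by (simp add: ennreal_mult ennreal_plus ennreal_power[symmetric])
  finally have main: "?m1 * ?V1 * ?V2 \<le> ?m2 * ?V2 * ?V1 + k * ?V1 * ?V2 + G * (2 ^ ?n * ?V * I)"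
    using mp Vpos k G I(2) by (subst (asm) ennreal_le_iff) (auto intro!: add_nonneg_nonneg mult_nonneg_nonneg)
  \<comment> \<open>The constant 16^n collects four factors 2^n: from the diameter
    \<open>2 * t\<close> in \<open>G\<close>, from \<open>nn_integral_segments\<close>, and from
    each of the radii \<open>t1\<close>, \<open>t2\<close> being at least
    \<open>t/2\<close>.\<close>
  have "G * (2 ^ ?n * ?V * I) \<le> (16 ^ ?n / ?\<omega> * I / k ^ (?n - 1)) * (?V1 * ?V2)"
  proof -
    have "(t/2) ^ ?n * (t/2) ^ ?n \<le> t1 ^ ?n * t2 ^ ?n"
      using t t12 by (intro mult_mono power_mono) auto
    then have "16 ^ ?n / ?\<omega> * I / k ^ (?n - 1) * ((t/2) ^ ?n * (t/2) ^ ?n) * (?\<omega> * ?\<omega>)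
       \<le> 16 ^ ?n / ?\<omega> * I / k ^ (?n - 1) * (t1 ^ ?n * t2 ^ ?n) * (?\<omega> * ?\<omega>)"
      using w I(2) k by (intro mult_right_mono mult_left_mono) auto
    moreover have "G * (2 ^ ?n * ?V * I) = 16 ^ ?n / ?\<omega> * I / k ^ (?n - 1) * ((t/2) ^ ?n * (t/2) ^ ?n) * (?\<omega> * ?\<omega>)"
    proof -
      have "(16::real) ^ ?n = 2 ^ ?n * 2 ^ ?n * (2 ^ ?n * 2 ^ ?n)" by (simp flip: power_mult_distrib)
      then show ?thesis using w t k
        by (simp add: G_def V power_mult_distrib power_divide field_simps)
    qed
    ultimately show ?thesis unfolding V by (simp only: mult_ac)
  qed
  with main have "?m1 * (?V1 * ?V2) \<le> (?m2 + k + 16 ^ ?n / ?\<omega> * I / k ^ (?n - 1)) * (?V1 * ?V2)"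
    by (simp add: algebra_simps)
  then have "?m1 \<le> ?m2 + k + 16 ^ ?n / ?\<omega> * I / k ^ (?n - 1)"
    using Vpos by (simp add: mult_le_cancel_right)
  then show ?thesis by simp
qed

section \<open>Loewner estimate\<close>

text \<open>With energy at most k^n both terms of the Poincare inequality are multiples of
  \<open>k\<close>, as k^n / k^(n-1) = k. Exchanging the two balls gives the absolute value.\<close>

lemma mean_on_dist_le:
  assumes P: "P \<in> borel_measurable borel"
    and e: "energy_bound W f P" and W: "ball q t \<subseteq> W" and t: "t > 0" and k: "k > 0"
    and sub: "ball q1 t1 \<subseteq> ball q t" "ball q2 t2 \<subseteq> ball q t" and t12: "t/2 \<le> t1" "t/2 \<le> t2"
    and I: "energy P (ball q t) \<le> ennreal (k ^ DIM('a))"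
  shows "\<bar>mean_on f (ball q1 t1) - mean_on f (ball q2 t2)\<bar> \<le>
    (1 + 16 ^ DIM('a) / measure lborel (ball (0::'a) 1)) * k"
proof -
  let ?C = "16 ^ DIM('a) / measure lborel (ball (0::'a) 1)"
  have e: "k + ?C * k ^ DIM('a) / k ^ (DIM('a) - 1) = (1 + ?C) * k"
  proof -
    have "k ^ DIM('a) = k * k ^ (DIM('a) - 1)" by (metis power_eq_if DIM_positive neq0_conv)
    then show ?thesis using k by (simp add: field_simps)
  qed
  have "mean_on f (ball q1 t1) - mean_on f (ball q2 t2) \<le> (1 + ?C) * k"
    using mean_on_diff_le[OF P assms(2) W t k sub t12 I] k e by simp
  moreover have "mean_on f (ball q2 t2) - mean_on f (ball q1 t1) \<le> (1 + ?C) * k"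
    using mean_on_diff_le[OF P assms(2) W t k sub(2,1) t12(2,1) I] k e by simp
  ultimately show ?thesis by (simp add: abs_le_iff)
qed

text \<open>Halving the radius halves the allowed energy, so consecutive means differ by at most a
  multiple of \<open>k * j ^ l\<close>, and the geometric series converges. By continuity the means
  tend to \<open>f q\<close>.\<close>

lemma telescoping_mean_on:
  assumes P: "P \<in> borel_measurable borel" and c: "isCont f q"
    and e: "energy_bound W f P" and W: "ball q t \<subseteq> W" and t: "t > 0" and k: "k > 0"
    and j: "0 < j" "j < 1" "j ^ DIM('a) = 1/2"
    and I: "\<And>l. energy P (ball q (t / 2 ^ l)) \<le> ennreal (k ^ DIM('a) / 2 ^ l)"
  shows "\<bar>f q - mean_on f (ball q t)\<bar> \<le>
    (1 + 16 ^ DIM('a) / measure lborel (ball (0::'a) 1)) * k / (1 - j)"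
proof -
  let ?C = "1 + 16 ^ DIM('a) / measure lborel (ball (0::'a) 1)"
  let ?m = "\<lambda>l. mean_on f (ball q (t / 2 ^ l))"
  have C: "?C > 0" by (simp add: add_pos_nonneg)
  have step: "\<bar>?m (Suc l) - ?m l\<bar> \<le> ?C * (k * j ^ l)" for l
  proof (rule mean_on_dist_le[OF P e, where q = q and t = "t / 2 ^ l"])
    have le: "t / 2 ^ l \<le> t" using t by (simp add: divide_le_eq mult_le_cancel_left1)
    then show "ball q (t / 2 ^ l) \<subseteq> W" using W by (meson order_trans subset_ball)
    have "(j ^ l) ^ DIM('a) = 1 / 2 ^ l"
      by (metis j(3) power_mult mult.commute power_one_over)
    then have "(k * j ^ l) ^ DIM('a) = k ^ DIM('a) / 2 ^ l" by (simp add: power_mult_distrib)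
    then show "energy P (ball q (t / 2 ^ l)) \<le> ennreal ((k * j ^ l) ^ DIM('a))"
      using I[of l] by simp
    have half: "t / 2 ^ Suc l \<le> t / 2 ^ l" using t by (simp add: field_simps)
    then show "ball q (t / 2 ^ Suc l) \<subseteq> ball q (t / 2 ^ l)" by (rule subset_ball)
    show "t / 2 ^ l / 2 \<le> t / 2 ^ l" using t by (simp add: field_simps)
  qed (use t k j in \<open>auto simp: mult.commute\<close>)
  have sum: "\<bar>?m l - ?m 0\<bar> \<le> ?C * k * (\<Sum>i<l. j ^ i)" for l
  proof (induction l)
    case (Suc l)
    have "\<bar>?m (Suc l) - ?m 0\<bar> \<le> \<bar>?m l - ?m 0\<bar> + \<bar>?m (Suc l) - ?m l\<bar>" by linarith
    also have "\<dots> \<le> ?C * k * (\<Sum>i<l. j ^ i) + ?C * (k * j ^ l)"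
      using Suc step[of l] by (rule add_mono)
    finally show ?case by (simp only: sum.lessThan_Suc distrib_left mult.assoc)
  qed simp
  have bound: "\<bar>?m l - ?m 0\<bar> \<le> ?C * k / (1 - j)" for l
  proof -
    have "(\<Sum>i<l. j ^ i) = (1 - j ^ l) / (1 - j)" using j by (simp add: sum_gp_strict)
    also have "\<dots> \<le> 1 / (1 - j)" using j by (intro divide_right_mono) auto
    finally have "?C * k * (\<Sum>i<l. j ^ i) \<le> ?C * k * (1 / (1 - j))"
      using C k by (intro mult_left_mono) auto
    with sum[of l] show ?thesis by simp
  qed
  have near: "\<exists>l. \<bar>f q - ?m l\<bar> \<le> r0" if r0: "r0 > 0" for r0
  proof -
    obtain d where d: "d > 0" "\<And>x. dist x q < d \<Longrightarrow> dist (f x) (f q) < r0"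
      using c r0 unfolding continuous_at_eps_delta by blast
    obtain l where l: "(1/2) ^ l < d / t"
      using real_arch_pow_inv[of "d / t" "1/2"] d t by auto
    then have lt: "t / 2 ^ l < d" using t by (simp add: field_simps)
    have pos: "t / 2 ^ l > 0" using t by simp
    have b: "\<bar>f x - f q\<bar> < r0" if "x \<in> ball q (t / 2 ^ l)" for x
      using d(2)[of x] that lt by (auto simp: dist_real_def dist_commute)
    have "\<bar>?m l - f q\<bar> \<le> r0" by (rule mean_on_near[OF pos f(1)]) (use b in \<open>auto intro: less_imp_le\<close>)
    then show ?thesis by (intro exI[of _ l]) (simp add: abs_minus_commute)
  qed
  have "\<bar>f q - ?m 0\<bar> \<le> ?C * k / (1 - j) + r0" if "r0 > 0" for r0
  proof -
    obtain l where "\<bar>f q - ?m l\<bar> \<le> r0" using near[OF \<open>r0 > 0\<close>] by blast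
    with bound[of l] show ?thesis by linarith
  qed
  then have "\<bar>f q - ?m 0\<bar> \<le> ?C * k / (1 - j)" by (rule field_le_epsilon)
  then show ?thesis by simp
qed

end

text \<open>Since \<open>dist x (q t) = t\<close>, disjoint intervals around the parameters \<open>t\<close> give disjoint balls around
  the points \<open>q t\<close>, so a one-dimensional covering argument suffices.\<close>

lemma energy_covering:
  fixes x :: "'a::euclidean_space" and P :: "'a \<Rightarrow> ennreal"
  assumes P[measurable]: "P \<in> borel_measurable borel" and "0 \<le> \<beta>" "0 \<le> n"
    and q: "\<And>t. t \<in> {\<alpha>..\<alpha>+\<beta>} \<Longrightarrow> dist x (q t) = t"
    and r: "\<And>t. t \<in> {\<alpha>..\<alpha>+\<beta>} \<Longrightarrow> 0 < r t \<and> r t \<le> B \<and> ball (q t) (r t) \<subseteq> W"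
    and large: "\<And>t. t \<in> {\<alpha>..\<alpha>+\<beta>} \<Longrightarrow>
      ennreal (n * r t) \<le> energy P (ball (q t) (r t))"
  shows "ennreal (n * \<beta> / 10) \<le> energy P W"
proof -
  let ?T = "{\<alpha>..\<alpha>+\<beta>}"
  have "?T \<subseteq> (\<Union>t\<in>?T. ball t (r t))" using r by force
  then obtain K where K: "K \<subseteq> ?T" "finite K" "?T \<subseteq> (\<Union>t\<in>K. ball t (r t))"
    using compactE_image[OF compact_Icc[of \<alpha> "\<alpha>+\<beta>"], of ?T "\<lambda>t. ball t (r t)"] by (metis open_ball)
  obtain C where C: "C \<subseteq> K" "pairwise (\<lambda>i j. disjnt (ball i (r i)) (ball j (r j))) C"
    "?T \<subseteq> (\<Union>i\<in>C. ball i (5 * r i))"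
  proof (rule Vitali_covering_lemma_balls)
    show "?T \<subseteq> (\<Union>t\<in>K. ball t (r t))" by (rule K(3))
    show "0 < r i \<and> r i \<le> B" if "i \<in> K" for i using r K(1) that by blast
  qed (rule that)
  have fin: "finite C" using C(1) K(2) finite_subset by blast
  have CT: "i \<in> ?T" if "i \<in> C" for i using C(1) K(1) that by blast
  \<comment> \<open>The five-fold enlarged intervals have length \<open>10 * r i\<close> and cover
    \<open>?T\<close>; comparing lengths yields the divisor 10.\<close>
  have "\<beta> \<le> (\<Sum>i\<in>C. 10 * r i)"
  proof -
    have "ennreal \<beta> = emeasure lborel ?T" using \<open>0 \<le> \<beta>\<close> by simp
    also have "\<dots> \<le> emeasure lborel (\<Union>i\<in>C. ball i (5 * r i))"
      using C(3) fin by (intro emeasure_mono) auto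
    also have "\<dots> \<le> (\<Sum>i\<in>C. emeasure lborel (ball i (5 * r i)))"
      using fin by (intro emeasure_subadditive_finite) auto
    also have "\<dots> = (\<Sum>i\<in>C. ennreal (10 * r i))"
      using r CT by (intro sum.cong) (fastforce simp: ball_eq_greaterThanLessThan)+
    also have "\<dots> = ennreal (\<Sum>i\<in>C. 10 * r i)"
      using r CT by (intro sum_ennreal) (fastforce intro: less_imp_le)+
    finally show ?thesis
      using r CT by (subst (asm) ennreal_le_iff) (fastforce intro!: sum_nonneg intro: less_imp_le)+
  qed
  then have "n * \<beta> / 10 \<le> (\<Sum>i\<in>C. n * r i)"
    using \<open>0 \<le> n\<close> mult_left_mono[of \<beta> "\<Sum>i\<in>C. 10 * r i" n]
    by (simp add: sum_distrib_left[symmetric] mult.left_commute)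
  then have "ennreal (n * \<beta> / 10) \<le> ennreal (\<Sum>i\<in>C. n * r i)" by (rule ennreal_leI)
  also have "\<dots> = (\<Sum>i\<in>C. ennreal (n * r i))"
    using r CT \<open>0 \<le> n\<close> by (intro sum_ennreal[symmetric]) (fastforce intro!: mult_nonneg_nonneg intro: less_imp_le)
  also have "\<dots> \<le> (\<Sum>i\<in>C. energy P (ball (q i) (r i)))"
    using large CT by (intro sum_mono) auto
  also have "\<dots> = (\<integral>\<^sup>+x. (\<Sum>i\<in>C. P x * indicator (ball (q i) (r i)) x) \<partial>lborel)"
    by (intro nn_integral_sum[symmetric] borel_measurable_times_ennreal borel_measurable_indicator) auto
  also have "\<dots> \<le> energy P W"
  proof (intro nn_integral_mono)
    fix z
    have disj: "disjoint_family_on (\<lambda>i. ball (q i) (r i)) C"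
      unfolding disjoint_family_on_def
    proof (intro ballI impI)
      fix i j assume ij: "i \<in> C" "j \<in> C" "i \<noteq> j"
      show "ball (q i) (r i) \<inter> ball (q j) (r j) = {}"
      proof (rule ccontr)
        assume "\<not> ?thesis"
        then obtain y where y: "dist (q i) y < r i" "dist (q j) y < r j" by auto
        have "\<bar>dist x y - dist x (q i)\<bar> \<le> dist (q i) y" "\<bar>dist x y - dist x (q j)\<bar> \<le> dist (q j) y"
          using dist_triangle[of x y "q i"] dist_triangle[of x "q i" y] dist_triangle[of x y "q j"]
            dist_triangle[of x "q j" y] by (simp_all add: dist_commute abs_le_iff)
        then have "dist x y \<in> ball i (r i)" "dist x y \<in> ball j (r j)"
          using y q[OF CT[OF ij(1)]] q[OF CT[OF ij(2)]] by (auto simp: dist_real_def abs_minus_commute)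
        then show False using C(2) ij unfolding pairwise_def disjnt_def by blast
      qed
    qed
    have "(\<Sum>i\<in>C. P z * indicator (ball (q i) (r i)) z) = P z * (\<Sum>i\<in>C. indicator (ball (q i) (r i)) z)"
      by (simp add: sum_distrib_left)
    also have "(\<Sum>i\<in>C. indicator (ball (q i) (r i)) z) = (indicator (\<Union>i\<in>C. ball (q i) (r i)) z :: ennreal)"
      by (rule indicator_UN_disjoint[symmetric, OF fin disj])
    also have "\<dots> \<le> indicator W z"
      using r CT by (fastforce simp: indicator_def)
    finally show "(\<Sum>i\<in>C. P z * indicator (ball (q i) (r i)) z) \<le> P z * indicator W z"
      by (simp add: mult_left_mono)
  qed
  finally show ?thesis .
qed

text \<open>In base and power this is k^n / 80 with k = (1 - j) / (8 C), where j^n = 1/2 and C is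
  the factor in \<open>mean_on_dist_le\<close>. The 8 brings the telescoping error down to 1/8. The
  80 is 8 * 10: the ratio of the radius \<open>2 * s\<close> to the interval length
  \<open>s/4\<close>, times the 10 of \<open>energy_covering\<close>.\<close>

definition loewner_const :: "nat \<Rightarrow> real \<Rightarrow> real"
  where "loewner_const n \<omega> = ((1 - root n (1/2)) / (8 * (1 + 16 ^ n / \<omega>))) ^ n / 80"

text \<open>With less energy, each of the two level sets contains a point around which the energy of
  balls decays at least like the radius; telescoping puts the value there within 1/4 of the mean
  over \<open>W\<close>, and 0 and 1 cannot both be that close. A continuum enters only through the
  spheres around \<open>x\<close> that it meets, with radii filling an interval of length
  \<open>s/4\<close>.\<close>

proposition loewner_estimate:
  fixes f :: "'a::euclidean_space \<Rightarrow> real" and x :: 'a and s :: real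
  defines "W \<equiv> ball x (4 * s)"
  assumes c: "continuous_on W f" and f: "\<And>z. z \<in> W \<Longrightarrow> 0 \<le> f z" "\<And>z. z \<in> W \<Longrightarrow> f z \<le> 1"
    and P[measurable]: "P \<in> borel_measurable borel" and e: "energy_bound W f P" and s: "s > 0"
    and E: "0 \<le> \<alpha>" "\<alpha> + s/4 \<le> 2 * s" "\<And>t. t \<in> {\<alpha>..\<alpha> + s/4} \<Longrightarrow> \<exists>q. dist x q = t \<and> f q = 0"
    and F: "0 \<le> \<beta>" "\<beta> + s/4 \<le> 2 * s" "\<And>t. t \<in> {\<beta>..\<beta> + s/4} \<Longrightarrow> \<exists>q. dist x q = t \<and> f q = 1"
  shows "ennreal (loewner_const DIM('a) (measure lborel (ball (0::'a) 1))) \<le> energy P W"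
proof (rule ccontr)
  let ?J = "\<lambda>q r. \<integral>\<^sup>+z. P z * indicator (ball q r) z \<partial>lborel"
  let ?n = "DIM('a)" and ?\<omega> = "measure lborel (ball (0::'a) 1)"
  define j where "j = root ?n (1/2)"
  define C where "C = 1 + 16 ^ ?n / ?\<omega>"
  define k where "k = (1 - j) / (8 * C)"
  define n where "n = k ^ ?n / 80"
  have j: "0 < j" "j < 1" "j ^ ?n = 1/2" unfolding j_def by (simp_all add: real_root_lt_1_iff)
  have C: "C \<ge> 1" by (simp add: C_def)
  have k: "k > 0" using j C by (simp add: k_def)
  have n: "n > 0" using k by (simp add: n_def)
  have k1: "C * k / (1 - j) = 1/8" using C j by (simp add: k_def)
  have k2: "C * k \<le> 1/8" using C j by (simp add: k_def)
  have cn: "loewner_const ?n ?\<omega> = n" by (simp add: loewner_const_def n_def k_def C_def j_def)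
  assume "\<not> ?thesis"
  then have small: "energy P W < ennreal n" by (simp add: cn not_le)
  \<comment> \<open>Cutting off outside the open set \<open>W\<close> gives a Borel function on the
    whole space and keeps continuity at the points of \<open>W\<close>.\<close>
  define w where "w z = (if z \<in> W then f z else 0)" for z
  have W[measurable]: "open W" "W \<in> sets borel" by (simp_all add: W_def)
  have wm: "w \<in> borel_measurable borel"
  proof -
    have "(\<lambda>z. indicator W z *\<^sub>R f z) \<in> borel_measurable borel"
      by (rule borel_measurable_continuous_on_indicator[OF _ c]) simp
    also have "(\<lambda>z. indicator W z *\<^sub>R f z) = w" by (auto simp: w_def indicator_def)
    finally show ?thesis .
  qed
  have w: "0 \<le> w z" "w z \<le> 1" for z using f by (auto simp: w_def)
  have we: "energy_bound W w P" using e by (simp add: energy_bound_def w_def)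
  have w_cont: "isCont w z" if "z \<in> W" for z
  proof -
    have "isCont f z" using c that W(1) by (simp add: continuous_on_eq_continuous_at)
    moreover have "eventually (\<lambda>y. w y = f y) (nhds z)"
      using eventually_nhds_in_open[OF W(1) that] by (rule eventually_mono) (simp add: w_def)
    ultimately show ?thesis by (simp add: isCont_cong)
  qed
  have key: "\<bar>v - mean_on w W\<bar> \<le> 1/4"
    if ab: "0 \<le> a" "a + s/4 \<le> 2 * s" and ex: "\<And>t. t \<in> {a..a + s/4} \<Longrightarrow> \<exists>q. dist x q = t \<and> f q = v" for a v
  proof -
    obtain q where q: "\<And>t. t \<in> {a..a + s/4} \<Longrightarrow> dist x (q t) = t \<and> f (q t) = v"
      using ex by metis
    have sub: "ball (q t) (2 * s) \<subseteq> W" "q t \<in> W" if t: "t \<in> {a..a + s/4}" for t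
    proof -
      have d: "dist (q t) x \<le> 2 * s" using q[OF t] t ab by (simp add: dist_commute)
      show "ball (q t) (2 * s) \<subseteq> W" unfolding W_def ball_subset_ball_iff using d s by auto
      show "q t \<in> W" using d s by (simp add: W_def dist_commute)
    qed
    \<comment> \<open>Otherwise every \<open>t\<close> has a ball whose energy is at least a fixed
      multiple of its radius, and \<open>energy_covering\<close> contradicts
      \<open>small\<close>.\<close>
    have "\<exists>t\<in>{a..a + s/4}. \<forall>l. ?J (q t) (2 * s / 2 ^ l) \<le> ennreal (k ^ ?n / 2 ^ l)"
    proof (rule ccontr)
      assume "\<not> ?thesis"
      then have "\<exists>l. ennreal (k ^ ?n / 2 ^ l) \<le> ?J (q t) (2 * s / 2 ^ l)"
        if "t \<in> {a..a + s/4}" for t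
        using that by (meson le_cases)
      then obtain l where l: "\<And>t. t \<in> {a..a + s/4} \<Longrightarrow>
        ennreal (k ^ ?n / 2 ^ l t) \<le> ?J (q t) (2 * s / 2 ^ l t)"
        by metis
      have "ennreal (k ^ ?n / (2 * s) * (s/4) / 10) \<le> energy P W"
      proof (rule energy_covering[OF P, where q = q and x = x and \<alpha> = a and B = "2 * s"
            and r = "\<lambda>t. 2 * s / 2 ^ l t"])
        fix t assume t: "t \<in> {a..a + s/4}"
        show "dist x (q t) = t" using q t by blast
        have le: "2 * s / 2 ^ l t \<le> 2 * s" using s by (simp add: divide_le_eq mult_le_cancel_left1)
        then have "ball (q t) (2 * s / 2 ^ l t) \<subseteq> W" using sub(1)[OF t] by (meson order_trans subset_ball)
        then show "0 < 2 * s / 2 ^ l t \<and> 2 * s / 2 ^ l t \<le> 2 * s \<and> ball (q t) (2 * s / 2 ^ l t) \<subseteq> W"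
          using le s by simp
        have "k ^ ?n / (2 * s) * (2 * s / 2 ^ l t) = k ^ ?n / 2 ^ l t" using s by simp
        then show "ennreal (k ^ ?n / (2 * s) * (2 * s / 2 ^ l t)) \<le>
          ?J (q t) (2 * s / 2 ^ l t)"
          using l[OF t] by simp
      qed (use s k in auto)
      also have "k ^ ?n / (2 * s) * (s/4) / 10 = n" using s by (simp add: n_def)
      finally show False using small by simp
    qed
    then obtain t where t: "t \<in> {a..a + s/4}"
      "\<And>l. ?J (q t) (2 * s / 2 ^ l) \<le> ennreal (k ^ ?n / 2 ^ l)" by blast
    have "\<bar>w (q t) - mean_on w (ball (q t) (2 * s))\<bar> \<le> C * k / (1 - j)"
      unfolding C_def
      by (rule telescoping_mean_on[OF wm w P w_cont[OF sub(2)[OF t(1)]] we sub(1)[OF t(1)] _ k j t(2)]) (use s in simp)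
    moreover have "\<bar>mean_on w (ball (q t) (2 * s)) - mean_on w (ball x (4 * s))\<bar> \<le> C * k"
      unfolding C_def
    proof (rule mean_on_dist_le[OF wm w P we, where q = x and t = "4 * s"])
      have "ennreal n \<le> ennreal (k ^ ?n)" using k by (intro ennreal_leI) (simp add: n_def)
      with small show "energy P (ball x (4 * s)) \<le> ennreal (k ^ ?n)"
        unfolding W_def by simp
      show "ball (q t) (2 * s) \<subseteq> ball x (4 * s)" using sub(1)[OF t(1)] by (simp add: W_def)
    qed (use s k in \<open>auto simp: W_def\<close>)
    moreover have "w (q t) = v" using sub(2)[OF t(1)] q[OF t(1)] by (simp add: w_def)
    ultimately show ?thesis using k1 k2 unfolding W_def by linarith
  qed
  from key[OF E] key[OF F] show False by linarith
qed

section \<open>Energy bounds along segments\<close>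

text \<open>A cut-off function may have kinks where it reaches 0 or 1. For \<open>p < q\<close>
  strictly between \<open>f b\<close> and \<open>f a\<close>, the segment is therefore restricted to
  a piece on which \<open>f\<close> runs from \<open>q\<close> to \<open>p\<close> and stays between
  them; there the fundamental theorem of calculus applies. Afterwards \<open>p\<close> and
  \<open>q\<close> tend to the end values.\<close>

lemma energy_boundI:
  fixes f :: "'a::euclidean_space \<Rightarrow> real"
  assumes W: "convex W" and c: "continuous_on W f"
    and f: "\<And>z. z \<in> W \<Longrightarrow> 0 \<le> f z" "\<And>z. z \<in> W \<Longrightarrow> f z \<le> 1"
    and U: "U = {z \<in> W. 0 < f z \<and> f z < 1}"
    and der: "\<And>z. z \<in> U \<Longrightarrow> (f has_derivative f' z) (at z within W)"
    and bd: "\<And>z v. z \<in> U \<Longrightarrow> \<bar>f' z v\<bar> \<le> w z * norm v"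
    and w: "continuous_on U w" "\<And>z. z \<in> U \<Longrightarrow> 0 \<le> w z"
    and P: "\<And>z. z \<in> U \<Longrightarrow> ennreal (w z ^ DIM('a)) \<le> P z" and Pm: "P \<in> borel_measurable borel"
  shows "energy_bound W f P"
  unfolding energy_bound_def
proof (intro ballI allI impI)
  fix a b and k :: real assume ab: "a \<in> W" "b \<in> W" and k: "k > 0"
  let ?n = "DIM('a)"
  define g where "g s = a + s *\<^sub>R (b - a)" for s :: real
  define R where "R = (\<integral>\<^sup>+s. P (a + s *\<^sub>R (b - a)) * indicator {0..1::real} s \<partial>lborel)"
  define T where "T = ennreal (dist a b) * (ennreal k + ennreal (1 / k ^ (?n - 1)) * R)"
  have gW: "g s \<in> W" if "s \<in> {0..1}" for s
  proof -
    have "g s = (1 - s) *\<^sub>R a + s *\<^sub>R b" by (simp add: g_def algebra_simps)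
    then show ?thesis using convexD[OF W ab, of "1 - s" s] that by simp
  qed
  have cont_seg: "continuous_on S g" for S unfolding g_def by (intro continuous_intros)
  have gc: "continuous_on {0..1} (\<lambda>s. f (g s))"
    using continuous_on_compose2[OF c cont_seg] gW by blast
  have main: "ennreal (q - p) \<le> T" if pq: "f b < p" "p < q" "q < f a" for p q
  proof -
    have cl: "compact ({u..v} \<inter> (\<lambda>s. f (g s)) -` S)" if "{u..v} \<subseteq> {0..1}" "closed S" for u v S
      using continuous_closed_preimage[OF continuous_on_subset[OF gc that(1)] _ that(2)]
      by (metis closed_Int_compact closed_real_atLeastAtMost compact_Icc inf.right_idem inf_commute)
    \<comment> \<open>Here \<open>s1\<close> is the first parameter at which \<open>f\<close> is
      down to \<open>p\<close>, and \<open>s0\<close> the last one before it with value at least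
      \<open>q\<close>.\<close>
    define S1 where "S1 = {0..1} \<inter> (\<lambda>s. f (g s)) -` {..p}"
    have "1 \<in> S1" using pq by (simp add: S1_def g_def)
    then obtain s1 where s1: "s1 \<in> S1" "\<And>s. s \<in> S1 \<Longrightarrow> s1 \<le> s"
      using compact_attains_inf[of S1] cl[of 0 1 "{..p}"] unfolding S1_def by fastforce
    have s1': "0 \<le> s1" "s1 \<le> 1" "f (g s1) \<le> p" using s1(1) by (auto simp: S1_def)
    define S0 where "S0 = {0..s1} \<inter> (\<lambda>s. f (g s)) -` {q..}"
    have "0 \<in> S0" using pq s1' by (simp add: S0_def g_def)
    then obtain s0 where s0: "s0 \<in> S0" "\<And>s. s \<in> S0 \<Longrightarrow> s \<le> s0"
      using compact_attains_sup[of S0] cl[of 0 s1 "{q..}"] s1' unfolding S0_def by fastforce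
    have s0': "0 \<le> s0" "s0 \<le> s1" "f (g s0) \<ge> q" using s0(1) by (auto simp: S0_def)
    have lt: "s0 < s1" using s0' s1' pq by (cases "s0 = s1") auto
    have sub: "{s0..s1} \<subseteq> {0..1}" using s0' s1' by auto
    have gc': "continuous_on {s0..s1} (\<lambda>s. f (g s))" by (rule continuous_on_subset[OF gc sub])
    have gt: "p < f (g s)" if "s \<in> {s0..<s1}" for s
      using s1(2)[of s] that sub by (force simp: S1_def)
    have lt': "f (g s) < q" if "s \<in> {s0<..s1}" for s
      using s0(2)[of s] that sub s0' by (force simp: S0_def)
    have "f (g s1) = p"
    proof (rule ccontr)
      assume "f (g s1) \<noteq> p"
      then have "f (g s1) < p" using s1' by simp
      then obtain s where "s \<in> {s0..s1}" "f (g s) = p"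
        using IVT2'[of "\<lambda>s. f (g s)" s1 p s0] s0' pq gc' by auto
      then show False using gt[of s] \<open>f (g s1) < p\<close> by (cases "s = s1") auto
    qed
    have "f (g s0) = q"
    proof (rule ccontr)
      assume "f (g s0) \<noteq> q"
      then have "f (g s0) > q" using s0' by simp
      then obtain s where "s \<in> {s0..s1}" "f (g s) = q"
        using IVT2'[of "\<lambda>s. f (g s)" s1 q s0] s0' pq gc' \<open>f (g s1) = p\<close> by auto
      then show False using lt'[of s] \<open>f (g s0) > q\<close> by (cases "s = s0") auto
    qed
    have inU: "g s \<in> U" if s: "s \<in> {s0..s1}" for s
    proof -
      have "p \<le> f (g s)" using gt[of s] \<open>f (g s1) = p\<close> s by (cases "s = s1") auto
      moreover have "f (g s) \<le> q" using lt'[of s] \<open>f (g s0) = q\<close> s by (cases "s = s0") auto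
      moreover have "g s \<in> W" using s sub gW by blast
      ultimately show ?thesis using pq f(1)[OF ab(2)] f(2)[OF ab(1)] unfolding U by auto
    qed
    have "((\<lambda>s. f' (g s) (b - a)) has_integral (f (g s1) - f (g s0))) {s0..s1}"
    proof (rule fundamental_theorem_of_calculus)
      show "s0 \<le> s1" by fact
      fix s assume s: "s \<in> {s0..s1}"
      have "(g has_vector_derivative (b - a)) (at s within {s0..s1})"
        unfolding g_def by (auto intro!: derivative_eq_intros)
      then have d1: "(g has_derivative (\<lambda>t. t *\<^sub>R (b - a))) (at s within {s0..s1})"
        by (simp add: has_vector_derivative_def)
      have d2: "(f has_derivative f' (g s)) (at (g s) within g ` {s0..s1})"
        using der[OF inU[OF s]] by (rule has_derivative_subset) (use gW sub in blast)
      have lin: "linear (f' (g s))" using der[OF inU[OF s]] by (rule has_derivative_linear)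
      have "((\<lambda>s. f (g s)) has_derivative (\<lambda>t. f' (g s) (t *\<^sub>R (b - a)))) (at s within {s0..s1})"
        using has_derivative_in_compose[OF d1 d2] .
      then show "((\<lambda>s. f (g s)) has_vector_derivative f' (g s) (b - a)) (at s within {s0..s1})"
        unfolding has_vector_derivative_def using linear_scale[OF lin] by simp
    qed
    from has_integral_neg[OF this]
    have I1: "((\<lambda>s. - f' (g s) (b - a)) has_integral (q - p)) {s0..s1}"
      by (simp add: \<open>f (g s1) = p\<close> \<open>f (g s0) = q\<close>)
    have wc: "continuous_on {s0..s1} (\<lambda>s. w (g s))"
      using continuous_on_compose2[OF w(1) cont_seg] inU by blast
    define r where "r = integral {s0..s1} (\<lambda>s. w (g s) ^ ?n)"
    have Ir: "((\<lambda>s. w (g s) ^ ?n) has_integral r) {s0..s1}"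
      unfolding r_def by (intro integrable_integral integrable_continuous_real continuous_intros wc)
    have r0: "r \<ge> 0" using Ir by (rule has_integral_nonneg) (use w(2) inU in auto)
    have I2: "((\<lambda>s. dist a b * (k + (1 / k ^ (?n - 1)) * w (g s) ^ ?n)) has_integral
        dist a b * (k * (s1 - s0) + (1 / k ^ (?n - 1)) * r)) {s0..s1}"
      using has_integral_const_real[of k s0 s1] lt
      by (intro has_integral_mult_right has_integral_add Ir) (simp add: mult.commute)
    have "q - p \<le> dist a b * (k * (s1 - s0) + (1 / k ^ (?n - 1)) * r)"
    proof (rule has_integral_le[OF I1 I2])
      fix s assume s: "s \<in> {s0..s1}"
      have young: "w (g s) \<le> k + (1 / k ^ (?n - 1)) * w (g s) ^ ?n"
      proof (cases "w (g s) \<le> k")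
        case True
        then show ?thesis using k w(2)[OF inU[OF s]] by (simp add: add_increasing2)
      next
        case False
        have "w (g s) * k ^ (?n - 1) \<le> w (g s) * w (g s) ^ (?n - 1)"
          using False k w(2)[OF inU[OF s]] by (intro mult_left_mono power_mono) auto
        also have "\<dots> = w (g s) ^ ?n" by (metis power_eq_if DIM_positive neq0_conv)
        finally have "w (g s) \<le> (1 / k ^ (?n - 1)) * w (g s) ^ ?n" using k by (simp add: field_simps)
        then show ?thesis using k by simp
      qed
      have "- f' (g s) (b - a) \<le> w (g s) * dist a b"
        using bd[OF inU[OF s], of "b - a"] by (simp add: dist_norm norm_minus_commute)
      also have "\<dots> \<le> (k + (1 / k ^ (?n - 1)) * w (g s) ^ ?n) * dist a b"
        using young by (intro mult_right_mono) auto
      finally show "- f' (g s) (b - a) \<le> dist a b * (k + (1 / k ^ (?n - 1)) * w (g s) ^ ?n)"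
        by (subst mult.commute)
    qed
    also have "\<dots> \<le> dist a b * (k + (1 / k ^ (?n - 1)) * r)"
    proof -
      have "k * (s1 - s0) \<le> k * 1" using k sub lt by (intro mult_left_mono) auto
      then show ?thesis by (intro mult_left_mono) auto
    qed
    finally have "ennreal (q - p) \<le> ennreal (dist a b * (k + (1 / k ^ (?n - 1)) * r))" by (rule ennreal_leI)
    also have "\<dots> = ennreal (dist a b) * (ennreal k + ennreal (1 / k ^ (?n - 1)) * ennreal r)"
      using k r0 by (simp add: ennreal_mult[symmetric] ennreal_plus[symmetric] del: ennreal_plus)
    also have "\<dots> \<le> T"
      unfolding T_def
    proof (intro mult_left_mono add_left_mono)
      have "ennreal r = (\<integral>\<^sup>+s. ennreal (w (g s) ^ ?n) * indicator {s0..s1} s \<partial>lborel)"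
        by (rule nn_integral_has_integral_lebesgue'[OF _ Ir, symmetric]) (use w(2) inU in auto)
      also have "\<dots> \<le> R"
        unfolding R_def
      proof (rule nn_integral_mono)
        fix s
        show "ennreal (w (g s) ^ ?n) * indicator {s0..s1} s \<le> P (a + s *\<^sub>R (b - a)) * indicator {0..1} s"
          using P[OF inU, of s] sub by (auto simp: indicator_def g_def)
      qed
      finally show "ennreal r \<le> R" .
    qed auto
    finally show ?thesis .
  qed
  show "ennreal (f a - f b) \<le> ennreal (dist a b) * (ennreal k + ennreal (1 / k ^ (?n - 1)) *
      (\<integral>\<^sup>+s. P (a + s *\<^sub>R (b - a)) * indicator {0..1::real} s \<partial>lborel))"
    unfolding R_def[symmetric] T_def[symmetric]
  proof (cases "f b < f a")
    case True
    show "ennreal (f a - f b) \<le> T"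
    proof (rule ennreal_le_epsilon)
      fix e :: real assume e: "0 < e"
      \<comment> \<open>The values \<open>p = f b + d\<close> and \<open>q = f a - d\<close> lose
        \<open>2 * d\<close>, at most \<open>e\<close>; the second entry of the minimum keeps
        \<open>p < q\<close>.\<close>
      define d where "d = min (e / 2) ((f a - f b) / 4)"
      have d: "0 < d" "d \<le> e / 2" "d \<le> (f a - f b) / 4" using e True unfolding d_def by (simp_all only: min.cobounded1 min.cobounded2) simp
      have "ennreal (f a - f b) = ennreal (f a - d - (f b + d)) + ennreal (2 * d)"
        using d by (subst ennreal_plus[symmetric]) auto
      also have "\<dots> \<le> T + ennreal e"
        using d True by (intro add_mono main ennreal_leI) auto
      finally show "ennreal (f a - f b) \<le> T + ennreal e" .
    qed
  next
    case False
    then show "ennreal (f a - f b) \<le> T" by (simp add: ennreal_neg)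
  qed
qed

section \<open>Change of variables over arbitrary finite index types\<close>

text \<open>The change of variables theorem of the library requires an index type of class \<open>wellorder\<close>. It is
  transported to an arbitrary finite index type by relabelling the coordinates.\<close>

typedef 'a wo_copy = "UNIV :: 'a set" ..

instance wo_copy :: (finite) finite
proof
  have "UNIV = range (Abs_wo_copy :: 'a \<Rightarrow> 'a wo_copy)"
    by (metis Rep_wo_copy_inverse surj_def)
  then show "finite (UNIV :: 'a wo_copy set)" by (metis finite finite_imageI)
qed

instantiation wo_copy :: (finite) linorder
begin

definition less_eq_wo_copy :: "'a wo_copy \<Rightarrow> 'a wo_copy \<Rightarrow> bool"
  where "less_eq_wo_copy x y \<longleftrightarrow> to_nat (Rep_wo_copy x) \<le> to_nat (Rep_wo_copy y)"

definition less_wo_copy :: "'a wo_copy \<Rightarrow> 'a wo_copy \<Rightarrow> bool"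
  where "less_wo_copy x y \<longleftrightarrow> to_nat (Rep_wo_copy x) < to_nat (Rep_wo_copy y)"

instance
  by standard (auto simp: less_eq_wo_copy_def less_wo_copy_def Rep_wo_copy_inject)

end

instance wo_copy :: (finite) wellorder
proof
  fix P :: "'a wo_copy \<Rightarrow> bool" and a
  assume "\<And>x. (\<And>y. y < x \<Longrightarrow> P y) \<Longrightarrow> P x"
  then show "P a"
    unfolding less_wo_copy_def by (rule measure_induct_rule)
qed

lemma bij_Rep_wo_copy: "bij Rep_wo_copy"
proof (rule bijI)
  show "inj Rep_wo_copy" by (simp add: inj_def Rep_wo_copy_inject)
  show "surj Rep_wo_copy" using Abs_wo_copy_inverse by (metis UNIV_I surj_def)
qed

text \<open>Conjugation by \<open>f\<close> is a sign-preserving bijection between the permutations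
  of the two index types, which matches the Leibniz sums term by term.\<close>

lemma det_reindex:
  fixes A :: "real^'n^'n" and f :: "'m::finite \<Rightarrow> 'n"
  assumes f: "bij f"
  shows "det (\<chi> i j. A $ f i $ f j) = det A"
proof -
  let ?M = "map_permutation UNIV f"
  have inj: "inj f" using f by (rule bij_is_inj)
  have bb: "bij_betw f UNIV UNIV" using f by simp
  have ap: "?M p (f i) = f (p i)" for p i
    using inj by (intro map_permutation_apply) auto
  have "det A = (\<Sum>p | p permutes UNIV. of_int (sign p) * (\<Prod>i\<in>UNIV. A $ i $ p i))"
    by (simp add: det_def)
  also have "\<dots> = (\<Sum>p | p permutes UNIV. of_int (sign (?M p)) * (\<Prod>i\<in>UNIV. A $ i $ ?M p i))"
  proof (rule sum.reindex_bij_witness[of _ ?M "map_permutation UNIV (inv f)"])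
    fix p :: "'n \<Rightarrow> 'n" assume "p \<in> {p. p permutes UNIV}"
    then have p: "p permutes UNIV" by simp
    have bi: "bij_betw (inv f) UNIV UNIV" using f by (simp add: bij_imp_bij_inv)
    show "?M (map_permutation UNIV (inv f) p) = p"
      by (rule map_permutation_compose_inv[OF bi p]) (simp add: surj_f_inv_f bij_is_surj[OF f])
    show "map_permutation UNIV (inv f) p \<in> {p. p permutes UNIV}"
      using map_permutation_permutes[OF bi p] by simp
    show "of_int (sign (?M (map_permutation UNIV (inv f) p))) *
         (\<Prod>i\<in>UNIV. A $ i $ ?M (map_permutation UNIV (inv f) p) i) =
         of_int (sign p) * (\<Prod>i\<in>UNIV. A $ i $ p i)"
      unfolding \<open>?M (map_permutation UNIV (inv f) p) = p\<close> ..
  next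
    fix p :: "'m \<Rightarrow> 'm" assume "p \<in> {p. p permutes UNIV}"
    then have p: "p permutes UNIV" by simp
    show "map_permutation UNIV (inv f) (?M p) = p"
      by (rule map_permutation_compose_inv[OF bb p]) (simp add: inj)
    show "?M p \<in> {p. p permutes UNIV}"
      using map_permutation_permutes[OF bb p] by simp
  qed
  also have "\<dots> = (\<Sum>p | p permutes UNIV. of_int (sign p) * (\<Prod>i\<in>UNIV. A $ f i $ f (p i)))"
  proof (rule sum.cong[OF refl])
    fix p :: "'m \<Rightarrow> 'm" assume "p \<in> {p. p permutes UNIV}"
    then have p: "p permutes UNIV" by simp
    have "(\<Prod>i\<in>UNIV. A $ i $ ?M p i) = (\<Prod>i\<in>UNIV. A $ f i $ ?M p (f i))"
      by (rule prod.reindex_bij_betw[OF bb, symmetric])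
    moreover have "sign (?M p) = sign p"
      using p inj by (intro sign_map_permutation) auto
    ultimately show "of_int (sign (?M p)) * (\<Prod>i\<in>UNIV. A $ i $ ?M p i) =
        (of_int (sign p) * (\<Prod>i\<in>UNIV. A $ f i $ f (p i)) :: real)"
      by (simp add: ap)
  qed
  also have "\<dots> = det (\<chi> i j. A $ f i $ f j)" by (simp add: det_def)
  finally show ?thesis by simp
qed

lemma lborel_distr_reindex:
  fixes f :: "'m::finite \<Rightarrow> 'n::finite"
  assumes f: "bij f"
  shows "distr lborel borel (\<lambda>x :: real^'n. \<chi> i. x $ f i) = (lborel :: (real^'m) measure)"
proof (rule lborel_eqI[symmetric])
  let ?T = "\<lambda>x :: real^'n. (\<chi> i. x $ f i) :: real^'m"
  have Tm[measurable]: "?T \<in> borel_measurable borel"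
    by (intro borel_measurable_continuous_onI continuous_intros)
  fix l u :: "real^'m" assume lu: "\<And>b. b \<in> Basis \<Longrightarrow> l \<bullet> b \<le> u \<bullet> b"
  have le: "l $ i \<le> u $ i" for i using lu[of "axis i 1"] by (simp add: inner_axis)
  let ?l = "\<chi> j. l $ inv f j" and ?u = "\<chi> j. u $ inv f j"
  have "?T -` box l u = box ?l ?u"
  proof -
    have "(\<forall>i. l $ i < x $ f i \<and> x $ f i < u $ i) \<longleftrightarrow> (\<forall>j. l $ inv f j < x $ j \<and> x $ j < u $ inv f j)" for x :: "real^'n"
      by (metis f bij_inv_eq_iff)
    then show ?thesis by (auto simp: mem_box_cart)
  qed
  then have "emeasure (distr lborel borel ?T) (box l u) = emeasure lborel (box ?l ?u)"
    by (subst emeasure_distr) auto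
  also have "\<dots> = ennreal (\<Prod>b\<in>Basis. (?u - ?l) \<bullet> b)"
    using le by (subst emeasure_lborel_box) (auto simp: Basis_vec_def inner_axis)
  also have "(\<Prod>b\<in>Basis. (?u - ?l) \<bullet> b) = (\<Prod>j\<in>UNIV. u $ inv f j - l $ inv f j)"
    by (simp add: Basis_vec_def prod.UNION_disjoint inner_axis axis_eq_axis)
  also have "\<dots> = (\<Prod>i\<in>UNIV. u $ i - l $ i)"
    using bij_imp_bij_inv[OF f] by (intro prod.reindex_bij_betw[of "inv f" UNIV UNIV "\<lambda>i. u $ i - l $ i"]) simp
  also have "\<dots> = (\<Prod>b\<in>Basis. (u - l) \<bullet> b)"
    by (simp add: Basis_vec_def prod.UNION_disjoint inner_axis axis_eq_axis)
  finally show "emeasure (distr lborel borel ?T) (box l u) = (\<Prod>b\<in>Basis. (u - l) \<bullet> b)" .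
qed simp

lemma nn_integral_det_le_wo:
  fixes h :: "real^'n::{finite,wellorder} \<Rightarrow> real^'n::_"
  assumes S: "S \<in> sets borel"
    and der: "\<And>x. x \<in> S \<Longrightarrow> (h has_derivative h' x) (at x within S)" and inj: "inj_on h S"
    and im: "h ` S \<in> lmeasurable"
  shows "(\<integral>\<^sup>+x. ennreal \<bar>det (matrix (h' x))\<bar> * indicator S x \<partial>lborel) = emeasure lebesgue (h ` S)"
proof -
  have "S \<in> sets lebesgue" using S by simp
  from has_measure_differentiable_image[OF this der inj, of "measure lebesgue (h ` S)"] im
  have "((\<lambda>x. \<bar>det (matrix (h' x))\<bar>) has_integral measure lebesgue (h ` S)) S" by simp
  from nn_integral_has_integral_lebesgue'[OF _ this]
  show ?thesis using fmeasurableD2[OF im] by (simp add: emeasure_eq_ennreal_measure)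
qed

section \<open>Energy of rings under quasiconformal maps\<close>

text \<open>\<open>h\<close> is conjugated to a map \<open>H\<close> over the relabelled index type.
  The relabelling preserves Lebesgue measure by \<open>lborel_distr_reindex\<close> and Jacobians by
  \<open>det_reindex\<close>, so both sides of the formula carry over.\<close>

lemma nn_integral_det_eq:
  fixes h :: "real^'n \<Rightarrow> real^'n"
  assumes S[measurable]: "S \<in> sets borel"
    and der: "\<And>x. x \<in> S \<Longrightarrow> (h has_derivative h' x) (at x within S)" and inj: "inj_on h S"
    and im: "h ` S \<in> sets borel" and fin: "emeasure lborel (h ` S) < \<infinity>"
    and meas: "(\<lambda>x. ennreal \<bar>det (matrix (h' x))\<bar> * indicator S x) \<in> borel_measurable borel"
  shows "(\<integral>\<^sup>+x. ennreal \<bar>det (matrix (h' x))\<bar> * indicator S x \<partial>lborel) = emeasure lborel (h ` S)"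
proof -
  define T where "T = (\<lambda>x :: real^'n. (\<chi> i. x $ Rep_wo_copy i) :: real^('n wo_copy))"
  define T' where "T' = (\<lambda>y :: real^('n wo_copy). (\<chi> j. y $ Abs_wo_copy j) :: real^'n)"
  have TT': "T (T' y) = y" for y by (simp add: T_def T'_def vec_eq_iff Rep_wo_copy_inverse)
  have T'T: "T' (T x) = x" for x by (simp add: T_def T'_def vec_eq_iff Abs_wo_copy_inverse)
  have lin: "linear T" "linear T'" by (auto simp: T_def T'_def vec_eq_iff intro!: linearI)
  have Tm[measurable]: "T \<in> borel_measurable borel" "T' \<in> borel_measurable borel"
    unfolding T_def T'_def by (intro borel_measurable_continuous_onI continuous_intros)+
  have bA: "bij (Abs_wo_copy :: 'n \<Rightarrow> _)"
    by (metis Abs_wo_copy_inverse Rep_wo_copy_inverse UNIV_I bij_iff)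
  have dT': "distr lborel borel T' = lborel"
    using lborel_distr_reindex[OF bA] by (simp add: T'_def)
  have im_T: "T ` B = T' -` B" for B
    using TT' T'T by (auto simp: image_iff) metis
  have bij_T': "inj T'" using TT' by (metis injI)
  define H where "H = (\<lambda>y. T (h (T' y)))"
  define H' where "H' = (\<lambda>y v. T (h' (T' y) (T' v)))"
  have im_H: "H ` (T ` S) = T ` (h ` S)"
    by (simp add: H_def image_image T'T)
  have eT: "emeasure lborel (T ` B) = emeasure lborel B" if "B \<in> sets borel" for B
  proof -
    have "emeasure lborel B = emeasure (distr lborel borel T') B" by (simp add: dT')
    also have "\<dots> = emeasure lborel (T' -` B)" using that by (subst emeasure_distr) auto
    finally show ?thesis by (simp add: im_T)
  qed
  have TSb: "T ` B \<in> sets borel" if "B \<in> sets borel" for B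
    unfolding im_T using measurable_sets[OF Tm(2) that] by simp
  have "(\<integral>\<^sup>+y. ennreal \<bar>det (matrix (H' y))\<bar> * indicator (T ` S) y \<partial>lborel) = emeasure lebesgue (H ` (T ` S))"
  proof (rule nn_integral_det_le_wo)
    show "T ` S \<in> sets borel" using S by (rule TSb)
    show "inj_on H (T ` S)"
      using inj by (auto simp: inj_on_def H_def T'T) (metis T'T)
    have "H ` (T ` S) \<in> sets borel" unfolding im_H using im by (rule TSb)
    moreover have "emeasure lborel (H ` (T ` S)) < \<infinity>" unfolding im_H using fin im by (simp add: eT)
    ultimately show "H ` (T ` S) \<in> lmeasurable" by (intro fmeasurableI) auto
    fix y assume "y \<in> T ` S"
    then have yS: "T' y \<in> S" by (auto simp: T'T)
    have d1: "(T' has_derivative T') (at y within T ` S)"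
      by (rule linear_imp_has_derivative[OF lin(2)])
    have "T' ` (T ` S) = S" by (auto simp: image_image T'T)
    then have d2: "(h has_derivative h' (T' y)) (at (T' y) within T' ` (T ` S))"
      using der[OF yS] by simp
    have d3: "(T has_derivative T) (at (h (T' y)) within (\<lambda>y. h (T' y)) ` (T ` S))"
      by (rule linear_imp_has_derivative[OF lin(1)])
    show "(H has_derivative H' y) (at y within T ` S)"
      unfolding H_def H'_def
      using has_derivative_in_compose[OF has_derivative_in_compose[OF d1 d2] d3] .
  qed
  also have "emeasure lebesgue (H ` (T ` S)) = emeasure lborel (h ` S)"
    unfolding im_H using im TSb[OF im] by (simp add: eT)
  also have "(\<integral>\<^sup>+y. ennreal \<bar>det (matrix (H' y))\<bar> * indicator (T ` S) y \<partial>lborel)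
      = (\<integral>\<^sup>+y. ennreal \<bar>det (matrix (h' (T' y)))\<bar> * indicator S (T' y) \<partial>lborel)"
  proof (rule nn_integral_cong)
    fix y
    \<comment> \<open>\<open>T'\<close> permutes the standard basis, so the matrix of
      \<open>H' y\<close> is that of \<open>h' (T' y)\<close> with rows and columns relabelled
      alike.\<close>
    have "T' (axis j 1) = axis (Rep_wo_copy j) 1" for j
      by (auto simp: T'_def vec_eq_iff axis_def Abs_wo_copy_inject Rep_wo_copy_inverse Abs_wo_copy_inverse)
    then have "matrix (H' y) = (\<chi> i j. matrix (h' (T' y)) $ Rep_wo_copy i $ Rep_wo_copy j)"
      by (simp add: matrix_def H'_def T_def)
    then have "det (matrix (H' y)) = det (matrix (h' (T' y)))"
      using det_reindex[OF bij_Rep_wo_copy] by simp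
    moreover have "indicator (T ` S) y = (indicator S (T' y) :: ennreal)"
      by (simp add: im_T indicator_def)
    ultimately show "ennreal \<bar>det (matrix (H' y))\<bar> * indicator (T ` S) y =
        ennreal \<bar>det (matrix (h' (T' y)))\<bar> * indicator S (T' y)" by simp
  qed
  also have "\<dots> = (\<integral>\<^sup>+x. ennreal \<bar>det (matrix (h' x))\<bar> * indicator S x \<partial>distr lborel borel T')"
    using meas by (subst nn_integral_distr) auto
  finally show ?thesis by (simp add: dT')
qed

section \<open>Energy of the logarithmic density, layer by layer\<close>

lemma onorm_matrix_continuous:
  fixes A :: "'a::topological_space \<Rightarrow> real^'n^'m"
  assumes "continuous_on S A"
  shows "continuous_on S (\<lambda>x. onorm ((*v) (A x)))"
proof -
  have le: "onorm ((*v) M) - onorm ((*v) M') \<le> (\<Sum>i\<in>UNIV. \<Sum>j\<in>UNIV. \<bar>M $ i $ j - M' $ i $ j\<bar>)"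
    for M M' :: "real^'n^'m"
  proof -
    have "onorm ((*v) M) = onorm (\<lambda>x. M' *v x + (M - M') *v x)"
      by (simp add: matrix_vector_mult_add_rdistrib[symmetric])
    also have "\<dots> \<le> onorm ((*v) M') + onorm ((*v) (M - M'))"
      by (intro onorm_triangle matrix_vector_mul_bounded_linear)
    also have "onorm ((*v) (M - M')) \<le> (\<Sum>i\<in>UNIV. \<Sum>j\<in>UNIV. \<bar>(M - M') $ i $ j\<bar>)"
      by (rule onorm_le_matrix_component_sum)
    finally show ?thesis by simp
  qed
  have "continuous_on UNIV (\<lambda>M :: real^'n^'m. onorm ((*v) M))"
    unfolding continuous_on_def
  proof
    fix M0 :: "real^'n^'m"
    let ?D = "\<lambda>M. \<Sum>i\<in>UNIV. \<Sum>j\<in>UNIV. \<bar>M $ i $ j - M0 $ i $ j\<bar>"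
    have "(?D \<longlongrightarrow> (\<Sum>i\<in>UNIV. \<Sum>j\<in>UNIV. \<bar>M0 $ i $ j - M0 $ i $ j\<bar>)) (at M0)"
      by (intro tendsto_intros)
    then have D0: "(?D \<longlongrightarrow> 0) (at M0)" by simp
    have "((\<lambda>M. onorm ((*v) M) - onorm ((*v) M0)) \<longlongrightarrow> 0) (at M0)"
    proof (rule Lim_null_comparison[OF _ D0], rule always_eventually, rule allI)
      fix M
      have "(\<Sum>i\<in>UNIV. \<Sum>j\<in>UNIV. \<bar>M0 $ i $ j - M $ i $ j\<bar>) = ?D M"
        by (intro sum.cong refl) (simp add: abs_minus_commute)
      then show "norm (onorm ((*v) M) - onorm ((*v) M0)) \<le> ?D M"
        using le[of M M0] le[of M0 M] by simp
    qed
    then show "((\<lambda>M. onorm ((*v) M)) \<longlongrightarrow> onorm ((*v) M0)) (at M0 within UNIV)"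
      by (simp add: LIM_zero_iff)
  qed
  from continuous_on_compose2[OF this assms] show ?thesis by simp
qed

lemma dyadic_layer:
  fixes r s :: real
  assumes "s \<le> r" "r < 2 ^ N * s"
  obtains k where "k < N" "2 ^ k * s \<le> r" "r < 2 ^ Suc k * s"
proof -
  have "\<exists>k<N. 2 ^ k * s \<le> r \<and> r < 2 ^ Suc k * s"
    using assms(2)
  proof (induction N)
    case (Suc N)
    then show ?case
      by (cases "r < 2 ^ N * s") (auto simp: less_Suc_eq not_less)
  qed (use assms(1) in simp)
  then show thesis using that by blast
qed

text \<open>The n-th power of an upper bound for the gradient of
  \<open>log_ramp s N (norm (h x - u))\<close>, which is defined below: the logarithm has slope 1/r
  at r = |h x - u|, is normalized by N ln 2, and the derivative of \<open>h\<close> stretches by at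
  most its operator norm.\<close>

definition ring_density ::
    "(real^'n) set \<Rightarrow> (real^'n \<Rightarrow> real^'n) \<Rightarrow> (real^'n \<Rightarrow> real^'n^'n) \<Rightarrow> real^'n \<Rightarrow> real \<Rightarrow> nat \<Rightarrow>
      real^'n \<Rightarrow> ennreal"
  where "ring_density G h A u s N x =
    ennreal ((onorm ((*v) (A x)) / (norm (h x - u) * (real N * ln 2))) ^ CARD('n))
      * indicator {x \<in> G. s < norm (h x - u) \<and> norm (h x - u) < 2 ^ N * s} x"

text \<open>The dilatation inequality is required at every point;
  \<open>quasiconformal_imp_qc_map\<close> obtains this from the condition almost
  everywhere.\<close>

locale qc_map =
  fixes G :: "(real^'n) set" and h :: "real^'n \<Rightarrow> real^'n" and A :: "real^'n \<Rightarrow> real^'n^'n" and K :: real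
  assumes open_G: "open G" and inj_h: "inj_on h G"
    and der_h: "\<And>x. x \<in> G \<Longrightarrow> (h has_derivative (*v) (A x)) (at x)"
    and cont_A: "continuous_on G A" and K_nonneg: "0 \<le> K"
    and dilatation: "\<And>x. x \<in> G \<Longrightarrow> onorm ((*v) (A x)) ^ CARD('n) \<le> K * det (A x)"
begin

abbreviation "stretch x \<equiv> onorm ((*v) (A x))"

lemma cont_h: "continuous_on G h"
  using der_h by (meson continuous_at_imp_continuous_on has_derivative_continuous)

lemma open_image: "open (h ` G)"
  using invariance_of_domain[OF cont_h open_G inj_h] .

lemma open_ring: "open {x \<in> G. s < norm (h x - u) \<and> norm (h x - u) < t}"
proof -
  have "open (G \<inter> (\<lambda>x. norm (h x - u)) -` {s<..<t})"
    by (rule continuous_open_preimage) (intro continuous_intros cont_h open_G open_greaterThanLessThan)+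
  also have "G \<inter> (\<lambda>x. norm (h x - u)) -` {s<..<t} = {x \<in> G. s < norm (h x - u) \<and> norm (h x - u) < t}"
    by auto
  finally show ?thesis .
qed

lemma cont_ring_density:
  assumes "0 \<le> s" "N > 0"
  shows "continuous_on {x \<in> G. s < norm (h x - u) \<and> norm (h x - u) < t}
    (\<lambda>x. stretch x / (norm (h x - u) * (real N * ln 2)))"
  using assms
  by (intro continuous_intros onorm_matrix_continuous continuous_on_subset[OF cont_A]
      continuous_on_subset[OF cont_h]) auto

lemma borel_ring_density:
  assumes "0 \<le> s" "N > 0"
  shows "ring_density G h A u s N \<in> borel_measurable borel"
proof -
  let ?R = "{x \<in> G. s < norm (h x - u) \<and> norm (h x - u) < 2 ^ N * s}"
  let ?f = "\<lambda>x. (stretch x / (norm (h x - u) * (real N * ln 2))) ^ CARD('n)"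
  have "continuous_on ?R ?f"
    by (intro continuous_on_power cont_ring_density assms)
  then have "(\<lambda>x. indicator ?R x *\<^sub>R ?f x) \<in> borel_measurable borel"
    by (intro borel_measurable_continuous_on_indicator borel_open open_ring)
  then have "(\<lambda>x. ennreal (indicator ?R x *\<^sub>R ?f x)) \<in> borel_measurable borel" by simp
  also have "(\<lambda>x. ennreal (indicator ?R x *\<^sub>R ?f x)) = ring_density G h A u s N"
    by (rule ext) (simp add: ring_density_def indicator_def)
  finally show ?thesis .
qed

text \<open>\<open>h\<close> is injective, so the Jacobian integrates over the layer to the volume
  of its image, which lies in \<open>ball u t\<close>.\<close>

lemma layer_energy:
  fixes u :: "real^'n" and s t :: real
  assumes "0 < t"
  defines "S \<equiv> {x \<in> G. s \<le> norm (h x - u) \<and> norm (h x - u) < t}"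
  shows "(\<integral>\<^sup>+x. ennreal \<bar>det (A x)\<bar> * indicator S x \<partial>lborel)
      \<le> ennreal (t ^ CARD('n) * measure lborel (ball (0::real^'n) 1))"
    and "(\<lambda>x. ennreal \<bar>det (A x)\<bar> * indicator S x) \<in> borel_measurable borel"
proof -
  have S_eq: "S = (G \<inter> (\<lambda>x. norm (h x - u)) -` {..<t}) - (G \<inter> (\<lambda>x. norm (h x - u)) -` {..<s})"
    unfolding S_def by auto
  have op: "open (G \<inter> (\<lambda>x. norm (h x - u)) -` {..<r})" for r
    by (rule continuous_open_preimage) (intro continuous_intros cont_h open_G open_lessThan)+
  have S[measurable]: "S \<in> sets borel" unfolding S_eq by (intro sets.Diff borel_open op)
  have SG: "S \<subseteq> G" by (auto simp: S_def)
  have "(\<lambda>x. indicator G x *\<^sub>R det (A x)) \<in> borel_measurable borel"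
    using cont_A open_G unfolding det_def
    by (intro borel_measurable_continuous_on_indicator continuous_intros) auto
  then have "(\<lambda>x. ennreal \<bar>indicator G x *\<^sub>R det (A x)\<bar> * indicator S x) \<in> borel_measurable borel" by measurable
  also have "(\<lambda>x. ennreal \<bar>indicator G x *\<^sub>R det (A x)\<bar> * indicator S x) = (\<lambda>x. ennreal \<bar>det (A x)\<bar> * indicator S x)"
    using SG by (auto simp: indicator_def fun_eq_iff)
  finally show meas: "(\<lambda>x. ennreal \<bar>det (A x)\<bar> * indicator S x) \<in> borel_measurable borel" .
  have im: "h ` S = h ` G \<inter> {y. s \<le> norm (y - u) \<and> norm (y - u) < t}" unfolding S_def by auto
  have "{y. s \<le> norm (y - u) \<and> norm (y - u) < t} = ball u t - ball u s"
    by (auto simp: dist_norm norm_minus_commute)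
  then have imb: "h ` S \<in> sets borel" unfolding im using open_image by (metis borel_open open_ball sets.Diff sets.Int)
  have sub: "h ` S \<subseteq> ball u t" unfolding im by (auto simp: dist_norm norm_minus_commute)
  have le: "emeasure lborel (h ` S) \<le> emeasure lborel (ball u t)"
    by (rule emeasure_mono[OF sub]) simp
  have eb: "emeasure lborel (ball u t) = ennreal (t ^ CARD('n) * measure lborel (ball (0::real^'n) 1))"
    using content_ball_conv_unit_ball[of t u] \<open>0 < t\<close> emeasure_bounded_finite[of "ball u t"]
      emeasure_eq_ennreal_measure[of lborel "ball u t"] by (simp add: less_top)
  have "(\<integral>\<^sup>+x. ennreal \<bar>det (matrix ((*v) (A x)))\<bar> * indicator S x \<partial>lborel) = emeasure lborel (h ` S)"
  proof (rule nn_integral_det_eq[OF S _ _ imb])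
    show "(h has_derivative (*v) (A x)) (at x within S)" if "x \<in> S" for x
      using der_h SG that has_derivative_at_withinI by blast
    show "inj_on h S" using inj_h SG by (rule inj_on_subset)
    show "emeasure lborel (h ` S) < \<infinity>" using le eb by (simp add: le_less_trans)
  qed (use meas in simp)
  then show "(\<integral>\<^sup>+x. ennreal \<bar>det (A x)\<bar> * indicator S x \<partial>lborel)
      \<le> ennreal (t ^ CARD('n) * measure lborel (ball (0::real^'n) 1))"
    using le eb by simp
qed

text \<open>On the k-th dyadic layer |h x - u| is at least 2^k s, while the image lies in a ball of
  radius 2^(k+1) s. Since the exponent is the dimension, the scale 2^k s cancels, and all N layers
  have the same bound.\<close>

proposition ring_energy:
  assumes s: "0 < s" and N: "0 < N"
  shows "(\<integral>\<^sup>+x. ring_density G h A u s N x \<partial>lborel) \<le>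
    ennreal (real N * (K * measure lborel (ball (0::real^'n) 1) * 2 ^ CARD('n) / (real N * ln 2) ^ CARD('n)))"
proof -
  let ?n = "CARD('n)" and ?L = "real N * ln 2" and ?\<omega> = "measure lborel (ball (0::real^'n) 1)"
  define S where "S k = {x \<in> G. 2 ^ k * s \<le> norm (h x - u) \<and> norm (h x - u) < 2 ^ Suc k * s}" for k :: nat
  let ?J = "\<lambda>k x. ennreal \<bar>det (A x)\<bar> * indicator (S k) x"
  let ?c = "\<lambda>k. ennreal (K / (2 ^ k * s * ?L) ^ ?n)"
  have L: "?L > 0" using N by simp
  have c0: "0 \<le> K / (2 ^ k * s * ?L) ^ ?n" for k :: nat
    using K_nonneg s L by simp
  have pt: "ring_density G h A u s N x \<le>
      (\<Sum>k<N. ?c k * ?J k x)" for x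
  proof (cases "x \<in> G \<and> s < norm (h x - u) \<and> norm (h x - u) < 2 ^ N * s")
    case True
    obtain k where k: "k < N" "2 ^ k * s \<le> norm (h x - u)" "norm (h x - u) < 2 ^ Suc k * s"
      using dyadic_layer[of s "norm (h x - u)" N] True by auto
    have pos: "0 < 2 ^ k * s * ?L" using s L by simp
    have on: "0 \<le> stretch x" by (intro onorm_pos_le matrix_vector_mul_bounded_linear)
    have d0: "0 \<le> K * det (A x)" using dilatation[of x] True on by (meson order_trans zero_le_power)
    have "(stretch x / (norm (h x - u) * ?L)) ^ ?n \<le> (stretch x / (2 ^ k * s * ?L)) ^ ?n"
    proof (intro power_mono divide_left_mono mult_right_mono)
      have "0 < 2 ^ k * s" using s by simp
      with k(2) have "0 < norm (h x - u)" by linarith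
      then show "0 < norm (h x - u) * ?L * (2 ^ k * s * ?L)"
        by (rule mult_pos_pos[OF mult_pos_pos[OF _ L] pos])
      show "0 \<le> stretch x / (norm (h x - u) * ?L)" using on L by simp
    qed (use on k L in auto)
    also have "\<dots> = stretch x ^ ?n / (2 ^ k * s * ?L) ^ ?n" by (simp add: power_divide)
    also have "\<dots> \<le> K * \<bar>det (A x)\<bar> / (2 ^ k * s * ?L) ^ ?n"
    proof (rule divide_right_mono)
      have "K * det (A x) \<le> K * \<bar>det (A x)\<bar>" using K_nonneg by (intro mult_left_mono) auto
      with dilatation[of x] True show "stretch x ^ ?n \<le> K * \<bar>det (A x)\<bar>" by auto
    qed (use pos in simp)
    finally have "ennreal ((stretch x / (norm (h x - u) * ?L)) ^ ?n)
        \<le> ennreal (K / (2 ^ k * s * ?L) ^ ?n * \<bar>det (A x)\<bar>)"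
      by (intro ennreal_leI) simp
    also have "\<dots> = ?c k * ?J k x"
      unfolding ennreal_mult[OF c0 abs_ge_zero] using k True by (simp add: S_def)
    also have "\<dots> \<le> (\<Sum>k<N. ?c k * ?J k x)"
      using k by (intro member_le_sum) auto
    finally show ?thesis using True by (simp add: ring_density_def)
  qed (auto simp: ring_density_def indicator_def)
  have "(\<integral>\<^sup>+x. ring_density G h A u s N x \<partial>lborel) \<le>
    (\<integral>\<^sup>+x. (\<Sum>k<N. ?c k * ?J k x) \<partial>lborel)"
    by (intro nn_integral_mono pt)
  also have "\<dots> = (\<Sum>k<N. ?c k *
      nn_integral lborel (?J k))"
  proof -
    have "(?J k) \<in> borel_measurable lborel" for k
      using layer_energy(2)[of "2 ^ Suc k * s" "2 ^ k * s" u] s by (simp add: S_def)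
    then show ?thesis by (subst nn_integral_sum) (auto simp: nn_integral_cmult intro!: borel_measurable_times_ennreal)
  qed
  also have "\<dots> \<le> (\<Sum>k<N. ennreal (K * ?\<omega> * 2 ^ ?n / ?L ^ ?n))"
  proof (rule sum_mono)
    fix k
    have "?c k * nn_integral lborel (?J k)
        \<le> ?c k * ennreal ((2 ^ Suc k * s) ^ ?n * ?\<omega>)"
      unfolding S_def using s by (intro mult_left_mono layer_energy(1)) auto
    also have "\<dots> = ennreal (K / (2 ^ k * s * ?L) ^ ?n * ((2 ^ Suc k * s) ^ ?n * ?\<omega>))"
      by (rule ennreal_mult[symmetric]) (use c0 s in auto)
    also have "K / (2 ^ k * s * ?L) ^ ?n * ((2 ^ Suc k * s) ^ ?n * ?\<omega>) = K * ?\<omega> * 2 ^ ?n / ?L ^ ?n"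
      using s L by (simp add: power_mult_distrib field_simps)
    finally show "?c k *
        nn_integral lborel (?J k) \<le> ennreal (K * ?\<omega> * 2 ^ ?n / ?L ^ ?n)" .
  qed
  also have "\<dots> = ennreal (real N * (K * ?\<omega> * 2 ^ ?n / ?L ^ ?n))"
  proof -
    have "(\<Sum>k<N. ennreal X) = ennreal (real N * X)" if "0 \<le> X" for X
      using that by (simp add: ennreal_mult ennreal_of_nat_eq_real_of_nat)
    then show ?thesis using K_nonneg L by simp
  qed
  finally show ?thesis .
qed

end

section \<open>Distortion estimates\<close>

text \<open>The inner maximum keeps the argument of the logarithm at least 1, also for
  \<open>r = 0\<close>, so that the ramp starts at 0.\<close>

definition log_ramp :: "real \<Rightarrow> nat \<Rightarrow> real \<Rightarrow> real"
  where "log_ramp s N r = min 1 (ln (max r s / s) / (real N * ln 2))"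

lemma log_ramp:
  assumes s: "0 < s" and N: "0 < N"
  shows "0 \<le> log_ramp s N r" "log_ramp s N r \<le> 1" "r \<le> s \<Longrightarrow> log_ramp s N r = 0"
    "2 ^ N * s \<le> r \<Longrightarrow> log_ramp s N r = 1"
    "s < r \<Longrightarrow> r < 2 ^ N * s \<Longrightarrow> log_ramp s N r = ln (r / s) / (real N * ln 2)"
    "continuous_on S (log_ramp s N)"
proof -
  have L: "0 < real N * ln 2" using N by simp
  have pos: "1 \<le> max r s / s" using s by simp
  show "0 \<le> log_ramp s N r" using L pos by (simp add: log_ramp_def)
  show "log_ramp s N r \<le> 1" by (simp add: log_ramp_def)
  show "log_ramp s N r = 0" if "r \<le> s" using that s by (simp add: log_ramp_def max_def)
  show "log_ramp s N r = 1" if r: "2 ^ N * s \<le> r"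
  proof -
    have "1 \<le> (2::real) ^ N" by simp
    then have "s \<le> 2 ^ N * s" using s by simp
    then have m: "max r s = r" using r by simp
    have "2 ^ N \<le> r / s" using r s by (simp add: field_simps)
    then have "ln (2 ^ N) \<le> ln (r / s)" by (subst ln_le_cancel_iff) (auto intro: less_le_trans[rotated])
    then have "real N * ln 2 \<le> ln (r / s)" by (simp add: ln_realpow)
    then show ?thesis using L m by (simp add: log_ramp_def)
  qed
  show "log_ramp s N r = ln (r / s) / (real N * ln 2)" if r: "s < r" "r < 2 ^ N * s"
  proof -
    have "r / s \<le> 2 ^ N" using r s by (simp add: field_simps)
    then have "ln (r / s) \<le> ln (2 ^ N)" using r s by (subst ln_le_cancel_iff) auto
    then have "ln (r / s) \<le> real N * ln 2" by (simp add: ln_realpow)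
    then show ?thesis using L r by (simp add: log_ramp_def max_def)
  qed
  show "continuous_on S (log_ramp s N)"
    unfolding log_ramp_def using s N by (intro continuous_intros) (auto simp: max_def)
qed

context qc_map
begin

lemma ring_energy_bound:
  assumes s: "0 < s" and N: "0 < N" and W: "convex W" "open W" and c: "continuous_on W f"
    and f: "\<And>z. z \<in> W \<Longrightarrow> z \<in> G \<Longrightarrow> f z = log_ramp s N (norm (h z - u))"
      "\<And>z. z \<in> W \<Longrightarrow> z \<notin> G \<Longrightarrow> f z = 1"
  shows "energy_bound W f (ring_density G h A u s N)"
proof -
  let ?L = "real N * ln 2"
  let ?R = "{x \<in> G. s < norm (h x - u) \<and> norm (h x - u) < 2 ^ N * s}"
  have L: "?L > 0" using N by simp
  define U where "U = {z \<in> W. 0 < f z \<and> f z < 1}"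
  have UR: "U \<subseteq> ?R"
  proof
    fix z assume z: "z \<in> U"
    then have zG: "z \<in> G" using f(2) by (force simp: U_def)
    then have "0 < log_ramp s N (norm (h z - u))" "log_ramp s N (norm (h z - u)) < 1"
      using z f(1) by (auto simp: U_def)
    then show "z \<in> ?R" using zG log_ramp(3,4)[OF s N] by (metis (mono_tags, lifting) less_irrefl mem_Collect_eq not_le)
  qed
  let ?D = "\<lambda>z v. (inner (sgn (h z - u)) (A z *v v)) / (norm (h z - u) * ?L)"
  let ?\<rho> = "\<lambda>x. stretch x / (norm (h x - u) * ?L)"
  show ?thesis
  proof (rule energy_boundI[where U = U and w = ?\<rho> and f' = ?D])
    show "0 \<le> f z" "f z \<le> 1" if "z \<in> W" for z
      using f(1)[OF that] f(2)[OF that] log_ramp(1,2)[OF s N] by (cases "z \<in> G"; simp)+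
    show "U = {z \<in> W. 0 < f z \<and> f z < 1}" by (simp add: U_def)
    show "(f has_derivative ?D z) (at z within W)" if z: "z \<in> U" for z
    proof -
      have zR: "z \<in> ?R" "z \<in> W" using UR z by (auto simp: U_def)
      then have "s < norm (h z - u)" by blast
      with s have pos: "norm (h z - u) > 0" by linarith
      then have ne: "h z - u \<noteq> 0" by auto
      have "((\<lambda>x. norm (h x - u)) has_derivative (\<lambda>v. inner (sgn (h z - u)) (A z *v v))) (at z)"
      proof -
        have "((\<lambda>x. h x - u) has_derivative (*v) (A z)) (at z)"
          using has_derivative_diff[OF der_h[of z] has_derivative_const[of u]] zR by simp
        from has_derivative_compose[OF this has_derivative_norm[OF ne]] show ?thesis
          by (simp add: inner_commute)
      qed
      then have "((\<lambda>x. ln (norm (h x - u) / s) / ?L) has_derivative ?D z) (at z)"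
        using pos s L by (auto intro!: derivative_eq_intros simp: field_simps)
      then have "(f has_derivative ?D z) (at z)"
      proof (rule has_derivative_transform_within_open)
        show "open (W \<inter> ?R)" using W(2) open_ring by (rule open_Int)
        show "z \<in> W \<inter> ?R" using zR by blast
        show "ln (norm (h x - u) / s) / ?L = f x" if "x \<in> W \<inter> ?R" for x
          using that f(1)[of x] log_ramp(5)[OF s N] by auto
      qed
      then show ?thesis by (rule has_derivative_at_withinI)
    qed
    show "\<bar>?D z v\<bar> \<le> ?\<rho> z * norm v" if z: "z \<in> U" for z v
    proof -
      have "norm (h z - u) > 0" using UR z s by force
      then have p: "norm (h z - u) * ?L > 0" using L by simp
      have "\<bar>inner (sgn (h z - u)) (A z *v v)\<bar> \<le> norm (sgn (h z - u)) * norm (A z *v v)"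
        by (rule Cauchy_Schwarz_ineq2)
      also have "\<dots> \<le> 1 * norm (A z *v v)" by (intro mult_right_mono) (auto simp: norm_sgn)
      also have "norm (A z *v v) \<le> stretch z * norm v"
        by (intro onorm matrix_vector_mul_bounded_linear)
      finally have "\<bar>inner (sgn (h z - u)) (A z *v v)\<bar> / (norm (h z - u) * ?L)
          \<le> stretch z * norm v / (norm (h z - u) * ?L)"
        using p by (intro divide_right_mono) auto
      then show ?thesis using L by (simp add: abs_mult)
    qed
    show "continuous_on U ?\<rho>"
      by (rule continuous_on_subset[OF cont_ring_density UR]) (use s N in auto)
    show "0 \<le> ?\<rho> z" for z using L
      by (intro divide_nonneg_nonneg mult_nonneg_nonneg onorm_pos_le matrix_vector_mul_bounded_linear) auto
    show "ennreal (?\<rho> z ^ DIM(real^'n)) \<le> ring_density G h A u s N z" if "z \<in> U" for z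
      using UR that by (auto simp: ring_density_def)
    show "ring_density G h A u s N \<in> borel_measurable borel"
      using borel_ring_density s N by simp
  qed (use W c in auto)
qed

text \<open>For such N the upper bound of \<open>ring_energy\<close> lies below the lower bound of
  \<open>loewner_estimate\<close>.\<close>

definition admissible :: "nat \<Rightarrow> bool"
  where "admissible N \<longleftrightarrow> 0 < N \<and>
    real N * (K * measure lborel (ball (0::real^'n) 1) * 2 ^ CARD('n) / (real N * ln 2) ^ CARD('n))
      < loewner_const CARD('n) (measure lborel (ball (0::real^'n) 1))"

text \<open>The bound is a constant times N / N^n, which for n >= 2 is at most a constant over
  N.\<close>

lemma admissible_exists:
  assumes "CARD('n) \<ge> 2"
  obtains N where "admissible N"
proof -
  let ?n = "CARD('n)" and ?\<omega> = "measure lborel (ball (0::real^'n) 1)"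
  define c where "c = K * ?\<omega> * 2 ^ ?n / ln 2 ^ ?n"
  have c: "c \<ge> 0" using K_nonneg by (simp add: c_def)
  have \<eta>: "loewner_const ?n ?\<omega> > 0"
  proof -
    have "root ?n (1/2) < 1" by (simp add: real_root_lt_1_iff)
    moreover have "0 < 8 * (1 + 16 ^ ?n / ?\<omega>)" by (simp add: add_pos_nonneg)
    ultimately show ?thesis by (simp add: loewner_const_def)
  qed
  obtain N :: nat where N: "c / loewner_const ?n ?\<omega> < real N" using reals_Archimedean2 by blast
  have N0: "0 < real N" using N c \<eta> by (meson divide_nonneg_pos le_less_trans)
  have "real N * (K * ?\<omega> * 2 ^ ?n / (real N * ln 2) ^ ?n) = c * (real N / real N ^ ?n)"
    by (simp add: c_def power_mult_distrib mult_ac)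
  also have "\<dots> \<le> c * (1 / real N)"
  proof (intro mult_left_mono c)
    have "real N ^ 2 \<le> real N ^ ?n" using N0 assms by (intro power_increasing) auto
    then have "real N / real N ^ ?n \<le> real N / real N ^ 2"
      using N0 by (intro divide_left_mono) auto
    then show "real N / real N ^ ?n \<le> 1 / real N" using N0 by (simp add: power2_eq_square)
  qed
  also have "\<dots> < loewner_const ?n ?\<omega>" using N N0 \<eta> by (simp add: field_simps)
  finally have "admissible N" using N0 by (simp add: admissible_def)
  then show thesis by (rule that)
qed

text \<open>This is the common contradiction behind both distortion estimates: the inner and the
  outer side of a thick ring cannot both meet many spheres around \<open>x\<close> of comparable
  radii.\<close>

lemma no_ring:
  assumes N: "admissible N" and s: "0 < s" and r: "0 < r" and c: "continuous_on (ball x (4 * r)) f"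
    and f: "\<And>z. z \<in> ball x (4 * r) \<Longrightarrow> z \<in> G \<Longrightarrow> f z = log_ramp s N (norm (h z - u))"
      "\<And>z. z \<in> ball x (4 * r) \<Longrightarrow> z \<notin> G \<Longrightarrow> f z = 1"
    and E: "0 \<le> \<alpha>" "\<alpha> + r/4 \<le> 2 * r" "\<And>t. t \<in> {\<alpha>..\<alpha> + r/4} \<Longrightarrow> \<exists>q. dist x q = t \<and> f q = 0"
    and F: "0 \<le> \<beta>" "\<beta> + r/4 \<le> 2 * r" "\<And>t. t \<in> {\<beta>..\<beta> + r/4} \<Longrightarrow> \<exists>q. dist x q = t \<and> f q = 1"
  shows False
proof -
  let ?\<omega> = "measure lborel (ball (0::real^'n) 1)" and ?P = "ring_density G h A u s N"
  have N0: "0 < N" using N by (simp add: admissible_def)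
  have "ennreal (loewner_const DIM(real^'n) ?\<omega>) \<le> energy ?P (ball x (4 * r))"
  proof (rule loewner_estimate[OF c _ _ _ _ r E F])
    show "0 \<le> f z" "f z \<le> 1" if "z \<in> ball x (4 * r)" for z
      using f[OF that] log_ramp(1,2)[OF s N0] by (cases "z \<in> G"; simp)+
    show "?P \<in> borel_measurable borel" using borel_ring_density s N0 by simp
    show "energy_bound (ball x (4 * r)) f ?P"
      by (rule ring_energy_bound[OF s N0 _ _ c f]) auto
  qed
  also have "\<dots> \<le> (\<integral>\<^sup>+z. ?P z \<partial>lborel)" by (intro nn_integral_mono) (auto simp: indicator_def)
  also have "\<dots> \<le> ennreal (real N * (K * ?\<omega> * 2 ^ CARD('n) / (real N * ln 2) ^ CARD('n)))"
    by (rule ring_energy[OF s N0])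
  finally have "loewner_const CARD('n) ?\<omega> \<le> real N * (K * ?\<omega> * 2 ^ CARD('n) / (real N * ln 2) ^ CARD('n))"
    using K_nonneg by (subst (asm) ennreal_le_iff) auto
  then show False using N by (simp add: admissible_def)
qed

text \<open>Following a ray in the image from \<open>h y\<close> until it leaves the image of
  \<open>ball x t\<close> produces a point of the sphere of radius \<open>t\<close>. The last
  property stops the ray no later than any of its points outside h(G).\<close>

lemma ray_exit:
  assumes t: "0 < t" "cball x t \<subseteq> G" and y: "dist x y \<le> t" and w: "w \<noteq> 0"
  obtains i q where "0 \<le> i" "dist x q = t" "h q = h y + i *\<^sub>R w"
    "\<And>j. 0 \<le> j \<Longrightarrow> h y + j *\<^sub>R w \<notin> h ` G \<Longrightarrow> i \<le> j"
proof -
  let ?c = "\<lambda>i. h y + i *\<^sub>R w"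
  have bG: "ball x t \<subseteq> G" using t(2) ball_subset_cball by blast
  have op: "open (h ` ball x t)"
    using invariance_of_domain[OF continuous_on_subset[OF cont_h bG] open_ball inj_on_subset[OF inj_h bG]] .
  have com: "compact (h ` cball x t)"
    by (intro compact_continuous_image continuous_on_subset[OF cont_h t(2)] compact_cball)
  \<comment> \<open>The exit parameter is the least element of this closed set; it is nonempty
    because the image of \<open>cball x t\<close> is bounded.\<close>
  define Z where "Z = {0..} \<inter> ?c -` (- (h ` ball x t))"
  have clZ: "closed Z"
    unfolding Z_def by (intro continuous_closed_preimage continuous_intros closed_atLeast) (use op in auto)
  obtain B where B: "\<And>z. z \<in> h ` cball x t \<Longrightarrow> norm z \<le> B" "0 < B"
    using compact_imp_bounded[OF com] by (metis bounded_pos)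
  have "Z \<noteq> {}"
  proof -
    define i where "i = (norm (h y) + B + 1) / norm w"
    have i: "0 \<le> i" using B by (simp add: i_def)
    have "norm (i *\<^sub>R w) = norm (h y) + B + 1" using w i B by (simp add: i_def)
    then have "norm (?c i) > B" using norm_triangle_ineq4[of "?c i" "h y"] by simp
    then have "?c i \<notin> h ` ball x t" using B(1) ball_subset_cball by (metis image_mono not_le subsetD)
    then show ?thesis using i by (auto simp: Z_def)
  qed
  moreover have bb: "bdd_below Z" by (auto simp: Z_def intro: bdd_belowI[of _ 0])
  ultimately have "Inf Z \<in> Z" using clZ by (intro closed_contains_Inf)
  define i where "i = Inf Z"
  have iZ: "i \<in> Z" and imin: "\<And>j. j \<in> Z \<Longrightarrow> i \<le> j"
    using \<open>Inf Z \<in> Z\<close> bb by (auto simp: i_def intro: cInf_lower)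
  have "?c i \<in> h ` cball x t"
  \<comment> \<open>\<open>i = 0\<close> occurs when \<open>y\<close> already lies on the sphere;
    otherwise the exit point is a limit of points in the compact image of
    \<open>cball x t\<close>.\<close>
  proof (cases "i = 0")
    case True
    then show ?thesis using y by auto
  next
    case False
    then have i: "0 < i" using iZ by (simp add: Z_def)
    have "?c j \<in> h ` cball x t" if "j \<in> {0..<i}" for j
    proof -
      have "j \<notin> Z" using imin[of j] that by auto
      then have "?c j \<in> h ` ball x t" using that by (auto simp: Z_def)
      then show ?thesis using ball_subset_cball by blast
    qed
    then have "?c ` {0..<i} \<subseteq> h ` cball x t" by blast
    then have "?c ` closure {0..<i} \<subseteq> h ` cball x t"
      using compact_imp_closed[OF com] by (intro image_closure_subset continuous_intros)
    then show ?thesis using i by (simp add: closure_atLeastLessThan image_subset_iff)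
  qed
  then obtain q where q: "q \<in> cball x t" "?c i = h q" by blast
  have "q \<notin> ball x t" using iZ q by (auto simp: Z_def)
  then have "dist x q = t" using q by auto
  moreover have "i \<le> j" if "0 \<le> j" "?c j \<notin> h ` G" for j
    using that bG by (intro imin) (auto simp: Z_def)
  ultimately show thesis using that[of i q] iZ q by (auto simp: Z_def)
qed

text \<open>The ring is centred at \<open>z\<close>, with inner radius |h x - z|. Were the claim
  false, one ray from \<open>h x\<close> towards \<open>z\<close> would stay inside the ring's inner
  ball and one from \<open>h y\<close> away from \<open>z\<close> beyond its outer radius, and the
  preimages of both would reach every sphere around \<open>x\<close> of radius slightly above
  \<open>d/4\<close>.\<close>

proposition distortion_upper:
  assumes N: "admissible N" and d: "0 < d" "ball x d \<subseteq> G"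
    and z: "z \<notin> h ` G" and y: "dist x y \<le> d / 4"
  shows "norm (h y - z) < 2 ^ N * norm (h x - z)"
proof (rule ccontr)
  assume "\<not> ?thesis"
  then have far: "2 ^ N * norm (h x - z) \<le> norm (h y - z)" by simp
  define m where "m = norm (h x - z)"
  have xG: "x \<in> G" and yG: "y \<in> G" using d y by (auto intro!: subsetD[OF d(2)])
  have m: "m > 0" using xG z by (auto simp: m_def)
  have N0: "0 < N" using N by (simp add: admissible_def)
  define f where "f p = log_ramp m N (norm (h p - z))" for p
  have cb: "cball x t \<subseteq> G" "0 < t" "dist x y \<le> t" "t < d" if "t \<in> {d/4..d/4 + (d/4)/4}" for t
  proof -
    show t: "0 < t" "dist x y \<le> t" "t < d" using that d y by auto
    then have "cball x t \<subseteq> ball x d" by auto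
    then show "cball x t \<subseteq> G" using d(2) by blast
  qed
  show False
  \<comment> \<open>With \<open>r = d/4\<close> the ball of radius \<open>4 * r\<close> is
    \<open>ball x d\<close>, which lies in \<open>G\<close>.\<close>
  proof (rule no_ring[OF N m, of "d/4" x f z "d/4" "d/4"])
    show "continuous_on (ball x (4 * (d/4))) f"
      unfolding f_def
      using d(2) by (intro continuous_on_compose2[OF log_ramp(6)[OF m N0, of UNIV]] continuous_intros
          continuous_on_subset[OF cont_h]) auto
    show "\<exists>q. dist x q = t \<and> f q = 0" if t: "t \<in> {d/4..d/4 + (d/4)/4}" for t
    proof -
      have "z - h x \<noteq> 0" using xG z by auto
      then obtain i q where iq: "0 \<le> i" "dist x q = t" "h q = h x + i *\<^sub>R (z - h x)"
        "\<And>j. 0 \<le> j \<Longrightarrow> h x + j *\<^sub>R (z - h x) \<notin> h ` G \<Longrightarrow> i \<le> j"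
        using ray_exit[OF cb(2)[OF t] cb(1)[OF t], of x "z - h x"] cb(2)[OF t] by auto
      \<comment> \<open>At parameter 1 the ray is at \<open>z\<close>, outside h(G), so it has left
        the image ball by then.\<close>
      have "i \<le> 1" using iq(4)[of 1] z by simp
      have "h q - z = (1 - i) *\<^sub>R (h x - z)" unfolding iq(3) by (simp add: algebra_simps)
      then have "norm (h q - z) = (1 - i) * m" using \<open>i \<le> 1\<close> by (simp add: m_def)
      also have "\<dots> \<le> m" using m iq(1) by (simp add: mult_le_cancel_right1)
      finally show ?thesis using iq(2) log_ramp(3)[OF m N0] by (auto simp: f_def)
    qed
    show "\<exists>q. dist x q = t \<and> f q = 1" if t: "t \<in> {d/4..d/4 + (d/4)/4}" for t
    proof -
      have "h y - z \<noteq> 0" using yG z by auto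
      then obtain i q where iq: "0 \<le> i" "dist x q = t" "h q = h y + i *\<^sub>R (h y - z)"
        using ray_exit[OF cb(2)[OF t] cb(1)[OF t] cb(3)[OF t], of "h y - z"] by metis
      have "h q - z = (1 + i) *\<^sub>R (h y - z)" unfolding iq(3) by (simp add: algebra_simps)
      then have "norm (h q - z) = (1 + i) * norm (h y - z)" using iq(1) by simp
      also have "\<dots> \<ge> norm (h y - z)" using iq(1) by (simp add: mult_le_cancel_right1)
      finally have "2 ^ N * m \<le> norm (h q - z)" using far by (simp add: m_def)
      then show ?thesis using iq(2) log_ramp(4)[OF m N0] by (auto simp: f_def)
    qed
  qed (use d in \<open>auto simp: f_def\<close>)
qed

text \<open>The ring is centred at \<open>h x\<close>. If the claim failed, the preimage of its
  closed inner ball would join \<open>x\<close> to \<open>y\<close> and meet all spheres of radius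
  up to |x - z| / 4, while the complement of the preimage \<open>S\<close> of the closed outer ball
  is connected, unbounded and contains \<open>z\<close>, so it meets all spheres of radius at least
  |x - z|.\<close>

proposition distortion_lower:
  assumes n: "CARD('n) \<ge> 2" and N: "admissible N" and x: "x \<in> G" and z: "z \<notin> G"
    and R: "0 < R" "cball (h x) R \<subseteq> h ` G" and y: "y \<in> G" "dist (h x) (h y) \<le> R / 2 ^ N"
  shows "dist x y < dist x z / 4"
proof (rule ccontr)
  assume "\<not> ?thesis"
  then have far: "dist x z / 4 \<le> dist x y" by simp
  let ?u = "h x" and ?d = "dist x z"
  define s where "s = R / 2 ^ N"
  have s: "0 < s" using R by (simp add: s_def)
  have Rs: "R = 2 ^ N * s" by (simp add: s_def)
  have N0: "0 < N" using N by (simp add: admissible_def)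
  have d: "0 < ?d" using x z by auto
  obtain g where g: "homeomorphism G (h ` G) h g"
    using invariance_of_domain_homeomorphism[OF open_G cont_h _ inj_h] by auto
  have gh: "\<And>p. p \<in> G \<Longrightarrow> g (h p) = p" and hg: "\<And>p. p \<in> h ` G \<Longrightarrow> h (g p) = p"
    and cg: "continuous_on (h ` G) g" and img: "g ` h ` G = G"
    using g by (auto simp: homeomorphism_def)
  have le: "s \<le> R" unfolding Rs using s by simp
  define S where "S = g ` cball ?u R"
  have S_eq: "S = {p \<in> G. norm (h p - ?u) \<le> R}"
  proof (intro set_eqI iffI)
    fix p assume "p \<in> S"
    then obtain v where v: "v \<in> cball ?u R" "p = g v" by (auto simp: S_def)
    then have "v \<in> h ` G" using R(2) by blast
    then have "p \<in> G" "h p = v" using hg img v by auto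
    then show "p \<in> {p \<in> G. norm (h p - ?u) \<le> R}" using v by (simp add: dist_norm norm_minus_commute)
  next
    fix p assume "p \<in> {p \<in> G. norm (h p - ?u) \<le> R}"
    then have "h p \<in> cball ?u R" "g (h p) = p" using gh by (auto simp: dist_norm norm_minus_commute)
    then show "p \<in> S" unfolding S_def by (metis imageI)
  qed
  have hom: "S homeomorphic cball ?u R"
  proof -
    have "homeomorphism (cball ?u R) (g ` cball ?u R) g h"
      by (rule homeomorphism_of_subsets[OF homeomorphism_symD[OF g] R(2) _ refl])
        (use R(2) img in blast)
    then show ?thesis unfolding S_def by (metis homeomorphic_def homeomorphic_sym)
  qed
  have Scom: "compact S"
    unfolding S_def by (intro compact_continuous_image continuous_on_subset[OF cg R(2)] compact_cball)
  \<comment> \<open>\<open>S\<close> is a topological closed ball, so its complement is connected in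
    dimension at least 2.\<close>
  have conn: "connected (- S)"
    using connected_complement_homeomorphic_convex_compact[OF hom] n by simp
  have zS: "z \<in> - S" using z S_eq by auto
  have unb: "\<not> bounded (- S)"
    using Scom compact_imp_bounded cobounded_imp_unbounded by blast
  \<comment> \<open>The ramp has reached 1 on the part of \<open>G\<close> outside \<open>S\<close>,
    so the value 1 extends it continuously beyond \<open>G\<close>.\<close>
  define f where "f p = (if p \<in> G then log_ramp s N (norm (h p - ?u)) else 1)" for p
  have fS: "f p = 1" if "p \<in> - S" for p
    using that log_ramp(4)[OF s N0] by (auto simp: f_def S_eq Rs)
  have c1: "continuous_on G f"
  proof -
    have "continuous_on G (\<lambda>p. log_ramp s N (norm (h p - ?u)))"
      by (intro continuous_on_compose2[OF log_ramp(6)[OF s N0, of UNIV]] continuous_intros cont_h) auto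
    then show ?thesis by (rule continuous_on_eq) (simp add: f_def)
  qed
  have c2: "continuous_on (- S) f"
    by (rule continuous_on_eq[of _ "\<lambda>_. 1"]) (use fS in auto)
  have "G \<union> - S = UNIV" using S_eq by auto
  then have c: "continuous_on UNIV f"
    using continuous_on_open_Un[OF open_G _ c1 c2] compact_imp_closed[OF Scom] by auto
  show False
  proof (rule no_ring[OF N s d, of x f ?u 0 ?d])
    show "continuous_on (ball x (4 * ?d)) f" using c by (rule continuous_on_subset) simp
    show "\<exists>q. dist x q = t \<and> f q = 0" if t: "t \<in> {0..0 + ?d/4}" for t
    proof -
      have sub: "cball ?u s \<subseteq> h ` G" using R(2) le by (meson order_trans subset_cball)
      let ?E = "g ` cball ?u s"
      have "connected (dist x ` ?E)"
        by (intro connected_continuous_image continuous_intros continuous_on_subset[OF cg sub]) simp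
      moreover have "x \<in> ?E" using gh[OF x] s by (metis centre_in_cball image_eqI less_imp_le)
      then have "0 \<in> dist x ` ?E" by (metis dist_self image_eqI)
      moreover have "y \<in> ?E" using gh[OF y(1)] y(2) by (metis image_eqI mem_cball s_def)
      then have "dist x y \<in> dist x ` ?E" by (rule imageI)
      ultimately have "t \<in> dist x ` ?E"
        by (rule connectedD_interval) (use t far in auto)
      then obtain v where v: "v \<in> cball ?u s" "t = dist x (g v)" by blast
      then have "g v \<in> G" "h (g v) = v" using sub hg img by blast+
      then have "f (g v) = 0" using v log_ramp(3)[OF s N0] by (simp add: f_def dist_norm norm_minus_commute)
      then show ?thesis using v by blast
    qed
    show "\<exists>q. dist x q = t \<and> f q = 1" if t: "t \<in> {?d..?d + ?d/4}" for t
    proof -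
      obtain p where p: "p \<in> - S" "t \<le> dist x p"
        using unb unfolding bounded_def by (metis linear)
      have "connected (dist x ` (- S))"
        by (intro connected_continuous_image continuous_intros conn)
      moreover have "?d \<in> dist x ` (- S)" "dist x p \<in> dist x ` (- S)" using zS p by blast+
      ultimately have "t \<in> dist x ` (- S)"
        by (rule connectedD_interval) (use t p in auto)
      then show ?thesis using fS by blast
    qed
  qed (use d in \<open>auto simp: f_def\<close>)
qed

end

section \<open>Gradient estimate for harmonic functions\<close>

text \<open>A positive second derivative would make the first one positive just to the right of 0,
  where it vanishes, and the mean value theorem would give a larger value.\<close>

lemma second_derivative_nonpos_at_max:
  fixes f :: "real \<Rightarrow> real"
  assumes b: "0 < b" and max: "\<And>t. \<bar>t\<bar> < b \<Longrightarrow> f t \<le> f 0"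
    and d1: "\<And>t. \<bar>t\<bar> < b \<Longrightarrow> (f has_real_derivative f1 t) (at t)"
    and d2: "(f1 has_real_derivative c) (at 0)"
  shows "c \<le> 0"
proof (rule ccontr)
  assume "\<not> ?thesis"
  then have c: "c > 0" by simp
  have z: "f1 0 = 0"
    using DERIV_local_max[OF d1[of 0] b] max b by auto
  obtain e where e: "e > 0" "\<And>t. 0 < t \<Longrightarrow> t < e \<Longrightarrow> f1 0 < f1 (0 + t)"
    using DERIV_pos_inc_right[OF d2 c] by blast
  define t where "t = min e b / 2"
  have t: "0 < t" "t < e" "t < b" using e(1) b by (auto simp: t_def min_def)
  obtain s where s: "0 < s" "s < t" "f t - f 0 = (t - 0) * f1 s"
    using MVT2[of 0 t f f1] t d1 by auto
  have "0 < f1 s" using e(2)[of s] s t z by simp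
  then have "0 < (t - 0) * f1 s" using t by simp
  then show False using s(3) max[of t] t by simp
qed

text \<open>The maximum principle on half of the cube compares the odd part of \<open>u\<close> in direction \<open>k\<close> with a
  quadratic superharmonic barrier that vanishes to first order at the centre.\<close>

lemma gradient_upper_bound_cube:
  fixes u :: "real^'n \<Rightarrow> real" and g gg :: "'n \<Rightarrow> real^'n \<Rightarrow> real" and x :: "real^'n" and d :: real
  assumes d: "0 < d" and M: "0 < M"
  defines "Q \<equiv> {p. \<forall>i. \<bar>p $ i - x $ i\<bar> \<le> d}"
  assumes g: "\<And>p i. p \<in> Q \<Longrightarrow> ((\<lambda>t. u (p + t *\<^sub>R axis i 1)) has_real_derivative g i p) (at 0)"
    and gg: "\<And>p i. p \<in> Q \<Longrightarrow> ((\<lambda>t. g i (p + t *\<^sub>R axis i 1)) has_real_derivative gg i p) (at 0)"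
    and lap: "\<And>p. p \<in> Q \<Longrightarrow> (\<Sum>i\<in>UNIV. gg i p) = 0"
    and c: "continuous_on Q u" and bd: "\<And>p. p \<in> Q \<Longrightarrow> \<bar>u p\<bar> \<le> M"
  shows "g k x \<le> (real CARD('n) + 1) * M / d"
proof -
  let ?n = "real CARD('n)"
  define ref where "ref p = (\<chi> i. if i = k then 2 * x $ k - p $ k else p $ i)" for p :: "real^'n"
  \<comment> \<open>The barrier has Laplacian -2 M / d^2. On the half cube it is nonnegative on the
    middle plane, where the odd part of \<open>u\<close> vanishes, and at least \<open>M\<close> on
    the other faces, where the odd part is at most \<open>M\<close>.\<close>
  define w where "w p = (M / d\<^sup>2) * ((\<Sum>i\<in>UNIV - {k}. (p $ i - x $ i)\<^sup>2)
      + (p $ k - x $ k) * ((?n + 1) * d - ?n * (p $ k - x $ k)))" for p :: "real^'n"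
  define v where "v p = (u p - u (ref p)) / 2 - w p" for p
  define R where "R = {p \<in> Q. x $ k \<le> p $ k}"
  have RQ: "p \<in> Q" if "p \<in> R" for p using that by (simp add: R_def)
  have refQ: "ref p \<in> Q" if "p \<in> Q" for p
  proof -
    have b: "\<bar>p $ i - x $ i\<bar> \<le> d" for i using that by (simp add: Q_def)
    have "\<bar>ref p $ i - x $ i\<bar> \<le> d" for i
      using b[of i] by (cases "i = k") (auto simp: ref_def)
    then show ?thesis by (simp add: Q_def)
  qed
  have Q_cbox: "Q = cbox (\<chi> i. x $ i - d) (\<chi> i. x $ i + d)"
    by (auto simp: Q_def mem_box_cart abs_le_iff algebra_simps)
  have compR: "compact R"
  proof -
    have "R = Q \<inter> {p. x $ k \<le> p $ k}" by (auto simp: R_def)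
    moreover have "closed {p :: real^'n. x $ k \<le> p $ k}" by (intro closed_Collect_le continuous_intros)
    ultimately show ?thesis by (simp add: Q_cbox compact_Int_closed)
  qed
  have cref: "continuous_on S ref" for S
    unfolding ref_def
  proof (rule continuous_on_vec_lambda)
    show "continuous_on S (\<lambda>p. if i = k then 2 * x $ k - p $ k else p $ i)" for i
      by (cases "i = k") (auto intro!: continuous_intros)
  qed
  have cw: "continuous_on S w" for S
    unfolding w_def by (intro continuous_intros)
  have cv: "continuous_on R v"
  proof -
    have "continuous_on R u" using c RQ by (meson continuous_on_subset subsetI)
    moreover have "continuous_on R (\<lambda>p. u (ref p))"
      using continuous_on_compose2[OF c cref] RQ refQ by (metis image_subsetI)
    ultimately show ?thesis unfolding v_def by (intro continuous_intros cw) auto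
  qed
  have "x \<in> R" using d by (simp add: R_def Q_def)
  then obtain p where p: "p \<in> R" "\<And>q. q \<in> R \<Longrightarrow> v q \<le> v p"
    using continuous_attains_sup[OF compR _ cv] by blast
  have coord: "\<bar>p $ i - x $ i\<bar> \<le> d" for i using RQ[OF p(1)] by (simp add: Q_def)
  have pk: "0 \<le> p $ k - x $ k" "p $ k - x $ k \<le> d" using p(1) coord[of k] by (auto simp: R_def)
  have n1: "?n \<ge> 1" by (simp add: Suc_le_eq)
  have Md: "M / d\<^sup>2 > 0" using M d by simp
  have prod_nonneg: "0 \<le> (p $ k - x $ k) * ((?n + 1) * d - ?n * (p $ k - x $ k))"
  proof (rule mult_nonneg_nonneg)
    have "?n * (p $ k - x $ k) \<le> ?n * d" using pk by (intro mult_left_mono) auto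
    then show "0 \<le> (?n + 1) * d - ?n * (p $ k - x $ k)" using d by (simp add: algebra_simps)
  qed (use pk in simp)
  have uM: "(u p - u (ref p)) / 2 \<le> M" using bd[OF RQ[OF p(1)]] bd[OF refQ[OF RQ[OF p(1)]]] by (simp add: abs_le_iff)
  have "v p \<le> 0"
  proof (rule ccontr)
    assume "\<not> ?thesis"
    then have vpos: "v p > 0" by simp
    have "p $ k \<noteq> x $ k"
    proof
      assume eq: "p $ k = x $ k"
      then have "ref p = p" by (simp add: ref_def vec_eq_iff)
      moreover have "0 \<le> w p" 
        unfolding w_def using Md prod_nonneg
        by (intro mult_nonneg_nonneg add_nonneg_nonneg[OF sum_nonneg prod_nonneg]) auto
      ultimately show False using vpos by (simp add: v_def)
    qed
    then have k0: "x $ k < p $ k" using pk by simp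
    have k1: "p $ k < x $ k + d"
    proof (rule ccontr)
      assume "\<not> ?thesis"
      then have eq: "p $ k - x $ k = d" using pk by simp
      have "w p \<ge> (M / d\<^sup>2) * (d * ((?n + 1) * d - ?n * d))"
        unfolding w_def eq using Md by (intro mult_left_mono) (auto simp: sum_nonneg)
      also have "(M / d\<^sup>2) * (d * ((?n + 1) * d - ?n * d)) = M"
        using d by (simp add: power2_eq_square algebra_simps)
      finally show False using vpos uM by (simp add: v_def)
    qed
    have i1: "\<bar>p $ i - x $ i\<bar> < d" if "i \<noteq> k" for i
    proof (rule ccontr)
      assume "\<not> ?thesis"
      then have eq: "\<bar>p $ i - x $ i\<bar> = d" using coord[of i] by simp
      have "d\<^sup>2 = (p $ i - x $ i)\<^sup>2" by (metis eq power2_abs)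
      also have "\<dots> \<le> (\<Sum>i\<in>UNIV - {k}. (p $ i - x $ i)\<^sup>2)"
        using that by (intro member_le_sum) auto
      finally have "d\<^sup>2 \<le> (\<Sum>i\<in>UNIV - {k}. (p $ i - x $ i)\<^sup>2)" .
      then have "w p \<ge> (M / d\<^sup>2) * d\<^sup>2"
        unfolding w_def using Md prod_nonneg by (intro mult_left_mono) auto
      also have "(M / d\<^sup>2) * d\<^sup>2 = M" using d by simp
      finally show False using vpos uM by (simp add: v_def)
    qed
    have c_le: "(gg j p - gg j (ref p)) / 2 - (M / d\<^sup>2) * ((\<Sum>i\<in>UNIV - {k}. 2 * (axis j 1 $ i)\<^sup>2)
        - 2 * ?n * (axis j 1 $ k)\<^sup>2) \<le> 0" for j
    proof -
      define e where "e = (axis j 1 :: real^'n)"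
      \<comment> \<open>The reflection reverses only direction \<open>k\<close>; the sign disappears
        from second derivatives because its square is 1.\<close>
      define s :: real where "s = (if j = k then -1 else 1)"
      define b where "b = min (p $ k - x $ k) (d - \<bar>p $ j - x $ j\<bar>)"
      have jd: "\<bar>p $ j - x $ j\<bar> < d" using i1[of j] k0 k1 by (cases "j = k") auto
      have b: "b > 0" using k0 jd by (simp add: b_def)
      have refe: "ref (p + t *\<^sub>R e) = ref p + (s * t) *\<^sub>R e" for t
        by (simp add: ref_def e_def s_def vec_eq_iff axis_def)
      have inR: "p + t *\<^sub>R e \<in> R" if t: "\<bar>t\<bar> < b" for t
      proof -
        have "\<bar>(p + t *\<^sub>R e) $ i - x $ i\<bar> \<le> d" for i
          using t coord[of i] jd by (cases "i = j") (auto simp: e_def axis_def b_def)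
        moreover have "x $ k \<le> (p + t *\<^sub>R e) $ k"
          using t pk by (cases "j = k") (auto simp: e_def axis_def b_def)
        ultimately show ?thesis by (simp add: R_def Q_def)
      qed
      have shift: "((\<lambda>r. F (q + r *\<^sub>R e)) has_real_derivative D) (at t)"
        if "((\<lambda>r. F ((q + t *\<^sub>R e) + r *\<^sub>R e)) has_real_derivative D) (at 0)" for F :: "real^'n \<Rightarrow> real" and q D t
      proof -
        have "((\<lambda>r. F (q + (r + t) *\<^sub>R e)) has_real_derivative D) (at 0)"
          using that by (simp add: algebra_simps)
        then show ?thesis using DERIV_shift[of "\<lambda>r. F (q + r *\<^sub>R e)" D 0 t] by simp
      qed
      have scale: "((\<lambda>r. F (q + (s * r) *\<^sub>R e)) has_real_derivative D * s) (at t)"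
        if "((\<lambda>r. F (q + r *\<^sub>R e)) has_real_derivative D) (at (s * t))" for F :: "real^'n \<Rightarrow> real" and q D t
        by (rule DERIV_chain2[where f = "\<lambda>r. F (q + r *\<^sub>R e)" and g = "\<lambda>r. s * r", OF that])
          (auto intro!: derivative_eq_intros)
      let ?S = "\<lambda>t. \<Sum>i\<in>UNIV - {k}. 2 * (p $ i + t * e $ i - x $ i) * e $ i"
      let ?T = "\<lambda>t. e $ k * ((?n + 1) * d - ?n * (p $ k + t * e $ k - x $ k))
          - (p $ k + t * e $ k - x $ k) * (?n * e $ k)"
      define f1 where "f1 t = (g j (p + t *\<^sub>R e) - g j (ref p + (s * t) *\<^sub>R e) * s) / 2 - (M / d\<^sup>2) * (?S t + ?T t)" for t
      have "(gg j p - gg j (ref p)) / 2 - (M / d\<^sup>2) * ((\<Sum>i\<in>UNIV - {k}. 2 * (e $ i)\<^sup>2) - 2 * ?n * (e $ k)\<^sup>2) \<le> 0"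
      proof (rule second_derivative_nonpos_at_max[OF b, of "\<lambda>t. v (p + t *\<^sub>R e)" f1])
        fix t assume t: "\<bar>t\<bar> < b"
        show "v (p + t *\<^sub>R e) \<le> v (p + 0 *\<^sub>R e)" using p(2)[OF inR[OF t]] by simp
        have D1: "((\<lambda>t. u (p + t *\<^sub>R e)) has_real_derivative g j (p + t *\<^sub>R e)) (at t)"
          by (rule shift[where F = u and q = p]) (use g[OF RQ[OF inR[OF t]], of j] in \<open>simp add: e_def\<close>)
        have Q2: "ref p + (s * t) *\<^sub>R e \<in> Q" using refQ[OF RQ[OF inR[OF t]]] by (simp add: refe)
        have D2: "((\<lambda>t. u (ref p + (s * t) *\<^sub>R e)) has_real_derivative g j (ref p + (s * t) *\<^sub>R e) * s) (at t)"
          by (rule scale[where F = u and q = "ref p"], rule shift[where F = u and q = "ref p"])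
            (use g[OF Q2, of j] in \<open>simp add: e_def\<close>)
        have D3: "((\<lambda>t. w (p + t *\<^sub>R e)) has_real_derivative (M / d\<^sup>2) * (?S t + ?T t)) (at t)"
          unfolding w_def
        proof (intro DERIV_cmult DERIV_add DERIV_sum)
          show "((\<lambda>t. ((p + t *\<^sub>R e) $ i - x $ i)\<^sup>2) has_real_derivative 2 * (p $ i + t * e $ i - x $ i) * e $ i) (at t)" for i
            by (auto intro!: derivative_eq_intros)
          show "((\<lambda>t. ((p + t *\<^sub>R e) $ k - x $ k) * ((?n + 1) * d - ?n * ((p + t *\<^sub>R e) $ k - x $ k))) has_real_derivative ?T t) (at t)"
            by (auto intro!: derivative_eq_intros simp: algebra_simps)
        qed
        show "((\<lambda>t. v (p + t *\<^sub>R e)) has_real_derivative f1 t) (at t)"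
          unfolding v_def f1_def refe by (intro DERIV_diff DERIV_cdivide D1 D2 D3)
      next
        have D1: "((\<lambda>t. g j (p + t *\<^sub>R e)) has_real_derivative gg j p) (at 0)"
          using gg[OF RQ[OF p(1)], of j] by (simp add: e_def)
        have "((\<lambda>t. g j (ref p + (s * t) *\<^sub>R e)) has_real_derivative gg j (ref p) * s) (at 0)"
          by (rule scale[where F = "g j" and q = "ref p"]) (use gg[OF refQ[OF RQ[OF p(1)]], of j] in \<open>simp add: e_def\<close>)
        then have D2: "((\<lambda>t. g j (ref p + (s * t) *\<^sub>R e) * s) has_real_derivative gg j (ref p) * s * s) (at 0)"
          by (rule DERIV_cmult_right)
        have ss: "gg j (ref p) * s * s = gg j (ref p)" by (simp add: s_def)
        have D3: "((\<lambda>t. (M / d\<^sup>2) * (?S t + ?T t))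
          has_real_derivative (M / d\<^sup>2) * ((\<Sum>i\<in>UNIV - {k}. 2 * (e $ i)\<^sup>2) - 2 * ?n * (e $ k)\<^sup>2)) (at 0)"
        proof (rule DERIV_cmult)
          have D4: "(?S has_real_derivative
              (\<Sum>i\<in>UNIV - {k}. 2 * (e $ i)\<^sup>2)) (at 0)"
            by (intro DERIV_sum) (auto intro!: derivative_eq_intros simp: power2_eq_square)
          have D5: "(?T has_real_derivative - 2 * ?n * (e $ k)\<^sup>2) (at 0)"
            by (auto intro!: derivative_eq_intros simp: power2_eq_square algebra_simps)
          show "((\<lambda>t. ?S t + ?T t)
            has_real_derivative (\<Sum>i\<in>UNIV - {k}. 2 * (e $ i)\<^sup>2) - 2 * ?n * (e $ k)\<^sup>2) (at 0)"
            using DERIV_add[OF D4 D5] by simp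
        qed
        show "(f1 has_real_derivative (gg j p - gg j (ref p)) / 2 - (M / d\<^sup>2) *
            ((\<Sum>i\<in>UNIV - {k}. 2 * (e $ i)\<^sup>2) - 2 * ?n * (e $ k)\<^sup>2)) (at 0)"
          unfolding f1_def using D1 D2[unfolded ss] D3 by (intro DERIV_diff DERIV_cdivide)
      qed
      then show ?thesis by (simp add: e_def)
    qed
    \<comment> \<open>Summing over the axes, the Laplacians of \<open>u\<close> at \<open>p\<close>
      and \<open>ref p\<close> vanish and the barrier leaves 2 M / d^2 > 0, which contradicts an
      interior maximum.\<close>
    have "(\<Sum>j\<in>UNIV. (gg j p - gg j (ref p)) / 2 - (M / d\<^sup>2) * ((\<Sum>i\<in>UNIV - {k}. 2 * (axis j 1 $ i)\<^sup>2)
        - 2 * ?n * (axis j 1 $ k)\<^sup>2)) \<le> 0"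
      by (intro sum_nonpos c_le)
    also have "(\<Sum>j\<in>UNIV. (gg j p - gg j (ref p)) / 2 - (M / d\<^sup>2) * ((\<Sum>i\<in>UNIV - {k}. 2 * (axis j 1 $ i)\<^sup>2)
        - 2 * ?n * (axis j 1 $ k)\<^sup>2)) =
      ((\<Sum>j\<in>UNIV. gg j p) - (\<Sum>j\<in>UNIV. gg j (ref p))) / 2 - (M / d\<^sup>2) *
        ((\<Sum>j\<in>UNIV. \<Sum>i\<in>UNIV - {k}. 2 * (axis j 1 $ i)\<^sup>2) - (\<Sum>j\<in>UNIV. 2 * ?n * (axis j 1 $ k)\<^sup>2))"
      by (simp only: sum_subtractf sum_divide_distrib[symmetric] sum_distrib_left[symmetric])
    also have "(\<Sum>j\<in>UNIV. gg j p) = 0" using lap RQ[OF p(1)] by blast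
    also have "(\<Sum>j\<in>UNIV. gg j (ref p)) = 0" using lap refQ RQ[OF p(1)] by blast
    also have "(\<Sum>j\<in>UNIV. \<Sum>i\<in>UNIV - {k}. 2 * (axis j 1 $ i)\<^sup>2) = 2 * (?n - 1)"
    proof -
      have "(\<Sum>j\<in>UNIV. 2 * ((axis j 1 :: real^'n) $ i)\<^sup>2) = 2" for i
      proof -
        have "(\<Sum>j\<in>UNIV. 2 * ((axis j 1 :: real^'n) $ i)\<^sup>2) = (\<Sum>j\<in>UNIV. if j = i then 2 else 0)"
          by (intro sum.cong) (auto simp: axis_def)
        then show ?thesis by simp
      qed
      then have "(\<Sum>i\<in>UNIV - {k}. \<Sum>j\<in>UNIV. 2 * ((axis j 1 :: real^'n) $ i)\<^sup>2) = (\<Sum>i\<in>UNIV - {k}. 2)" by simp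
      also have "\<dots> = 2 * (?n - 1)" using n1 by (simp add: card_Diff_singleton of_nat_diff)
      finally show ?thesis by (subst sum.swap)
    qed
    also have "(\<Sum>j\<in>UNIV. 2 * ?n * ((axis j 1 :: real^'n) $ k)\<^sup>2) = 2 * ?n"
    proof -
      have "(\<Sum>j\<in>UNIV. 2 * ?n * ((axis j 1 :: real^'n) $ k)\<^sup>2) = (\<Sum>j\<in>UNIV. if j = k then 2 * ?n else 0)"
        by (intro sum.cong) (auto simp: axis_def)
      then show ?thesis by simp
    qed
    finally have "2 * (M / d\<^sup>2) \<le> 0" by (simp add: algebra_simps)
    then show False using Md by simp
  qed
  then have vR: "v q \<le> 0" if "q \<in> R" for q using p(2)[OF that] by simp
  define e where "e = (axis k 1 :: real^'n)"
  \<comment> \<open>On the axis through \<open>x\<close> the odd part is half the symmetric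
    difference of \<open>u\<close>, and the barrier is at most linear with slope (n + 1) M /
    d.\<close>
  have le: "(u (x + t *\<^sub>R e) - u (x + (- t) *\<^sub>R e)) / (2 * t) \<le> (?n + 1) * M / d" if t: "0 < t" "t < d" for t
  proof -
    have "x + t *\<^sub>R e \<in> R" using t by (auto simp: R_def Q_def e_def axis_def)
    from vR[OF this] have "(u (x + t *\<^sub>R e) - u (ref (x + t *\<^sub>R e))) / 2 \<le> w (x + t *\<^sub>R e)" by (simp add: v_def)
    also have "ref (x + t *\<^sub>R e) = x + (- t) *\<^sub>R e" by (auto simp: ref_def e_def vec_eq_iff axis_def)
    also have "w (x + t *\<^sub>R e) = (M / d\<^sup>2) * (t * ((?n + 1) * d - ?n * t))"
      by (simp add: w_def e_def axis_def)
    also have "\<dots> \<le> (M / d\<^sup>2) * (t * ((?n + 1) * d))"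
      using Md t by (intro mult_left_mono) auto
    also have "\<dots> = t * ((?n + 1) * M / d)" using d by (simp add: power2_eq_square)
    finally show ?thesis using t by (simp add: field_simps)
  qed
  have xQ: "x \<in> Q" using d by (simp add: Q_def)
  have lim1: "((\<lambda>t. (u (x + t *\<^sub>R e) - u x) / t) \<longlongrightarrow> g k x) (at 0)"
    using g[OF xQ, of k] by (simp add: DERIV_def e_def)
  have "((\<lambda>t. u (x + (- t) *\<^sub>R e)) has_real_derivative g k x * (- 1)) (at 0)"
    by (rule DERIV_chain2[where f = "\<lambda>t. u (x + t *\<^sub>R e)" and g = "\<lambda>t. - t"])
      (use g[OF xQ, of k] in \<open>auto simp: e_def intro!: derivative_eq_intros\<close>)
  then have lim2: "((\<lambda>t. (u (x + (- t) *\<^sub>R e) - u x) / t) \<longlongrightarrow> g k x * (- 1)) (at 0)"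
    by (simp add: DERIV_def)
  have "((\<lambda>t. ((u (x + t *\<^sub>R e) - u x) / t - (u (x + (- t) *\<^sub>R e) - u x) / t) / 2) \<longlongrightarrow> (g k x - g k x * (- 1)) / 2) (at 0)"
    by (intro tendsto_intros lim1 lim2) simp
  then have "((\<lambda>t. (u (x + t *\<^sub>R e) - u (x + (- t) *\<^sub>R e)) / (2 * t)) \<longlongrightarrow> g k x) (at 0)"
    by (simp add: diff_divide_distrib[symmetric] mult.commute)
  then have lim: "((\<lambda>t. (u (x + t *\<^sub>R e) - u (x + (- t) *\<^sub>R e)) / (2 * t)) \<longlongrightarrow> g k x) (at_right 0)"
    by (rule filterlim_at_split[THEN iffD1, THEN conjunct2])
  show ?thesis
  proof (rule tendsto_upperbound[OF lim])
    show "\<forall>\<^sub>F t in at_right 0. (u (x + t *\<^sub>R e) - u (x + (- t) *\<^sub>R e)) / (2 * t) \<le> (?n + 1) * M / d"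
      unfolding eventually_at_right[OF d] using le d by blast
  qed simp
qed

section \<open>Proof of the theorem\<close>

lemma partial_deriv_has_derivative:
  assumes "(f has_derivative f') (at x)"
  shows "((\<lambda>t. f (x + t *\<^sub>R axis i 1)) has_vector_derivative f' (axis i 1)) (at 0)"
    and "partial_deriv i f x = f' (axis i 1)"
proof -
  have "((\<lambda>t. x + t *\<^sub>R axis i 1) has_derivative (\<lambda>t. t *\<^sub>R axis i 1)) (at (0::real))"
    by (auto intro!: derivative_eq_intros)
  moreover have "(f has_derivative f') (at (x + 0 *\<^sub>R axis i 1))" using assms by simp
  ultimately have "((\<lambda>t. f (x + t *\<^sub>R axis i 1)) has_derivative (\<lambda>t. f' (t *\<^sub>R axis i 1))) (at 0)"
    by (rule has_derivative_compose)
  then show 1: "((\<lambda>t. f (x + t *\<^sub>R axis i 1)) has_vector_derivative f' (axis i 1)) (at 0)"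
    unfolding has_vector_derivative_def using linear_scale[OF has_derivative_linear[OF assms]] by simp
  show "partial_deriv i f x = f' (axis i 1)"
    unfolding partial_deriv_def using 1 by (rule vector_derivative_at)
qed

lemma has_real_derivative_partial_deriv:
  fixes f :: "real^'n \<Rightarrow> real"
  assumes "f differentiable (at x)"
  shows "((\<lambda>t. f (x + t *\<^sub>R axis i 1)) has_real_derivative partial_deriv i f x) (at 0)"
proof -
  obtain f' where "(f has_derivative f') (at x)" using assms by (auto simp: differentiable_def)
  from partial_deriv_has_derivative[OF this] show ?thesis
    by (simp add: has_real_derivative_iff_has_vector_derivative)
qed

text \<open>Subtracting \<open>c\<close> does not change the gradient, so only the oscillation
  counts. The one-sided cube estimate is applied to \<open>u - c\<close> and to
  \<open>c - u\<close>.\<close>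

lemma harmonic_gradient_bound:
  fixes u :: "real^'n \<Rightarrow> real"
  assumes u: "harmonic_on D u" and r: "0 < r" "cball x r \<subseteq> D" and M: "0 < M"
    and bd: "\<And>p. p \<in> cball x r \<Longrightarrow> \<bar>u p - c\<bar> \<le> M"
  shows "\<bar>partial_deriv k u x\<bar> \<le> (real CARD('n) + 1) * M * real CARD('n) / r"
proof -
  let ?n = "real CARD('n)"
  \<comment> \<open>The norm is at most the sum of the n coordinates' absolute values, so the cube
    of half-side r / n lies in the ball.\<close>
  define d where "d = r / ?n"
  have n: "?n > 0" by simp
  have d: "d > 0" using r n by (simp add: d_def)
  have Q: "p \<in> cball x r" if p: "p \<in> {p. \<forall>i. \<bar>p $ i - x $ i\<bar> \<le> d}" for p
  proof -
    have "norm (p - x) \<le> (\<Sum>i\<in>UNIV. \<bar>(p - x) $ i\<bar>)" by (rule norm_le_l1_cart)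
    also have "\<dots> \<le> (\<Sum>i\<in>(UNIV::'n set). d)" using p by (intro sum_mono) auto
    also have "\<dots> = r" using n by (simp add: d_def)
    finally show ?thesis by (simp add: dist_norm norm_minus_commute)
  qed
  have du: "u differentiable (at p)" "partial_deriv i u differentiable (at p)"
      "(\<Sum>i\<in>UNIV. partial_deriv i (partial_deriv i u) p) = 0" if "p \<in> cball x r" for p i
    using u r(2) that unfolding harmonic_on_def by blast+
  have cu: "continuous_on {p. \<forall>i. \<bar>p $ i - x $ i\<bar> \<le> d} u"
    using du(1) Q by (intro continuous_at_imp_continuous_on ballI differentiable_imp_continuous_within) blast
  have up: "partial_deriv k u x \<le> (?n + 1) * M / d"
  proof (rule gradient_upper_bound_cube[OF d M, where u = "\<lambda>p. u p - c" and g = "\<lambda>i. partial_deriv i u"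
        and gg = "\<lambda>i. partial_deriv i (partial_deriv i u)"])
    fix p i assume p: "p \<in> {p. \<forall>i. \<bar>p $ i - x $ i\<bar> \<le> d}"
    show "((\<lambda>t. u (p + t *\<^sub>R axis i 1) - c) has_real_derivative partial_deriv i u p) (at 0)"
      using DERIV_diff[OF has_real_derivative_partial_deriv[OF du(1)[OF Q[OF p]]] DERIV_const[of c]] by simp
    show "((\<lambda>t. partial_deriv i u (p + t *\<^sub>R axis i 1)) has_real_derivative
        partial_deriv i (partial_deriv i u) p) (at 0)"
      by (rule has_real_derivative_partial_deriv[OF du(2)[OF Q[OF p]]])
  qed (use du(3) Q cu bd in \<open>auto intro!: continuous_intros\<close>)
  have lo: "- partial_deriv k u x \<le> (?n + 1) * M / d"
  proof (rule gradient_upper_bound_cube[OF d M, where u = "\<lambda>p. c - u p" and g = "\<lambda>i p. - partial_deriv i u p"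
        and gg = "\<lambda>i p. - partial_deriv i (partial_deriv i u) p"])
    fix p i assume p: "p \<in> {p. \<forall>i. \<bar>p $ i - x $ i\<bar> \<le> d}"
    show "((\<lambda>t. c - u (p + t *\<^sub>R axis i 1)) has_real_derivative - partial_deriv i u p) (at 0)"
      using DERIV_diff[OF DERIV_const[of c] has_real_derivative_partial_deriv[OF du(1)[OF Q[OF p]]]] by simp
    show "((\<lambda>t. - partial_deriv i u (p + t *\<^sub>R axis i 1)) has_real_derivative
        - partial_deriv i (partial_deriv i u) p) (at 0)"
      by (rule DERIV_minus[OF has_real_derivative_partial_deriv[OF du(2)[OF Q[OF p]]]])
  next
    fix p assume p: "p \<in> {p. \<forall>i. \<bar>p $ i - x $ i\<bar> \<le> d}"
    show "(\<Sum>i\<in>UNIV. - partial_deriv i (partial_deriv i u) p) = 0"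
      using du(3)[OF Q[OF p]] by (simp add: sum_negf)
    show "\<bar>c - u p\<bar> \<le> M" using bd[OF Q[OF p]] by (simp add: abs_minus_commute)
  qed (use cu in \<open>auto intro!: continuous_intros\<close>)
  have "(?n + 1) * M / d = (?n + 1) * M * ?n / r" using r n by (simp add: d_def)
  with up lo show ?thesis by (simp add: abs_le_iff)
qed

lemma harmonic_map_has_derivative:
  fixes h :: "real^'n \<Rightarrow> real^'m"
  assumes h: "harmonic_map_on D h" and x: "x \<in> D"
  shows "(h has_derivative (*v) (deriv_matrix h x)) (at x)"
    and "deriv_matrix h x $ i $ j = partial_deriv j (\<lambda>x. h x $ i) x"
proof -
  have "(\<lambda>x. h x $ i) differentiable (at x)" for i
    using h x by (simp add: harmonic_map_on_def harmonic_on_def)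
  then have "h differentiable (at x)"
    by (subst differentiable_componentwise_within) (auto simp: Basis_vec_def inner_axis)
  then obtain h' where h': "(h has_derivative h') (at x)" by (auto simp: differentiable_def)
  have "deriv_matrix h x = matrix h'"
    by (simp add: deriv_matrix_def matrix_def partial_deriv_has_derivative(2)[OF h'])
  then have "(*v) (deriv_matrix h x) = h'"
    using matrix_vector_mul(2)[OF has_derivative_linear[OF h']] by simp
  with h' show "(h has_derivative (*v) (deriv_matrix h x)) (at x)" by simp
  have hi: "((\<lambda>x. h x $ i) has_derivative (\<lambda>v. h' v $ i)) (at x)"
    using bounded_linear.has_derivative[OF bounded_linear_vec_nth h'] .
  show "deriv_matrix h x $ i $ j = partial_deriv j (\<lambda>x. h x $ i) x"
    by (simp add: deriv_matrix_def partial_deriv_has_derivative(2)[OF h'] partial_deriv_has_derivative(2)[OF hi])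
qed

lemma harmonic_map_cont_deriv:
  fixes h :: "real^'n \<Rightarrow> real^'m"
  assumes h: "harmonic_map_on D h"
  shows "continuous_on D (deriv_matrix h)"
proof -
  have c: "continuous_on D (partial_deriv j (\<lambda>x. h x $ i))" for i j
    using h unfolding harmonic_map_on_def harmonic_on_def
    by (intro continuous_at_imp_continuous_on ballI differentiable_imp_continuous_within) blast
  have "continuous_on D (\<lambda>x. \<chi> i j. partial_deriv j (\<lambda>x. h x $ i) x)"
    by (intro continuous_on_vec_lambda c)
  then show ?thesis
    by (rule continuous_on_eq) (simp add: vec_eq_iff harmonic_map_has_derivative(2)[OF h])
qed

text \<open>The set where the dilatation inequality fails is open, as the derivative is continuous,
  and null by assumption; an open null set is empty.\<close>

lemma quasiconformal_imp_qc_map: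
  fixes h :: "real^'n \<Rightarrow> real^'n"
  assumes h: "harmonic_map_on G h" and K: "0 \<le> K" and qc: "quasiconformal K G (h ` G) h"
  shows "qc_map G h (deriv_matrix h) K"
proof
  let ?A = "deriv_matrix h"
  have G: "open G" using qc by (simp add: quasiconformal_def domain_set_def)
  then show "open G" .
  obtain g where "homeomorphism G (h ` G) h g" using qc by (auto simp: quasiconformal_def)
  then show "inj_on h G" by (metis homeomorphism_apply1 inj_on_inverseI)
  show "(h has_derivative (*v) (?A x)) (at x)" if "x \<in> G" for x
    using harmonic_map_has_derivative(1)[OF h that] .
  show cA: "continuous_on G ?A" by (rule harmonic_map_cont_deriv[OF h])
  show "0 \<le> K" by fact
  define B where "B = {x \<in> G. K * det (?A x) < onorm ((*v) (?A x)) ^ CARD('n)}"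
  have "open B"
  proof -
    have "open (G \<inter> (\<lambda>x. onorm ((*v) (?A x)) ^ CARD('n) - K * det (?A x)) -` {0<..})"
      unfolding det_def
      by (rule continuous_open_preimage[OF _ G open_greaterThan])
        (intro continuous_intros onorm_matrix_continuous cA)
    also have "G \<inter> (\<lambda>x. onorm ((*v) (?A x)) ^ CARD('n) - K * det (?A x)) -` {0<..} = B"
      by (auto simp: B_def)
    finally show ?thesis .
  qed
  moreover have "negligible B"
  proof -
    have "AE x in lebesgue. x \<notin> B"
      using qc unfolding quasiconformal_def B_def by (elim conjE) (erule AE_mp, auto intro!: AE_I2)
    then have "B \<in> null_sets lebesgue"
      using \<open>open B\<close> by (subst AE_iff_null_sets) auto
    then show ?thesis by (simp add: negligible_iff_null_sets)
  qed
  ultimately have "B = {}" using open_not_negligible by blast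
  then show "onorm ((*v) (?A x)) ^ CARD('n) \<le> K * det (?A x)" if "x \<in> G" for x
    using that by (force simp: B_def not_less)
qed

section \<open>Transport of the quasihyperbolic metric by \<open>h\<close> and by its
  inverse\<close>

context qc_map
begin

text \<open>If the image were the whole space, \<open>distortion_lower\<close> could be used with
  arbitrarily large \<open>R\<close>. A point \<open>y\<close> close to a boundary point
  \<open>z\<close> would then be closer to \<open>x\<close> than |x - z| / 4, which the triangle
  inequality forbids.\<close>

lemma image_ne_UNIV:
  assumes n: "CARD('n) \<ge> 2" and ne: "G \<noteq> {}" "G \<noteq> UNIV"
  shows "h ` G \<noteq> UNIV"
proof
  assume U: "h ` G = UNIV"
  obtain N where N: "admissible N" using admissible_exists[OF n] .
  obtain x where x: "x \<in> G" using ne by blast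
  have "frontier G \<noteq> {}" using ne frontier_eq_empty by auto
  then obtain z where z: "z \<in> frontier G" by blast
  then have zG: "z \<notin> G" using open_G by (simp add: frontier_def interior_open)
  have d: "dist x z > 0" using x zG by auto
  have "z \<in> closure G" using z by (simp add: frontier_def)
  then obtain y where y: "y \<in> G" "dist y z < dist x z / 4"
    using d unfolding closure_approachable by (meson divide_pos_pos zero_less_numeral)
  have "dist x y < dist x z / 4"
  proof (rule distortion_lower[OF n N x zG, where R = "2 ^ N * (dist (h x) (h y) + 1)"])
    show "0 < 2 ^ N * (dist (h x) (h y) + 1)" by (intro mult_pos_pos) (auto intro: add_nonneg_pos)
  qed (use U y in auto)
  then show False using y dist_triangle[of x z y] d by linarith
qed

lemma derivative_bound:
  assumes n: "CARD('n) \<ge> 2" and ne: "G \<noteq> {}" "G \<noteq> UNIV"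
    and harm: "harmonic_map_on G h" and A: "A = deriv_matrix h"
  obtains C where "0 < C"
    "\<And>x. x \<in> G \<Longrightarrow> stretch x \<le> C * bdist (h ` G) (h x) / bdist G x"
proof -
  obtain N where N: "admissible N" using admissible_exists[OF n] .
  let ?n = "real CARD('n)"
  \<comment> \<open>The first n * n passes from matrix entries to the operator norm, 2^N + 1 comes
    from \<open>distortion_upper\<close>, the remaining factors from
    \<open>harmonic_gradient_bound\<close> on a ball of radius \<open>d/4\<close>.\<close>
  define C where "C = ?n * ?n * ((?n + 1) * (2 ^ N + 1) * ?n * 4)"
  have C: "C > 0" by (simp add: C_def add_pos_pos)
  have imU: "h ` G \<noteq> UNIV" by (rule image_ne_UNIV[OF n ne])
  have "stretch x \<le> C * bdist (h ` G) (h x) / bdist G x"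
    if x: "x \<in> G" for x
  proof -
    define d where "d = bdist G x"
    have d: "d > 0" unfolding d_def using open_G ne x by (intro infdist_frontier_pos)
    have bG: "ball x d \<subseteq> G" unfolding d_def using x by (rule ball_infdist_frontier)
    have "frontier (h ` G) \<noteq> {}" using imU ne frontier_eq_empty by auto
    then obtain z where z: "z \<in> frontier (h ` G)" "bdist (h ` G) (h x) = dist (h x) z"
      using infdist_attains_inf[OF frontier_closed] by metis
    have zG: "z \<notin> h ` G" using z open_image by (simp add: frontier_def interior_open)
    define m where "m = dist (h x) z"
    have m: "m > 0" using zG x by (auto simp: m_def)
    have cb: "cball x (d/4) \<subseteq> G" using bG d by (auto simp: subset_iff)
    have near: "norm (h y - h x) \<le> (2 ^ N + 1) * m" if "y \<in> cball x (d/4)" for y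
    proof -
      have "norm (h y - z) < 2 ^ N * norm (h x - z)"
        using that by (intro distortion_upper[OF N d bG zG]) auto
      moreover have "norm (h y - h x) \<le> norm (h y - z) + norm (h x - z)"
        using norm_triangle_ineq4[of "h y - z" "h x - z"] by simp
      ultimately show ?thesis by (simp add: m_def dist_norm algebra_simps)
    qed
    have comp: "\<bar>A x $ i $ j\<bar> \<le> (?n + 1) * ((2 ^ N + 1) * m) * ?n / (d/4)" for i j
      unfolding A harmonic_map_has_derivative(2)[OF harm x]
    proof (rule harmonic_gradient_bound)
      show "harmonic_on G (\<lambda>x. h x $ i)" using harm by (simp add: harmonic_map_on_def)
      show "0 < (2 ^ N + 1) * m" using m by (intro mult_pos_pos) (auto intro: add_pos_pos)
      show "\<bar>h p $ i - h x $ i\<bar> \<le> (2 ^ N + 1) * m" if "p \<in> cball x (d/4)" for p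
        using near[OF that] component_le_norm_cart[of "h p - h x" i] by simp
    qed (use d cb in auto)
    have "stretch x \<le> ?n * ?n * ((?n + 1) * ((2 ^ N + 1) * m) * ?n / (d/4))"
      by (rule onorm_le_matrix_component[OF comp])
    also have "\<dots> = C * m / d" by (simp add: C_def)
    finally show ?thesis by (simp add: z(2) m_def d_def)
  qed
  with C show thesis by (rule that)
qed

text \<open>At a point of the curve the derivative bound is doubled to become strict. By continuity
  it then holds on a small ball, where the mean value inequality makes \<open>h\<close> Lipschitz;
  the doubling is the factor 2 in the conclusion.\<close>

lemma qh_join_image:
  assumes C: "0 < C" and ne: "G \<noteq> {}" "G \<noteq> UNIV" "h ` G \<noteq> UNIV"
    and bd: "\<And>x. x \<in> G \<Longrightarrow>
      stretch x \<le> C * bdist (h ` G) (h x) / bdist G x"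
    and j: "qh_join G x y c"
  shows "qh_join (h ` G) (h x) (h y) (2 * C * c)"
proof -
  obtain g B where q: "qh_param G g B" "pathstart g = x" "pathfinish g = y" "B 1 - B 0 \<le> c"
    using j unfolding qh_join_def by blast
  have p: "path g" "path_image g \<subseteq> G" and cB: "continuous_on {0..1} B"
    using q(1) unfolding qh_param_def by blast+
  have loc: "\<exists>e>0. \<forall>u v. straddles 0 1 t e u v \<longrightarrow>
      dist ((h \<circ> g) u) ((h \<circ> g) v) \<le> bdist (h ` G) ((h \<circ> g) t) * (2 * C * B v - 2 * C * B u)"
    if t: "t \<in> {0..1}" for t
  proof -
    define p0 where "p0 = g t"
    define d where "d = bdist G p0"
    define m where "m = bdist (h ` G) (h p0)"
    define L where "L = 2 * C * m / d"
    have p0: "p0 \<in> G" using p t by (auto simp: p0_def path_image_def)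
    have d: "d > 0" unfolding d_def using open_G ne p0 by (intro infdist_frontier_pos)
    have m: "m > 0" unfolding m_def using open_image ne p0 by (intro infdist_frontier_pos) auto
    have "stretch p0 \<le> C * m / d" using bd[OF p0] by (simp add: d_def m_def)
    also have "\<dots> < L" using C d m by (simp add: L_def divide_strict_right_mono)
    finally have L: "stretch p0 < L" .
    have "open (G \<inter> stretch -` {..<L})"
      by (rule continuous_open_preimage[OF onorm_matrix_continuous[OF cont_A] open_G open_lessThan])
    moreover have "p0 \<in> G \<inter> stretch -` {..<L}" using p0 L by simp
    ultimately obtain e where e: "e > 0" "ball p0 e \<subseteq> G \<inter> stretch -` {..<L}"
      unfolding open_contains_ball by blast
    have lip: "norm (h a - h b) \<le> L * norm (a - b)" if "a \<in> ball p0 e" "b \<in> ball p0 e" for a b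
    proof (rule differentiable_bound[of "ball p0 e" h "\<lambda>x. (*v) (A x)"])
      fix w assume w: "w \<in> ball p0 e"
      then have "w \<in> G" "stretch w < L" using e(2) by auto
      then show "(h has_derivative (*v) (A w)) (at w within ball p0 e)" "stretch w \<le> L"
        by (auto intro: has_derivative_at_withinI der_h)
    qed (use that in auto)
    obtain e1 where e1: "e1 > 0" "\<And>s. s \<in> {0..1} \<Longrightarrow> dist s t < e1 \<Longrightarrow> dist (g s) (g t) < e"
      using p(1) t e(1) unfolding path_def continuous_on_iff by blast
    obtain e2 where e2: "e2 > 0" "\<And>u v. 0 \<le> u \<Longrightarrow> u \<le> t \<Longrightarrow> t \<le> v \<Longrightarrow> v \<le> 1 \<Longrightarrow> v - u < e2 \<Longrightarrow>
      dist (g u) (g v) \<le> bdist G (g t) * (B v - B u)"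
      using qh_paramD[OF q(1) t] by blast
    have "dist (h (g u)) (h (g v)) \<le> m * (2 * C * B v - 2 * C * B u)"
      if uv: "0 \<le> u" "u \<le> t" "t \<le> v" "v \<le> 1" "v - u < min e1 e2" for u v
    proof -
      have "g u \<in> ball p0 e" "g v \<in> ball p0 e"
        using uv e1(2)[of u] e1(2)[of v] by (auto simp: p0_def dist_commute dist_real_def)
      then have "dist (h (g u)) (h (g v)) \<le> L * dist (g u) (g v)" using lip by (simp add: dist_norm)
      also have "\<dots> \<le> L * (d * (B v - B u))"
        using e2(2)[of u v] uv C m d by (intro mult_left_mono) (auto simp: d_def p0_def L_def)
      also have "\<dots> = m * (2 * C * B v - 2 * C * B u)" 
      proof -
        have "L * d = 2 * C * m" using d by (simp add: L_def)
        then have "L * (d * (B v - B u)) = 2 * C * m * (B v - B u)" by (simp add: mult.assoc[symmetric])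
        then show ?thesis by (simp add: algebra_simps)
      qed
      finally show ?thesis .
    qed
    then show ?thesis
      using e1(1) e2(1) unfolding m_def p0_def o_def by (intro exI[of _ "min e1 e2"]) auto
  qed
  have "qh_param (h ` G) (h \<circ> g) (\<lambda>t. 2 * C * B t)"
    unfolding qh_param_def
  proof (intro conjI ballI loc)
    show "path (h \<circ> g)" using p by (intro path_continuous_image continuous_on_subset[OF cont_h])
    show "path_image (h \<circ> g) \<subseteq> h ` G" using p(2) by (auto simp: path_image_compose)
  qed (auto intro!: continuous_intros cB)
  moreover have "2 * C * B 1 - 2 * C * B 0 \<le> 2 * C * c"
    using q(4) C by (simp add: right_diff_distrib[symmetric] mult.assoc)
  ultimately show ?thesis
    unfolding qh_join_def using q(2,3)
    by (intro exI[of _ "h \<circ> g"] exI[of _ "\<lambda>t. 2 * C * B t"]) (auto simp: pathstart_compose pathfinish_compose)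
qed

text \<open>Such a small increment of \<open>B\<close> keeps the curve within the distance that
  \<open>distortion_lower\<close> allows for a ball of half the boundary distance, and then the
  preimages are joined by a segment.\<close>

lemma qh_join_preimage_step:
  assumes n: "CARD('n) \<ge> 2" and N: "admissible N" and ne: "G \<noteq> UNIV" "h ` G \<noteq> UNIV"
    and q: "qh_param (h ` G) g B" and t: "0 \<le> t1" "t1 \<le> t2" "t2 \<le> 1"
    and xy: "x \<in> G" "y \<in> G" "h x = g t1" "h y = g t2" and small: "B t2 - B t1 \<le> 1 / (2 ^ N * 8)"
  shows "qh_join G x y 1"
proof -
  let ?d = "\<lambda>t. bdist (h ` G) (g t)"
  define d :: real where "d = 1 / (2 ^ N * 2)"
  have d: "0 < d" "d \<le> 1" by (simp_all add: d_def divide_le_eq_1 mult_ge1_I)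
  have p: "path g" "path_image g \<subseteq> h ` G" using q unfolding qh_param_def by blast+
  have t1G: "g t1 \<in> h ` G" using xy(1,3) by (metis imageI)
  have d1: "?d t1 > 0" by (rule infdist_frontier_pos[OF open_image ne(2) t1G])
  have close: "dist (g t1) (g t2) \<le> d * ?d t1"
  proof (rule ccontr)
    assume "\<not> ?thesis"
    then have far: "d * ?d t1 < dist (g t1) (g t2)" by simp
    have c: "continuous_on {t1..t2} (\<lambda>t. dist (g t1) (g t))"
      using p(1) t unfolding path_def
      by (intro continuous_intros) (auto elim: continuous_on_subset)
    define Z where "Z = {t1..t2} \<inter> (\<lambda>t. dist (g t1) (g t)) -` {d * ?d t1..}"
    have "closed Z" unfolding Z_def by (rule continuous_closed_preimage[OF c]) auto
    then have "compact Z" unfolding Z_def by (metis bounded_Int bounded_closed_interval compact_eq_bounded_closed cbox_interval)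
    moreover have "t2 \<in> Z" using far t by (simp add: Z_def)
    \<comment> \<open>At the first parameter where the curve has moved \<open>d * ?d t1\<close>, the
      boundary distance has been at most \<open>2 * ?d t1\<close> all along, so the increment allows
      only half of that distance.\<close>
    ultimately obtain s where s: "s \<in> Z" "\<And>t. t \<in> Z \<Longrightarrow> s \<le> t"
      using compact_attains_inf[of Z] by blast
    have st: "t1 \<le> s" "s \<le> t2" "d * ?d t1 \<le> dist (g t1) (g s)" using s(1) by (auto simp: Z_def)
    have eqs: "dist (g t1) (g s) = d * ?d t1"
    proof (rule ccontr)
      assume "\<not> ?thesis"
      then have gt: "d * ?d t1 < dist (g t1) (g s)" using st by simp
      have "continuous_on {t1..s} (\<lambda>t. dist (g t1) (g t))" using c by (rule continuous_on_subset) (use st in auto)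
      then obtain r where "t1 \<le> r" "r \<le> s" "dist (g t1) (g r) = d * ?d t1"
        using IVT'[of "\<lambda>t. dist (g t1) (g t)" t1 "d * ?d t1" s] gt st d d1 by auto
      then show False using s(2)[of r] gt st by (auto simp: Z_def)
    qed
    have "dist (g t1) (g s) \<le> (2 * ?d t1) * (B s - B t1)"
    proof (rule qh_param_dist_le[OF q open_image ne(2)])
      fix r assume r: "r \<in> {t1..s}"
      have "dist (g t1) (g r) \<le> d * ?d t1"
      proof (cases "r = s")
        case False
        then have "r \<notin> Z" using s(2)[of r] r by auto
        then show ?thesis using r st by (auto simp: Z_def)
      qed (use eqs in simp)
      also have "\<dots> \<le> 1 * ?d t1" using d d1 by (intro mult_right_mono) auto
      finally show "?d r \<le> 2 * ?d t1"
        using infdist_triangle[of "g r" "frontier (h ` G)" "g t1"] by (simp add: dist_commute)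
    qed (use st t in auto)
    also have "\<dots> \<le> (2 * ?d t1) * (1 / (2 ^ N * 8))"
      using small qh_param_mono[OF q open_image ne(2), of s t2] st t d1
      by (intro mult_left_mono) auto
    also have "\<dots> < d * ?d t1" using d1 by (simp add: d_def field_simps)
    finally show False using eqs by simp
  qed
  have "frontier G \<noteq> {}" using ne xy frontier_eq_empty by auto
  then obtain z where z: "z \<in> frontier G" "bdist G x = dist x z"
    using infdist_attains_inf[OF frontier_closed] by metis
  have zG: "z \<notin> G" using z open_G by (simp add: frontier_def interior_open)
  have "dist x y < dist x z / 4"
  proof (rule distortion_lower[OF n N xy(1) zG, where R = "?d t1 / 2"])
    have "cball (h x) (?d t1 / 2) \<subseteq> ball (h x) (?d t1)" using d1 by auto
    also have "\<dots> \<subseteq> h ` G" using ball_infdist_frontier[OF t1G] xy(3) by simp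
    finally show "cball (h x) (?d t1 / 2) \<subseteq> h ` G" .
    show "dist (h x) (h y) \<le> ?d t1 / 2 / 2 ^ N" using close xy by (simp add: d_def mult.commute)
  qed (use d1 xy in auto)
  then have "dist x y \<le> bdist G x / 2" unfolding z(2) using zero_le_dist[of x z] by linarith
  then show ?thesis using open_G ne xy by (intro qh_join_segment)
qed

text \<open>The curve is cut whenever \<open>B\<close> has grown by \<open>k\<close>, and each piece
  costs one segment join. The summand 2, from rounding \<open>c / k\<close> up and from the last
  piece, is the source of the additive constant in the pseudo-isometry.\<close>

lemma qh_join_preimage:
  assumes n: "CARD('n) \<ge> 2" and N: "admissible N" and ne: "G \<noteq> UNIV" "h ` G \<noteq> UNIV"
    and xy: "x \<in> G" "y \<in> G" and j: "qh_join (h ` G) (h x) (h y) c"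
  shows "qh_join G x y (2 ^ N * 8 * c + 2)"
proof -
  obtain g B where q: "qh_param (h ` G) g B" "pathstart g = h x" "pathfinish g = h y" "B 1 - B 0 \<le> c"
    using j unfolding qh_join_def by blast
  have p: "path_image g \<subseteq> h ` G" and cB: "continuous_on {0..1} B"
    using q(1) unfolding qh_param_def by blast+
  define k :: real where "k = 1 / (2 ^ N * 8)"
  have k: "k > 0" by (simp add: k_def)
  have main: "qh_join G x' y' (real m + 1)"
    if "0 \<le> t1" "t1 \<le> t2" "t2 \<le> 1" "x' \<in> G" "y' \<in> G" "h x' = g t1" "h y' = g t2" "B t2 - B t1 \<le> real m * k"
    for t1 t2 x' y' m
    using that
  proof (induction m arbitrary: t1 x')
    case 0
    have "B t2 - B t1 \<le> 0" using 0(8) by simp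
    also have "0 \<le> (1::real) / (2 ^ N * 8)" by simp
    finally have "B t2 - B t1 \<le> 1 / (2 ^ N * 8)" .
    then show ?case using qh_join_preimage_step[OF n N ne q(1) 0(1-7)] by simp
  next
    case (Suc m)
    show ?case
    proof (cases "B t2 - B t1 \<le> k")
      case True
      then have "qh_join G x' y' 1"
        using qh_join_preimage_step[OF n N ne q(1) Suc.prems(1-7)] by (simp add: k_def)
      then show ?thesis by (rule qh_join_mono) simp
    next
      case False
      have "continuous_on {t1..t2} B" using cB by (rule continuous_on_subset) (use Suc.prems in auto)
      then obtain s where s: "t1 \<le> s" "s \<le> t2" "B s = B t1 + k"
        using IVT'[of B t1 "B t1 + k" t2] False k Suc.prems by auto
      have "g s \<in> h ` G" using p s Suc.prems by (auto simp: path_image_def)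
      then obtain w where w: "w \<in> G" "h w = g s" by auto
      have "qh_join G x' w 1"
        using qh_join_preimage_step[OF n N ne q(1) Suc.prems(1) s(1) _ Suc.prems(4) w(1) Suc.prems(6) w(2)]
          s Suc.prems by (simp add: k_def)
      moreover have "qh_join G w y' (real m + 1)"
        using s Suc.prems w by (intro Suc.IH[of s w]) (auto simp: algebra_simps)
      ultimately have "qh_join G x' y' (1 + (real m + 1))" by (rule qh_join_trans)
      then show ?thesis by (simp add: add.commute add.left_commute)
    qed
  qed
  have c0: "0 \<le> c" using qh_param_mono[OF q(1) open_image ne(2), of 0 1] q(4) by simp
  define m where "m = nat \<lceil>c / k\<rceil>"
  have m: "c / k \<le> real m" "real m \<le> c / k + 1"
    using c0 k by (auto simp: m_def)
  have "qh_join G x y (real m + 1)"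
  proof (rule main[of 0 1])
    have "c \<le> real m * k" using m(1) k by (simp add: field_simps)
    then show "B 1 - B 0 \<le> real m * k" using q(4) by simp
  qed (use xy q in \<open>auto simp: pathstart_def pathfinish_def\<close>)
  then show ?thesis
    by (rule qh_join_mono) (use m(2) in \<open>simp add: k_def mult.commute\<close>)
qed

end

lemma quasihyperbolic_nonneg:
  assumes j: "qh_join D x y c" and D: "open D" "D \<noteq> UNIV"
  shows "0 \<le> quasihyperbolic D x y"
proof (rule ccontr)
  assume "\<not> ?thesis"
  \<comment> \<open>Halving a negative number increases it; the factor 2 of
    \<open>qh_join_of_quasihyperbolic\<close> then yields a parametrization with negative total
    increment.\<close>
  then have "quasihyperbolic D x y < quasihyperbolic D x y / 2" by simp
  from qh_join_of_quasihyperbolic[OF j D this]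
  obtain g B where "qh_param D g B" "B 1 - B 0 \<le> 2 * (quasihyperbolic D x y / 2)"
    unfolding qh_join_def by blast
  with qh_param_mono[OF _ D, of g B 0 1] \<open>\<not> ?thesis\<close> show False by force
qed

theorem corollary2p21:
  fixes G :: "(real^'n) set" and h :: "real^'n \<Rightarrow> real^'n" and K :: real
  assumes "CARD('n) \<ge> 2"
    and "domain_set G" and "G \<noteq> UNIV"
    and "K \<ge> 1"
    and "harmonic_map_on G h"
    and "quasiconformal K G (h ` G) h"
  shows "pseudo_isometry G (quasihyperbolic G) (h ` G) (quasihyperbolic (h ` G)) h"
proof -
  interpret qc_map G h "deriv_matrix h" K
    using assms by (intro quasiconformal_imp_qc_map) auto
  have G: "open G" "connected G" "G \<noteq> {}" using assms(2) by (auto simp: domain_set_def)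
  have imU: "h ` G \<noteq> UNIV" by (rule image_ne_UNIV[OF assms(1) G(3) assms(3)])
  obtain N where N: "admissible N" using admissible_exists[OF assms(1)] .
  obtain C where C: "0 < C" "\<And>x. x \<in> G \<Longrightarrow> onorm ((*v) (deriv_matrix h x)) \<le>
      C * bdist (h ` G) (h x) / bdist G x"
    using derivative_bound[OF assms(1) G(3) assms(3,5) refl] by blast
  have image: "qh_join (h ` G) (h x) (h y) (2 * C * c)" if "qh_join G x y c" for x y c
    by (rule qh_join_image[OF C(1) G(3) assms(3) imU _ that]) (rule C(2))
  note preimage = qh_join_preimage[OF assms(1) N assms(3) imU]
  \<comment> \<open>64 = 4 * 8 * 2, from \<open>quasihyperbolic_le\<close>,
    \<open>qh_join_preimage\<close> and \<open>qh_join_of_quasihyperbolic\<close>; the factor 16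
    below is 4 * 2 * 2 with \<open>qh_join_image\<close> in the middle, and the additive 8 is 4 *
    2.\<close>
  define L :: real where "L = 2 ^ N * 64"
  define a where "a = max (16 * C) L"
  have a: "a > 0" "16 * C \<le> a" "L \<le> a" using C(1) by (auto simp: a_def)
  have "inverse a * quasihyperbolic G x y - 8 / a \<le> quasihyperbolic (h ` G) (h x) (h y)
      \<and> quasihyperbolic (h ` G) (h x) (h y) \<le> a * quasihyperbolic G x y"
    if xy: "x \<in> G" "y \<in> G" for x y
  proof -
    let ?k = "quasihyperbolic G x y" and ?k' = "quasihyperbolic (h ` G) (h x) (h y)"
    obtain c where c: "qh_join G x y c"
      using qh_join_exists[OF G(1) assms(3) G(2) xy] .
    note c' = image[OF c]
    have pos: "0 \<le> ?k" "0 \<le> ?k'"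
      using quasihyperbolic_nonneg[OF c G(1) assms(3)] quasihyperbolic_nonneg[OF c' open_image imU] by auto
    have "?k' \<le> 16 * C * ?k + d" if d: "0 < d" for d
    proof -
      \<comment> \<open>The infimum need not be attained, so the estimates are proved with a slack
        that is then sent to 0.\<close>
      define e where "e = d / (16 * C)"
      have "?k < ?k + e" using d C(1) by (simp add: e_def)
      from quasihyperbolic_le[OF image[OF qh_join_of_quasihyperbolic[OF c G(1) assms(3) this]] open_image imU]
      have "?k' \<le> 16 * C * (?k + e)" by (simp add: algebra_simps)
      also have "\<dots> = 16 * C * ?k + d" using C(1) by (simp add: e_def distrib_left)
      finally show ?thesis .
    qed
    then have "?k' \<le> 16 * C * ?k" by (rule field_le_epsilon)
    also have "\<dots> \<le> a * ?k" using a pos by (intro mult_right_mono) auto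
    finally have up: "?k' \<le> a * ?k" .
    have "?k \<le> L * ?k' + 8 + d" if d: "0 < d" for d
    proof -
      define e where "e = d / L"
      have "?k' < ?k' + e" using d by (simp add: e_def L_def)
      from quasihyperbolic_le[OF preimage[OF xy qh_join_of_quasihyperbolic[OF c' open_image imU this]] G(1) assms(3)]
      have "?k \<le> L * (?k' + e) + 8" by (simp add: L_def algebra_simps)
      also have "\<dots> = L * ?k' + 8 + d" by (simp add: e_def distrib_left L_def)
      finally show ?thesis .
    qed
    then have "?k \<le> L * ?k' + 8" by (rule field_le_epsilon)
    also have "L * ?k' \<le> a * ?k'" using a pos by (intro mult_right_mono) auto
    finally have "?k \<le> a * ?k' + 8" by simp
    then have "inverse a * ?k - 8 / a \<le> ?k'" using a(1) by (simp add: field_simps)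
    with up show ?thesis by simp
  qed
  then show ?thesis
    unfolding pseudo_isometry_def using a(1)
    by (intro conjI exI[of _ a] exI[of _ "8 / a"]) auto
qed

end
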